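(* Let $K>0$ be a fixed constant and let $F_1,F_2$ be distribution functions of random variables bounded in absolute value by $K$, with variances $\sigma_1^2$ and $\sigma_2^2$ respectively. For each $n$, let $m=m(n)\ge 2$ be an integer and let $V_1,\ldots,V_m$ be a partition of $[n]=\{1,\ldots,n\}$ with $|V_k|=n\nu_k$, where $\nu_k=\nu_k(n)$, $k=1,\ldots,m$. Let $\mathbf{A}_n=(a_{ij})_{1\le i,j\le n}$ be a random real symmetric matrix ($a_{ij}=a_{ji}$) whose entries $a_{ij}$, $1\le i\le j\le n$, are independent, where $a_{ij}$ has distribution $F_1$ if $i$ and $j$ lie in the same part $V_k$, and distribution $F_2$ if $i\in V_k$ and $j\in[n]\setminus V_k$ for some $k$; in particular $|a_{ij}|\le K$. Let $\mathbf{B}_n=\frac{1}{2\sqrt n}\mathbf{A}_n$ and let $\Psi_n(x)$ be the empirical spectral distribution of $\mathbf{B}_n$, i.e. $\Psi_n(x)=\frac1n\#\{k:\lambda_{k,n}\le x\}$ where $\lambda_{1,n},\ldots,\lambda_{n,n}$ are the eigenvalues of $\mathbf{B}_n$. (i) If $\lim_{n\to\infty}\max\{\nu_1(n),\ldots,\nu_m(n)\}>0$ and $\lim_{n\to\infty}\nu_i(n)/\nu_j(n)=1$ for all $1\le i,j\le m$, then $\lim_{n\to\infty}\Psi_n(x)=\Psi(x)$ almost surely, where $\Psi$ is the distribution with density $$\psi(x)=\begin{cases}\dfrac{2m}{\pi(\sigma_1^2+(m-1)\sigma_2^2)}\sqrt{\dfrac{\sigma_1^2+(m-1)\sigma_2^2}{m}-x^2},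 & |x|\le\sqrt{\dfrac{\sigma_1^2+(m-1)\sigma_2^2}{m}},\\[2mm] 0, & \text{otherwise.}\end{cases}$$ (ii) If $\lim_{n\to\infty}\max\{\nu_1(n),\ldots,\nu_m(n)\}=0$, then $\lim_{n\to\infty}\Psi_n(x)=\Phi(x)$ almost surely, where $\Phi$ is the distribution with density $\phi(x)=\frac{2}{\pi\sigma_2^2}\sqrt{\sigma_2^2-x^2}$ for $|x|\le\sigma_2$ and $\phi(x)=0$ for $|x|>\sigma_2$.
   Context: The empirical spectral distribution (ESD) of a real symmetric $n\times n$ matrix with eigenvalues $\lambda_1,\ldots,\lambda_n$ is $x\mapsto \frac1n\#\{k:\lambda_k\le x\}$. *)

theory Defs
  imports "HOL-Probability.Probability" "Jordan_Normal_Form.Char_Poly"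
begin

text \<open>The roots of the characteristic polynomial are counted with multiplicity
  (\<^const>\<open>proots\<close> is a multiset); for a real symmetric matrix these are all \<open>n\<close> eigenvalues.\<close>

definition eigenvalues_mset :: "real mat \<Rightarrow> real multiset" where
  "eigenvalues_mset B = proots (char_poly B)"

definition esd :: "real mat \<Rightarrow> real \<Rightarrow> real" where
  "esd B x = real (size (filter_mset (\<lambda>l. l \<le> x) (eigenvalues_mset B))) / real (dim_row B)"

definition bounded_distribution_function :: "real \<Rightarrow> real \<Rightarrow> (real \<Rightarrow> real) \<Rightarrow> bool" where
  "bounded_distribution_function K \<sigma> F \<longleftrightarrow>
     (\<exists>\<mu>. real_distribution \<mu> \<and> cdf \<mu> = F \<and> (AE x in \<mu>. \<bar>x\<bar> \<le> K) \<and>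
          prob_space.variance \<mu> (\<lambda>x. x) = \<sigma>\<^sup>2)"

definition has_distribution_function ::
    "'w measure \<Rightarrow> ('w \<Rightarrow> real) \<Rightarrow> (real \<Rightarrow> real) \<Rightarrow> bool" where
  "has_distribution_function M X F \<longleftrightarrow>
     X \<in> borel_measurable M \<and> cdf (distr M borel X) = F"

definition part_fraction :: "(nat \<Rightarrow> nat \<Rightarrow> nat set) \<Rightarrow> nat \<Rightarrow> nat \<Rightarrow> real" where
  "part_fraction V n k = real (card (V n k)) / real n"

text \<open>Entries are indexed from 1, matrices of type \<^typ>\<open>real mat\<close> from 0.\<close>

definition scaled_matrix :: "(nat \<Rightarrow> nat \<Rightarrow> nat \<Rightarrow> 'w \<Rightarrow> real) \<Rightarrow> nat \<Rightarrow> 'w \<Rightarrow> real mat" where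
  "scaled_matrix a n \<omega> =
     (1 / (2 * sqrt (real n))) \<cdot>\<^sub>m mat n n (\<lambda>(i, j). a n (Suc i) (Suc j) \<omega>)"

definition psi_density :: "real \<Rightarrow> real \<Rightarrow> nat \<Rightarrow> real \<Rightarrow> real" where
  "psi_density \<sigma>1 \<sigma>2 m x =
     (if \<bar>x\<bar> \<le> sqrt ((\<sigma>1\<^sup>2 + (real m - 1) * \<sigma>2\<^sup>2) / real m)
      then 2 * real m / (pi * (\<sigma>1\<^sup>2 + (real m - 1) * \<sigma>2\<^sup>2)) *
             sqrt ((\<sigma>1\<^sup>2 + (real m - 1) * \<sigma>2\<^sup>2) / real m - x\<^sup>2)
      else 0)"

definition phi_density :: "real \<Rightarrow> real \<Rightarrow> real" where
  "phi_density \<sigma>2 x =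
     (if \<bar>x\<bar> \<le> \<sigma>2 then 2 / (pi * \<sigma>2\<^sup>2) * sqrt (\<sigma>2\<^sup>2 - x\<^sup>2) else 0)"

definition cdf_of_density :: "(real \<Rightarrow> real) \<Rightarrow> real \<Rightarrow> real" where
  "cdf_of_density f = cdf (density lborel (\<lambda>x. ennreal (f x)))"

end

theory Submission
  imports Defs "HOL-Real_Asymp.Real_Asymp" "Jordan_Normal_Form.Schur_Decomposition"
begin

text \<open>
  Everything is read off from the Stieltjes transform at the purely imaginary points \<open>\<i>y\<close>, i.e. from the
  normalised trace of the resolvent \<open>G = (B - \<i>y)\<^sup>-\<^sup>1\<close>. For a centred matrix with independent entries, the
  Schur complement formula expresses \<open>1/G\<^sub>i\<^sub>i\<close> as \<open>- \<i>y\<close> minus a quadratic form in the \<open>i\<close>-th row whose kernel is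
  independent of that row; the form concentrates around \<open>\<Sum>\<^sub>j v\<^sub>i\<^sub>j G\<^sub>j\<^sub>j\<close>, where \<open>v\<^sub>i\<^sub>j\<close> is the variance of the
  entry. Both limits \<open>\<nu> = 1/m\<close> and \<open>\<nu> = 0\<close> of the block sizes make all row sums of the variances
  asymptotically equal to \<open>s/4\<close> with \<open>s = \<nu>\<sigma>\<^sub>1\<^sup>2 + (1 - \<nu>)\<sigma>\<^sub>2\<^sup>2\<close>, so for large \<open>y\<close> a contraction argument gives
  \<open>E|G\<^sub>i\<^sub>i - g| \<longlonglongrightarrow> 0\<close> uniformly in \<open>i\<close>, where \<open>g(- \<i>y - (s/4) g) = 1\<close> is the equation of the semicircle
  distribution of variance \<open>s/4\<close>. Nothing is assumed about the joint law of matrices of different sizes,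
  so almost sure convergence needs summable tails: changing one entry moves the normalised trace by
  \<open>O(n\<^sup>-\<^sup>3\<^sup>/\<^sup>2)\<close>, and the bounded differences inequality yields tails exponentially small in \<open>n\<close>.

  The mean matrix is a constant matrix plus a multiple of the block indicator matrix. The former has rank one;
  the latter has bounded rank in case (i), and small Frobenius norm in case (ii). Neither affects the limit
  of the normalised trace. Finally, the values of the Stieltjes transform at \<open>\<i>(y + k)\<close>, \<open>k \<in> \<nat>\<close>, are a sequence of
  Laplace transforms of the characteristic function and hence determine the measure.
\<close>


subsection \<open>The semicircle distribution\<close>

text \<open>The point \<open>\<i>y\<close> stays at a fixed distance from the real axis, so every
  resolvent bound is a fixed power of 1/y. The contraction factor is n \<beta>^2 / y^2, where
  \<beta> = K / sqrt n bounds the centred scaled entries, so it equals K^2 / y^2. Hence the choice y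
  = 2 K, which serves all points y + k as well; only countably many points occur, so their null sets
  can be united. Cancellation of mean-zero terms and concentration are both carried out on the
  product of the entry laws, where Fubini replaces conditioning. There a coordinate may take any
  real value, whereas the entries are bounded only almost surely; truncation to [-K, K] repairs this
  without changing the laws. The 4 in s/4 is the square of the 2 in the normalisation 2 sqrt n. In
  case (i) the number of blocks may depend on n. The block fractions sum to 1 and are asymptotically
  equal, which forces that number to be eventually constant, and this is what bounds the rank of the
  mean. In case (ii) the rank is unbounded and only the Frobenius norm is available.\<close>

definition semicircle_density :: "real \<Rightarrow> real \<Rightarrow> real" where
  "semicircle_density s x = (if \<bar>x\<bar> \<le> sqrt s then 2 / (pi * s) * sqrt (s - x\<^sup>2) else 0)"

definition semicircle :: "real \<Rightarrow> real measure" where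
  "semicircle s = density lborel (\<lambda>x. ennreal (semicircle_density s x))"

lemma semicircle_density_measurable [measurable]: "semicircle_density s \<in> borel_measurable borel"
  unfolding semicircle_density_def by measurable

lemma semicircle_density_minus [simp]: "semicircle_density s (- x) = semicircle_density s x"
  by (simp add: semicircle_density_def)

lemma semicircle_density_nonneg: "s > 0 \<Longrightarrow> semicircle_density s x \<ge> 0"
  using real_le_rsqrt[of "\<bar>x\<bar>" s] abs_le_square_iff[of x "sqrt s"]
  by (auto simp: semicircle_density_def)

lemma abs_less_sqrt_imp_sq_less:
  fixes x s :: real
  assumes "s > 0" "x \<in> {- sqrt s<..<sqrt s}"
  shows "x\<^sup>2 < s"
  using assms real_less_rsqrt[of x s] real_sqrt_less_iff[of "x\<^sup>2" s]
  by (auto simp: abs_less_iff)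

text \<open>The two summands of the antiderivative are not differentiable at the endpoints, hence
  the form of the fundamental theorem that asks for continuity up to the boundary and derivatives
  only inside.\<close>

lemma has_integral_semicircle_density:
  assumes s: "s > 0"
  shows "(semicircle_density s has_integral 1) UNIV"
proof -
  define R where "R = sqrt s"
  have R: "R > 0" "R\<^sup>2 = s" using s by (auto simp: R_def)
  define F where "F x = (x * sqrt (s - x\<^sup>2) + s * arcsin (x / R)) / (pi * s)" for x
  have "((\<lambda>x. 2 / (pi * s) * sqrt (s - x\<^sup>2)) has_integral F R - F (- R)) {- R..R}"
  proof (rule fundamental_theorem_of_calculus_interior)
    show "continuous_on {- R..R} F"
      unfolding F_def using R s by (intro continuous_intros) (auto simp: divide_simps)
    fix x assume x: "x \<in> {- R<..<R}"
    have x2: "x\<^sup>2 < s" using x s abs_less_sqrt_imp_sq_less by (auto simp: R_def)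
    have "sqrt (1 - (x / R)\<^sup>2) = sqrt (s - x\<^sup>2) / R"
      using R s by (simp add: R_def power_divide real_sqrt_divide[symmetric] diff_divide_distrib)
    moreover have "s = sqrt (s - x\<^sup>2) * sqrt (s - x\<^sup>2) + x * x"
      using x2 by (simp add: power2_eq_square)
    moreover have "(F has_real_derivative (1 * sqrt (s - x\<^sup>2) + inverse (sqrt (s - x\<^sup>2)) / 2 * (- (2 * x)) * x +
        s * (inverse (sqrt (1 - (x / R)\<^sup>2)) * (1 / R))) / (pi * s)) (at x)"
      unfolding F_def
    proof (intro DERIV_cdivide DERIV_add DERIV_mult DERIV_cmult DERIV_ident)
      show "((\<lambda>x. sqrt (s - x\<^sup>2)) has_real_derivative inverse (sqrt (s - x\<^sup>2)) / 2 * (- (2 * x))) (at x)"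
        by (rule DERIV_real_sqrt[THEN DERIV_chain2]) (use x2 in \<open>auto intro!: derivative_eq_intros\<close>)
      show "((\<lambda>x. arcsin (x / R)) has_real_derivative inverse (sqrt (1 - (x / R)\<^sup>2)) * (1 / R)) (at x)"
        by (rule DERIV_arcsin[THEN DERIV_chain2]) (use x R in \<open>auto intro!: derivative_eq_intros simp: divide_simps\<close>)
    qed
    moreover define w where "w = sqrt (s - x\<^sup>2)"
    moreover have "w > 0" using x2 by (simp add: w_def)
    ultimately have "(F has_real_derivative 2 / (pi * s) * w) (at x)"
      using R s by (elim DERIV_cong) (simp add: field_simps)
    then show "(F has_vector_derivative 2 / (pi * s) * sqrt (s - x\<^sup>2)) (at x)"
      by (simp add: has_real_derivative_iff_has_vector_derivative \<open>w = sqrt (s - x\<^sup>2)\<close>)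
  qed (use R in auto)
  also have "F R - F (- R) = 1"
    using R s by (simp add: F_def add_divide_distrib[symmetric])
  finally have "(semicircle_density s has_integral 1) {- R..R}"
    by (rule has_integral_eq[rotated]) (auto simp: semicircle_density_def R_def)
  then show ?thesis
    by (rule has_integral_on_superset) (auto simp: semicircle_density_def R_def)
qed

text \<open>The factor y / (x^2 + y^2) is the imaginary part of 1 / (x - iy). With w = sqrt (s -
  x^2), the identity w / (x^2 + y^2) = ((y^2 + s) / (x^2 + y^2) - 1) / w splits the integrand into
  derivatives of two arcsines.\<close>

lemma has_integral_semicircle_Poisson:
  assumes s: "s > 0" and y: "y > 0"
  shows "((\<lambda>x. semicircle_density s x * (y / (x\<^sup>2 + y\<^sup>2))) has_integral 2 * (sqrt (y\<^sup>2 + s) - y) / s) UNIV"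
proof -
  define R where "R = sqrt s"
  have R: "R > 0" "R\<^sup>2 = s" using s by (auto simp: R_def)
  define c where "c = sqrt (y\<^sup>2 + s)"
  have c: "c > 0" "c\<^sup>2 = y\<^sup>2 + s" using s y by (auto simp: c_def add_pos_pos)
  \<comment> \<open>\<open>u\<close> runs from -1 to 1 over [-R, R], and the derivative of arcsin u
    is c y / ((x^2 + y^2) w), the first of the two terms up to the factor c / y.\<close>
  define u where "u x = x * c / (R * sqrt (x\<^sup>2 + y\<^sup>2))" for x
  define F where "F x = 2 * y / (pi * s) * (- arcsin (x / R) + c / y * arcsin (u x))" for x
  have pos: "x\<^sup>2 + y\<^sup>2 > 0" for x using y by (simp add: add_nonneg_pos)
  have u2: "1 - (u x)\<^sup>2 = (y\<^sup>2 * (s - x\<^sup>2)) / (s * (x\<^sup>2 + y\<^sup>2))" for x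
  proof -
    have "(u x)\<^sup>2 = x\<^sup>2 * (y\<^sup>2 + s) / (s * (x\<^sup>2 + y\<^sup>2))"
      using pos[of x] by (simp add: u_def power_divide power_mult_distrib R c)
    also have "1 - \<dots> = (s * (x\<^sup>2 + y\<^sup>2) - x\<^sup>2 * (y\<^sup>2 + s)) / (s * (x\<^sup>2 + y\<^sup>2))"
      using y s by (subst diff_divide_distrib) simp
    also have "s * (x\<^sup>2 + y\<^sup>2) - x\<^sup>2 * (y\<^sup>2 + s) = y\<^sup>2 * (s - x\<^sup>2)"
      by (simp add: algebra_simps)
    finally show ?thesis .
  qed
  have "((\<lambda>x. 2 / (pi * s) * sqrt (s - x\<^sup>2) * (y / (x\<^sup>2 + y\<^sup>2))) has_integral F R - F (- R)) {- R..R}"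
  proof (rule fundamental_theorem_of_calculus_interior)
    have "\<bar>u x\<bar> \<le> 1" if "x \<in> {- R..R}" for x
    proof -
      have "x\<^sup>2 \<le> s" using that R abs_le_square_iff[of x R] by auto
      then have "1 - (u x)\<^sup>2 \<ge> 0" unfolding u2 using s pos[of x] by (intro divide_nonneg_nonneg mult_nonneg_nonneg) auto
      then show ?thesis using abs_square_le_1[of "u x"] by simp
    qed
    moreover have "continuous_on {- R..R} u"
      unfolding u_def using R pos by (intro continuous_intros) (metis less_irrefl mult_eq_0_iff real_sqrt_eq_zero_cancel_iff)
    ultimately show "continuous_on {- R..R} F"
      unfolding F_def using R s by (intro continuous_intros) (auto simp: divide_simps abs_le_iff)
    fix x assume x: "x \<in> {- R<..<R}"
    have x2: "x\<^sup>2 < s" using x s abs_less_sqrt_imp_sq_less by (auto simp: R_def)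
    define w where "w = sqrt (s - x\<^sup>2)"
    have w: "w > 0" "w * w = s - x\<^sup>2" using x2 by (auto simp: w_def)
    define q where "q = sqrt (x\<^sup>2 + y\<^sup>2)"
    have q: "q > 0" "q * q = x\<^sup>2 + y\<^sup>2" using pos[of x] by (auto simp: q_def)
    have 1: "sqrt (1 - (x / R)\<^sup>2) = w / R"
      using R s by (simp add: w_def R_def power_divide real_sqrt_divide[symmetric] diff_divide_distrib)
    have 2: "sqrt (1 - (u x)\<^sup>2) = y * w / (R * q)"
      unfolding u2 using y by (simp add: real_sqrt_divide real_sqrt_mult R_def w_def q_def)
    have "(u x)\<^sup>2 < 1" 
    proof -
      have "0 < y\<^sup>2 * (s - x\<^sup>2) / (s * (x\<^sup>2 + y\<^sup>2))" using x2 s y pos[of x] by simp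
      then show ?thesis using u2[of x] by simp
    qed
    then have u1: "- 1 < u x" "u x < 1" by (auto simp: abs_square_less_1 abs_less_iff)
    have du: "(u has_real_derivative c * y\<^sup>2 / (R * (q * q * q))) (at x)"
    proof -
      have "(u has_real_derivative (c * (R * q) - x * c * (R * (x / q))) / (R * q * (R * q))) (at x)"
        unfolding u_def q_def
      proof (intro DERIV_divide)
        show "((\<lambda>x. x * c) has_real_derivative c) (at x)"
          by (auto intro!: derivative_eq_intros)
        have "((\<lambda>x. sqrt (x\<^sup>2 + y\<^sup>2)) has_real_derivative inverse (sqrt (x\<^sup>2 + y\<^sup>2)) / 2 * (2 * x)) (at x)"
          by (rule DERIV_real_sqrt[THEN DERIV_chain2]) (use pos[of x] in \<open>auto intro!: derivative_eq_intros\<close>)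
        from DERIV_cmult[OF this, of R]
        show "((\<lambda>x. R * sqrt (x\<^sup>2 + y\<^sup>2)) has_real_derivative R * (x / sqrt (x\<^sup>2 + y\<^sup>2))) (at x)"
          by (simp add: field_simps)
        show "R * sqrt (x\<^sup>2 + y\<^sup>2) \<noteq> 0" using R y by simp
      qed
      moreover have "(c * (R * q) - x * c * (R * (x / q))) / (R * q * (R * q)) = c * (q * q - x * x) / (R * (q * q * q))"
        using R q(1) by (simp add: field_simps)
      ultimately show ?thesis using q by (simp add: power2_eq_square)
    qed
    have "(F has_real_derivative 2 * y / (pi * s) * (- (1 / R * inverse (w / R)) + c / y * (c * y\<^sup>2 / (R * (q * q * q)) * inverse (y * w / (R * q))))) (at x)"
      unfolding F_def
    proof (intro DERIV_cmult DERIV_add DERIV_minus)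
      show "((\<lambda>x. arcsin (x / R)) has_real_derivative 1 / R * inverse (w / R)) (at x)"
        unfolding 1[symmetric] by (subst mult.commute, rule DERIV_arcsin[THEN DERIV_chain2])
          (use x R in \<open>auto intro!: derivative_eq_intros simp: divide_simps\<close>)
      show "((\<lambda>x. arcsin (u x)) has_real_derivative c * y\<^sup>2 / (R * (q * q * q)) * inverse (y * w / (R * q))) (at x)"
        unfolding 2[symmetric] by (subst mult.commute, rule DERIV_arcsin[THEN DERIV_chain2]) (use u1 du in auto)
    qed
    also have "- (1 / R * inverse (w / R)) + c / y * (c * y\<^sup>2 / (R * (q * q * q)) * inverse (y * w / (R * q)))
        = (c\<^sup>2 - q * q) / (q * q * w)"
      using R(1) y w(1) q(1) by (simp add: field_simps power2_eq_square)
    also have "\<dots> = w / (x\<^sup>2 + y\<^sup>2)"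
    proof -
      have "c\<^sup>2 - q * q = w * w" using w(2) q(2) c(2) by simp
      then have "(c\<^sup>2 - q * q) / (q * q * w) = w / (q * q)" using w(1) by simp
      then show ?thesis using q(2) by simp
    qed
    finally have "(F has_real_derivative 2 / (pi * s) * w * (y / (x\<^sup>2 + y\<^sup>2))) (at x)"
      by (simp add: mult_ac)
    then show "(F has_vector_derivative 2 / (pi * s) * sqrt (s - x\<^sup>2) * (y / (x\<^sup>2 + y\<^sup>2))) (at x)"
      by (simp add: has_real_derivative_iff_has_vector_derivative w_def)
  qed (use R in auto)
  also have "F R - F (- R) = 2 * (sqrt (y\<^sup>2 + s) - y) / s"
  proof -
    have "u R = 1" "u (- R) = - 1"
      using R c by (auto simp: u_def c_def add_ac)
    then show ?thesis using R y s by (simp add: F_def c_def field_simps)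
  qed
  finally have "((\<lambda>x. semicircle_density s x * (y / (x\<^sup>2 + y\<^sup>2))) has_integral 2 * (sqrt (y\<^sup>2 + s) - y) / s) {- R..R}"
    by (rule has_integral_eq[rotated]) (auto simp: semicircle_density_def R_def)
  then show ?thesis
    by (rule has_integral_on_superset) (auto simp: semicircle_density_def R_def)
qed

lemma real_distribution_semicircle:
  assumes s: "s > 0"
  shows "real_distribution (semicircle s)"
proof -
  have "(\<integral>\<^sup>+x. ennreal (semicircle_density s x) \<partial>lborel) = 1"
    using nn_integral_has_integral_lborel[OF _ _ has_integral_semicircle_density[OF s]]
      semicircle_density_nonneg[OF s] by simp
  then have "prob_space (semicircle s)"
    by (intro prob_spaceI) (simp add: semicircle_def emeasure_density cong: nn_integral_cong)
  then show ?thesis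
    by (auto simp: real_distribution_def real_distribution_axioms_def semicircle_def)
qed

lemma isCont_cdf_semicircle:
  assumes s: "s > 0"
  shows "isCont (cdf (semicircle s)) x"
proof -
  interpret real_distribution "semicircle s" by (rule real_distribution_semicircle[OF s])
  have "emeasure (semicircle s) {x} = 0"
    by (simp add: semicircle_def emeasure_density nn_integral_indicator_singleton)
  then show ?thesis by (simp add: isCont_cdf measure_def)
qed

text \<open>The argument \<open>y\<close> stands for the point \<open>\<i>y\<close>.\<close>

definition stieltjes :: "real measure \<Rightarrow> real \<Rightarrow> complex" where
  "stieltjes \<mu> y = (CLINT x|\<mu>. 1 / (of_real x - \<i> * of_real y))"

text \<open>The density is even, so the odd real part x / (x^2 + y^2) of the kernel integrates to
  zero and only the Poisson integral remains.\<close>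

lemma stieltjes_semicircle:
  assumes s: "s > 0" and y: "y > 0"
  shows "stieltjes (semicircle s) y = \<i> * of_real (2 * (sqrt (y\<^sup>2 + s) - y) / s)"
proof -
  interpret real_distribution "semicircle s" by (rule real_distribution_semicircle[OF s])
  have pos: "x\<^sup>2 + y\<^sup>2 > 0" for x using y by (simp add: add_nonneg_pos)
  have b1: "\<bar>x / (x\<^sup>2 + y\<^sup>2)\<bar> \<le> 1 / y" for x
  proof -
    have "\<bar>x\<bar> * y \<le> x\<^sup>2 + y\<^sup>2" 
    proof -
      have "0 \<le> \<bar>x\<bar> * y" using y by simp
      then show ?thesis using sum_squares_bound[of "\<bar>x\<bar>" y] by simp
    qed
    then show ?thesis using pos[of x] y by (simp add: abs_divide divide_simps mult_ac)
  qed
  have b2: "\<bar>y / (x\<^sup>2 + y\<^sup>2)\<bar> \<le> 1 / y" for x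
    using pos[of x] y by (simp add: divide_simps power2_eq_square)
  have i1: "integrable (semicircle s) (\<lambda>x. x / (x\<^sup>2 + y\<^sup>2))"
    by (rule integrable_const_bound[of _ "1 / y"]) (use b1 in auto)
  have i2: "integrable (semicircle s) (\<lambda>x. y / (x\<^sup>2 + y\<^sup>2))"
    by (rule integrable_const_bound[of _ "1 / y"]) (use b2 in auto)
  have dens: "(\<integral>x. f x \<partial>semicircle s) = (\<integral>x. semicircle_density s x * f x \<partial>lborel)"
    if "f \<in> borel_measurable borel" for f :: "real \<Rightarrow> real"
    unfolding semicircle_def using that semicircle_density_nonneg[OF s]
    by (subst integral_density) (auto simp: )
  have "(\<integral>x. semicircle_density s x * (x / (x\<^sup>2 + y\<^sup>2)) \<partial>lborel) =
      (\<integral>x. semicircle_density s (0 + -1 * x) * ((0 + -1 * x) / ((0 + -1 * x)\<^sup>2 + y\<^sup>2)) \<partial>lborel)"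
    by (subst lborel_integral_real_affine[of "-1" _ 0]) auto
  also have "\<dots> = - (\<integral>x. semicircle_density s x * (x / (x\<^sup>2 + y\<^sup>2)) \<partial>lborel)"
    by simp
  finally have e1: "(\<integral>x. x / (x\<^sup>2 + y\<^sup>2) \<partial>semicircle s) = 0"
    by (subst dens) auto
  have nn: "semicircle_density s x * (y / (x\<^sup>2 + y\<^sup>2)) \<ge> 0" for x
    using semicircle_density_nonneg[OF s] y pos[of x] by (intro mult_nonneg_nonneg divide_nonneg_nonneg) auto
  have e2: "(\<integral>x. y / (x\<^sup>2 + y\<^sup>2) \<partial>semicircle s) = 2 * (sqrt (y\<^sup>2 + s) - y) / s"
  proof -
    have "(\<integral>\<^sup>+x. ennreal (semicircle_density s x * (y / (x\<^sup>2 + y\<^sup>2))) \<partial>lborel) = ennreal (2 * (sqrt (y\<^sup>2 + s) - y) / s)"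
      by (rule nn_integral_has_integral_lborel[OF _ _ has_integral_semicircle_Poisson[OF s y]]) (use nn in auto)
    moreover have "2 * (sqrt (y\<^sup>2 + s) - y) / s \<ge> 0"
      using s y by (intro divide_nonneg_nonneg mult_nonneg_nonneg) (auto intro!: real_le_rsqrt)
    moreover have "(\<integral>x. semicircle_density s x * (y / (x\<^sup>2 + y\<^sup>2)) \<partial>lborel) =
        enn2real (\<integral>\<^sup>+x. ennreal (semicircle_density s x * (y / (x\<^sup>2 + y\<^sup>2))) \<partial>lborel)"
      by (rule integral_eq_nn_integral) (use nn in auto)
    ultimately have "(\<integral>x. semicircle_density s x * (y / (x\<^sup>2 + y\<^sup>2)) \<partial>lborel) = 2 * (sqrt (y\<^sup>2 + s) - y) / s"
      by (simp only: enn2real_ennreal)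
    then show ?thesis by (subst dens) auto
  qed
  have "1 / (complex_of_real x - \<i> * complex_of_real y)
      = of_real (x / (x\<^sup>2 + y\<^sup>2)) + \<i> * of_real (y / (x\<^sup>2 + y\<^sup>2))" for x
  proof -
    have "a / D = a * D / D\<^sup>2" for a D :: real by (simp add: power2_eq_square)
    then show ?thesis by (simp add: complex_eq_iff Re_divide Im_divide)
  qed
  then have "stieltjes (semicircle s) y
      = (CLINT x|semicircle s. of_real (x / (x\<^sup>2 + y\<^sup>2)) + \<i> * of_real (y / (x\<^sup>2 + y\<^sup>2)))"
    unfolding stieltjes_def by presburger
  also have "\<dots> = of_real (\<integral>x. x / (x\<^sup>2 + y\<^sup>2) \<partial>semicircle s) + \<i> * of_real (\<integral>x. y / (x\<^sup>2 + y\<^sup>2) \<partial>semicircle s)"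
    by (subst Bochner_Integration.integral_add)
      (use i1 i2 in \<open>auto simp del: of_real_divide of_real_add of_real_power\<close>)
  finally show ?thesis unfolding e1 e2 by simp
qed

subsection \<open>Convergence of Stieltjes transforms implies weak convergence\<close>

text \<open>The integral of exp (- (y + ix) t) over t > 0 is 1 / (y + ix) = - i / (x - iy); Fubini
  exchanges it with the integral over \<open>\<mu>\<close>. The sign of x in the exponent is the
  source of the argument - t.\<close>

lemma stieltjes_char:
  assumes "real_distribution \<mu>" and y: "y > 0"
  shows "(CLINT t:{0<..}|lborel. exp (- of_real (y * t)) * char \<mu> (- t)) = - \<i> * stieltjes \<mu> y"
proof -
  interpret real_distribution \<mu> by fact
  interpret P: pair_sigma_finite lborel \<mu> ..
  define f :: "real \<Rightarrow> real \<Rightarrow> complex"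
    where "f t x = indicator {0<..} t *\<^sub>R exp (- ((of_real y + \<i> * of_real x) * of_real t))" for t x
  have f_meas: "(\<lambda>(t, x). f t x) \<in> borel_measurable (lborel \<Otimes>\<^sub>M \<mu>)"
    unfolding f_def by measurable
  have ex: "exp (- ((of_real y + \<i> * of_real x) * of_real t)) = exp (- of_real (y * t)) * iexp (- t * x)" for t x :: real
    by (simp add: exp_add[symmetric] algebra_simps)
  have nf: "norm (f t x) = indicator {0<..} t * exp (- (y * t))" for t x
    by (simp add: f_def ex norm_mult indicator_def)
  have I1: "integrable lborel (\<lambda>t. indicator {0<..} t * exp (- (y * t)) :: real)"
    using integrable_I0i_exp_mscale[OF y] by (simp add: set_integrable_def mult.commute)
  have f_int: "integrable (lborel \<Otimes>\<^sub>M \<mu>) (\<lambda>(t, x). f t x)"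
  proof (rule P.Fubini_integrable[OF f_meas])
    show "integrable lborel (\<lambda>t. \<integral>x. norm (case (t, x) of (t, x) \<Rightarrow> f t x) \<partial>\<mu>)"
      using I1 prob_space by (simp add: nf)
    show "AE t in lborel. integrable \<mu> (\<lambda>x. case (t, x) of (t, x) \<Rightarrow> f t x)"
      by (intro AE_I2 integrable_const_bound[of _ 1]) (auto simp: nf indicator_def f_def y less_imp_le)
  qed
  have inner: "(\<integral>t. f t x \<partial>lborel) = - \<i> * (1 / (of_real x - \<i> * of_real y))" for x
  proof -
    define a where "a = complex_of_real y + \<i> * of_real x"
    have a: "a \<noteq> 0" "Re a = y" using y by (auto simp: a_def complex_eq_iff)
    define F where "F t = - exp (- (a * of_real t)) / a" for t
    have int: "set_integrable lborel {0<..} (\<lambda>t. exp (- (a * of_real t)))"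
      unfolding set_integrable_def
      by (rule Bochner_Integration.integrable_bound[OF I1]) (auto simp: a indicator_def)
    have "(LBINT t=0..\<infinity>. exp (- (a * of_real t))) = 0 - (- 1 / a)"
    proof (rule interval_integral_FTC_integrable[where F = F])
      show "(F has_vector_derivative exp (- (a * of_real t))) (at t)" for t
        unfolding F_def using a
        by (auto intro!: derivative_eq_intros has_vector_derivative_real_field)
      show "isCont (\<lambda>t. exp (- (a * of_real t))) t" for t by (intro continuous_intros)
      show "set_integrable lborel (einterval 0 \<infinity>) (\<lambda>t. exp (- (a * of_real t)))"
        using int by (simp add: einterval_def greaterThan_def zero_ereal_def)
      have "(F \<longlongrightarrow> F 0) (at_right 0)" unfolding F_def using a by (intro tendsto_intros) auto
      then show "((F \<circ> real_of_ereal) \<longlongrightarrow> - 1 / a) (at_right 0)"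
        by (simp add: zero_ereal_def ereal_tendsto_simps F_def)
      have "((\<lambda>t. exp (- (y * t))) \<longlongrightarrow> 0) at_top"
        using y by real_asymp
      then have "((\<lambda>t. exp (- (y * t)) / cmod a) \<longlongrightarrow> 0) at_top"
        by (rule tendsto_divide_zero)
      then have "(F \<longlongrightarrow> 0) at_top"
        by (rule Lim_null_comparison[rotated]) (auto simp: F_def norm_divide a)
      then show "((F \<circ> real_of_ereal) \<longlongrightarrow> 0) (at_left \<infinity>)"
        by (simp add: ereal_tendsto_simps)
    qed auto
    also have "(LBINT t=0..\<infinity>. exp (- (a * of_real t))) = (\<integral>t. f t x \<partial>lborel)"
      by (simp add: interval_lebesgue_integral_def einterval_def set_lebesgue_integral_def f_def a_def
          greaterThan_def zero_ereal_def)
    also have "0 - (- 1 / a) = - \<i> * (1 / (of_real x - \<i> * of_real y))"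
      using a by (simp add: a_def divide_simps) (simp add: algebra_simps)
    finally show ?thesis by simp
  qed
  have "(CLINT t:{0<..}|lborel. exp (- of_real (y * t)) * char \<mu> (- t)) = (\<integral>t. (\<integral>x. f t x \<partial>\<mu>) \<partial>lborel)"
    unfolding set_lebesgue_integral_def char_def f_def ex by simp
  also have "\<dots> = (\<integral>x. (\<integral>t. f t x \<partial>lborel) \<partial>\<mu>)"
    using P.Fubini_integral[OF f_int] by simp
  also have "\<dots> = - \<i> * stieltjes \<mu> y"
    unfolding inner stieltjes_def by (rule integral_mult_right_zero)
  finally show ?thesis .
qed

text \<open>In the variable \<open>u = exp (- t)\<close> the hypothesis says that all polynomial moments vanish, so the
  Weierstrass theorem applies.\<close>

lemma laplace_transform_zero_imp_zero:
  fixes d :: "real \<Rightarrow> real"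
  assumes cont: "continuous_on {0..} d" and bdd: "\<And>t. t \<ge> 0 \<Longrightarrow> \<bar>d t\<bar> \<le> D" and y: "y > 0"
    and zero: "\<And>k::nat. (LINT t:{0<..}|lborel. exp (- ((y + real k) * t)) * d t) = 0"
    and t: "t > 0"
  shows "d t = 0"
proof -
  \<comment> \<open>The factor \<open>u\<close> makes \<open>q\<close> continuous at 0, where
    \<open>d (- ln u)\<close> need not have a limit; boundedness of \<open>d\<close> is enough for
    that.\<close>
  define q where "q u = (if u = 0 then 0 else u * d (- ln u))" for u :: real
  have D: "D \<ge> 0" using bdd[of 0] by simp
  have cq: "continuous_on {0..1} q"
  proof -
    have "continuous (at u within {0..1}) q" if u: "u \<in> {0..1}" for u
    proof (cases "u = 0")
      case True
      have "((\<lambda>v. D * \<bar>v\<bar>) \<longlongrightarrow> D * \<bar>0\<bar>) (at 0 within {0..1::real})"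
        by (intro tendsto_intros)
      then have "(q \<longlongrightarrow> 0) (at 0 within {0..1})"
        by (intro Lim_null_comparison[where g = "\<lambda>v. D * \<bar>v\<bar>" and f = q])
           (auto simp: eventually_at_filter q_def abs_mult mult.commute intro!: always_eventually mult_right_mono bdd)
      then show ?thesis using True by (simp add: continuous_within q_def)
    next
      case False
      have "continuous_on {0<..1} (\<lambda>u. u * d (- ln u))"
        by (intro continuous_intros continuous_on_compose2[OF cont]) (auto simp: ln_le_zero_iff)
      then have "continuous_on {0<..1} q"
        by (rule continuous_on_eq) (auto simp: q_def)
      moreover have "at u within {0..1} = at u within {0<..1}"
        by (rule at_within_nhd[of _ "{0<..}"]) (use u False in auto)
      ultimately show ?thesis using u False by (auto simp: continuous_on_eq_continuous_within)
    qed
    then show ?thesis by (simp add: continuous_on_eq_continuous_within)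
  qed
  define h where "h t = indicator {0<..} t * d t" for t
  have [measurable]: "h \<in> borel_measurable borel"
    unfolding h_def
    using borel_measurable_continuous_on_indicator[of "{0<..}" d] continuous_on_subset[OF cont, of "{0<..}"]
    by (simp add: subset_iff)
  have hD: "\<bar>h t\<bar> \<le> D" for t using bdd[of t] D by (auto simp: h_def indicator_def)
  have Ik: "integrable lborel (\<lambda>t. exp (- (c * t)) * h t)" if "c > 0" for c
  proof (rule Bochner_Integration.integrable_bound)
    show "integrable lborel (\<lambda>t. indicator {0<..} t * exp (- (t * c)) * D)"
      using integrable_I0i_exp_mscale[OF that] by (simp add: set_integrable_def)
    have "norm (exp (- (c * t)) * h t) \<le> norm (indicator {0<..} t * exp (- (t * c)) * D)" for t
    proof (cases "t > 0")
      case True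
      then show ?thesis using hD[of t] D by (simp add: abs_mult mult.commute)
    qed (simp add: h_def)
    then show "AE t in lborel. norm (exp (- (c * t)) * h t) \<le> norm (indicator {0<..} t * exp (- (t * c)) * D)"
      by simp
  qed simp
  have polyI: "integrable lborel (\<lambda>t. p (exp (- t)) * (exp (- (y * t)) * h t))" (is ?A)
    and poly0: "(\<integral>t. p (exp (- t)) * (exp (- (y * t)) * h t) \<partial>lborel) = 0" (is ?B)
    if p: "real_polynomial_function p" for p
  proof -
    obtain a N where pe: "p = (\<lambda>x. \<Sum>i\<le>N. a i * x ^ i)"
      using p unfolding real_polynomial_function_iff_sum by blast
    have e: "exp (- t) ^ i * exp (- (y * t)) = exp (- ((y + real i) * t))" for i t
      by (simp add: exp_of_nat_mult[symmetric] exp_add[symmetric] algebra_simps)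
    have "a i * exp (- t) ^ i * (exp (- (y * t)) * h t) = a i * (exp (- ((y + real i) * t)) * h t)" for i t
      unfolding e[symmetric] by (simp only: mult.assoc)
    then have eq: "(\<lambda>t. p (exp (- t)) * (exp (- (y * t)) * h t))
        = (\<lambda>t. \<Sum>i\<le>N. a i * (exp (- ((y + real i) * t)) * h t))"
      unfolding pe sum_distrib_right by presburger
    have I: "integrable lborel (\<lambda>t. exp (- ((y + real k) * t)) * h t)" for k
      using y by (intro Ik) simp
    show ?A unfolding eq by (intro Bochner_Integration.integrable_sum integrable_mult_right I)
    have "(\<integral>t. exp (- ((y + real k) * t)) * h t \<partial>lborel) = 0" for k
      using zero[of k] by (simp add: set_lebesgue_integral_def h_def mult_ac)
    then show ?B unfolding eq
      by (subst Bochner_Integration.integral_sum) (auto intro!: integrable_mult_right I)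
  qed
  \<comment> \<open>For t > 0 this is q (exp (- t)) * exp (- y t) * h t, the additional exp (- t)
    being the factor \<open>u\<close> of \<open>q\<close>. With a polynomial in place of
    \<open>q\<close> the integral is zero, so the integral of this nonnegative function is at most
    \<open>e * E\<close> for every \<open>e\<close>.\<close>
  define w where "w t = exp (- ((y + 1) * t)) * (h t * h t)" for t
  have [measurable]: "w \<in> borel_measurable borel" unfolding w_def by measurable
  have w_nonneg: "w t \<ge> 0" for t by (simp add: w_def)
  have wI: "integrable lborel w"
  proof (rule Bochner_Integration.integrable_bound[OF integrable_mult_left[OF Ik[of "y + 1"], of D]])
    have "norm (w t) \<le> norm (exp (- ((y + 1) * t)) * h t * D)" for t
    proof -
      have "\<bar>h t\<bar> * \<bar>h t\<bar> \<le> \<bar>h t\<bar> * D" by (intro mult_left_mono hD) simp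
      then have "exp (- ((y + 1) * t)) * (\<bar>h t\<bar> * \<bar>h t\<bar>) \<le> exp (- ((y + 1) * t)) * (\<bar>h t\<bar> * D)"
        by (rule mult_left_mono) simp
      moreover have "norm (w t) = exp (- ((y + 1) * t)) * (\<bar>h t\<bar> * \<bar>h t\<bar>)"
        by (simp add: w_def abs_mult)
      moreover have "norm (exp (- ((y + 1) * t)) * h t * D) = exp (- ((y + 1) * t)) * (\<bar>h t\<bar> * D)"
        using D by (simp add: abs_mult)
      ultimately show ?thesis by (simp only:)
    qed
    then show "AE t in lborel. norm (w t) \<le> norm (exp (- ((y + 1) * t)) * h t * D)" by simp
  qed (use y in simp_all)
  have hI: "integrable lborel (\<lambda>t. exp (- (y * t)) * h t)" by (rule Ik[OF y])
  define E where "E = (\<integral>t. \<bar>exp (- (y * t)) * h t\<bar> \<partial>lborel)"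
  have "(\<integral>t. w t \<partial>lborel) \<le> e * E" if e: "e > 0" for e
  proof -
    obtain p where p: "real_polynomial_function p" "\<And>x. x \<in> {0..1} \<Longrightarrow> \<bar>q x - p x\<bar> < e"
      using Stone_Weierstrass_real_polynomial_function[OF compact_Icc cq e] by metis
    have "(\<integral>t. w t \<partial>lborel) = (\<integral>t. w t - p (exp (- t)) * (exp (- (y * t)) * h t) \<partial>lborel)"
      using poly0[OF p(1)] polyI[OF p(1)] wI by simp
    also have "\<dots> \<le> (\<integral>t. e * \<bar>exp (- (y * t)) * h t\<bar> \<partial>lborel)"
    proof (rule integral_mono)
      fix t :: real
      show "w t - p (exp (- t)) * (exp (- (y * t)) * h t) \<le> e * \<bar>exp (- (y * t)) * h t\<bar>"
      proof (cases "t > 0")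
        case True
        have "w t = q (exp (- t)) * (exp (- (y * t)) * h t)"
          using True by (simp add: w_def q_def h_def exp_add[symmetric] algebra_simps mult_exp_exp)
        then have "w t - p (exp (- t)) * (exp (- (y * t)) * h t)
            = (q (exp (- t)) - p (exp (- t))) * (exp (- (y * t)) * h t)"
          by (simp add: algebra_simps)
        also have "\<dots> \<le> \<bar>(q (exp (- t)) - p (exp (- t)))\<bar> * \<bar>exp (- (y * t)) * h t\<bar>"
          by (metis abs_ge_self abs_mult)
        also have "\<dots> \<le> e * \<bar>exp (- (y * t)) * h t\<bar>"
          using p(2)[of "exp (- t)"] True by (intro mult_right_mono) auto
        finally show ?thesis .
      qed (auto simp: w_def h_def)
    qed (use wI polyI[OF p(1)] hI in auto)
    also have "\<dots> = e * E" by (simp add: E_def)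
    finally show ?thesis .
  qed
  moreover have "E \<ge> 0" by (simp add: E_def)
  ultimately have "(\<integral>t. w t \<partial>lborel) \<le> 0"
  proof (rule_tac ccontr)
    assume E: "E \<ge> 0" and le: "\<And>e. e > 0 \<Longrightarrow> (\<integral>t. w t \<partial>lborel) \<le> e * E"
      and "\<not> (\<integral>t. w t \<partial>lborel) \<le> 0"
    then have W: "(\<integral>t. w t \<partial>lborel) > 0" by simp
    with le[of "(\<integral>t. w t \<partial>lborel) / (E + 1)"] E show False by (simp add: field_simps)
  qed
  then have "(\<integral>t. w t \<partial>lborel) = 0"
    using integral_nonneg_AE[of w lborel] w_nonneg by (simp add: order_antisym)
  then have "AE t in lborel. w t = 0"
    using integral_nonneg_eq_0_iff_AE[OF wI] w_nonneg by simp
  \<comment> \<open>The zero set of a continuous function is closed, so vanishing almost everywhere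
    on the open half-line means vanishing everywhere on it.\<close>
  then have "AE t in lebesgue. t \<in> {0<..} \<longrightarrow> t \<in> {t \<in> {0..}. d t = 0}"
    by (intro AE_completion) (auto simp: w_def h_def)
  then show ?thesis
    using mem_closed_if_AE_lebesgue_open[of "{0<..}" "{t \<in> {0..}. d t = 0}" t] t
      continuous_closed_preimage_constant[OF cont, of 0] by auto
qed

text \<open>The difference of the characteristic functions on the negative half-line has vanishing
  Laplace transform at all y + k, hence is zero. Conjugation carries this to the positive half-line,
  and Levy's uniqueness theorem concludes.\<close>

lemma stieltjes_eq_imp_eq:
  assumes \<mu>: "real_distribution \<mu>" and \<nu>: "real_distribution \<nu>" and y: "y > 0"
    and eq: "\<And>k::nat. stieltjes \<mu> (y + real k) = stieltjes \<nu> (y + real k)"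
  shows "\<mu> = \<nu>"
proof -
  interpret \<mu>: real_distribution \<mu> by fact
  interpret \<nu>: real_distribution \<nu> by fact
  define D where "D t = char \<mu> (- t) - char \<nu> (- t)" for t
  have cont: "continuous_on S D" for S
    unfolding D_def
  proof (intro continuous_on_diff)
    have "continuous_on UNIV (char \<mu>)" "continuous_on UNIV (char \<nu>)"
      by (intro continuous_at_imp_continuous_on ballI \<mu>.isCont_char \<nu>.isCont_char)+
    note c = this
    show "continuous_on S (\<lambda>t. char \<mu> (- t))"
      by (rule continuous_on_compose2[OF c(1)]) (auto intro: continuous_on_minus continuous_on_id)
    show "continuous_on S (\<lambda>t. char \<nu> (- t))"
      by (rule continuous_on_compose2[OF c(2)]) (auto intro: continuous_on_minus continuous_on_id)
  qed
  have bdd: "cmod (D t) \<le> 2" for t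
    using \<mu>.cmod_char_le_1[of "-t"] \<nu>.cmod_char_le_1[of "-t"] norm_triangle_ineq4[of "char \<mu> (- t)" "char \<nu> (- t)"]
    by (simp add: D_def)
  have [measurable]: "char \<mu> \<in> borel_measurable borel" "char \<nu> \<in> borel_measurable borel"
    by (intro borel_measurable_continuous_onI continuous_at_imp_continuous_on ballI \<mu>.isCont_char \<nu>.isCont_char)+
  have I: "set_integrable lborel {0<..} (\<lambda>t. exp (- of_real (c * t)) * char \<rho> (- t))"
    if "c > 0" "real_distribution \<rho>" for c \<rho>
  proof -
    interpret \<rho>: real_distribution \<rho> by fact
    have [measurable]: "char \<rho> \<in> borel_measurable borel"
      by (intro borel_measurable_continuous_onI continuous_at_imp_continuous_on ballI \<rho>.isCont_char)
    have "integrable lborel (\<lambda>t. indicator {0<..} t * exp (- (t * c)))"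
      using integrable_I0i_exp_mscale[OF that(1)] by (simp add: set_integrable_def)
    then show ?thesis unfolding set_integrable_def
    proof (rule Bochner_Integration.integrable_bound)
      show "AE t in lborel. norm (indicator {0<..} t *\<^sub>R (exp (- complex_of_real (c * t)) * char \<rho> (- t)))
          \<le> norm (indicator {0<..} t * exp (- (t * c)))"
        using \<rho>.cmod_char_le_1 by (auto simp: norm_mult indicator_def mult.commute intro!: mult_left_le)
    qed measurable
  qed
  have D0: "(CLINT t:{0<..}|lborel. exp (- of_real (c * t)) * D t) = 0"
    and DI: "set_integrable lborel {0<..} (\<lambda>t. exp (- of_real (c * t)) * D t)"
    if c: "c = y + real k" for c and k :: nat
  proof -
    have c0: "c > 0" using c y by simp
    have e: "(\<lambda>t. exp (- of_real (c * t)) * D t) =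
      (\<lambda>t. exp (- of_real (c * t)) * char \<mu> (- t) - exp (- of_real (c * t)) * char \<nu> (- t))"
      by (simp add: D_def algebra_simps)
    show "set_integrable lborel {0<..} (\<lambda>t. exp (- of_real (c * t)) * D t)"
      unfolding e by (intro set_integral_diff(1) I c0 \<mu> \<nu>)
    show "(CLINT t:{0<..}|lborel. exp (- of_real (c * t)) * D t) = 0"
      unfolding e using eq[of k]
      by (simp only: set_integral_diff(2)[OF I[OF c0 \<mu>] I[OF c0 \<nu>]] stieltjes_char[OF \<mu> c0] stieltjes_char[OF \<nu> c0]
          c[symmetric] diff_self)
  qed
  have ex: "exp (- of_real (c * t)) * D t = of_real (exp (- (c * t))) * D t" for c t
    by (simp add: exp_of_real[symmetric])
  have "Re (D t) = 0" if "t > 0" for t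
  proof (rule laplace_transform_zero_imp_zero[of "\<lambda>t. Re (D t)" 2 y t])
    show "(LINT t:{0<..}|lborel. exp (- ((y + real k) * t)) * Re (D t)) = 0" for k
      using arg_cong[OF D0[OF refl, of k], of Re] DI[OF refl, of k]
      unfolding ex set_lebesgue_integral_def set_integrable_def
      by (subst (asm) integral_Re[symmetric]) (simp_all del: of_real_mult of_real_exp)
  qed (use that y bdd abs_Re_le_cmod order_trans in \<open>auto intro!: continuous_intros cont\<close>, blast)
  moreover have "Im (D t) = 0" if "t > 0" for t
  proof (rule laplace_transform_zero_imp_zero[of "\<lambda>t. Im (D t)" 2 y t])
    show "(LINT t:{0<..}|lborel. exp (- ((y + real k) * t)) * Im (D t)) = 0" for k
      using arg_cong[OF D0[OF refl, of k], of Im] DI[OF refl, of k]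
      unfolding ex set_lebesgue_integral_def set_integrable_def
      by (subst (asm) integral_Im[symmetric]) (simp_all del: of_real_mult of_real_exp)
  qed (use that y bdd abs_Im_le_cmod order_trans in \<open>auto intro!: continuous_intros cont\<close>, blast)
  ultimately have neg: "char \<mu> (- t) = char \<nu> (- t)" if "t > 0" for t
    using that by (simp add: D_def complex_eq_iff)
  have cnj: "char \<rho> t = cnj (char \<rho> (- t))" for \<rho> t
    by (simp add: char_def exp_cnj flip: Bochner_Integration.integral_cnj)
  have "char \<mu> t = char \<nu> t" for t
    using neg[of t] neg[of "- t"] cnj[of \<mu> t] cnj[of \<nu> t] \<mu>.char_zero \<nu>.char_zero
    by (cases t "0::real" rule: linorder_cases) auto
  then show ?thesis by (intro Levy_uniqueness \<mu> \<nu> ext)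
qed

text \<open>Bounded second moments give tightness by Chebyshev's inequality. Since 1 / (x - ic) is
  bounded and continuous, every subsequential weak limit has the transforms of \<open>\<nu>\<close>
  at all y + k, and these values identify it.\<close>

lemma stieltjes_tendsto_imp_weak_conv:
  assumes \<mu>: "\<And>n. real_distribution (\<mu> n)" and \<nu>: "real_distribution \<nu>" and y: "y > 0"
    and conv: "\<And>k::nat. (\<lambda>n. stieltjes (\<mu> n) (y + real k)) \<longlonglongrightarrow> stieltjes \<nu> (y + real k)"
    and I2: "\<And>n. integrable (\<mu> n) (\<lambda>x. x\<^sup>2)"
    and bdd: "\<And>n. (\<integral>x. x\<^sup>2 \<partial>\<mu> n) \<le> C"
  shows "weak_conv_m \<mu> \<nu>"
proof (rule tight_subseq_weak_converge[OF \<mu> \<nu>])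
  have C: "C \<ge> 0"
  proof -
    have "0 \<le> (\<integral>x. x\<^sup>2 \<partial>\<mu> 0)" by (rule integral_nonneg_AE) simp
    then show ?thesis using bdd[of 0] by linarith
  qed
  show "tight \<mu>"
    unfolding tight_def
  proof (intro conjI allI impI \<mu>)
    fix e :: real assume e: "e > 0"
    define a where "a = sqrt ((C + 1) / e) + 1"
    have a: "a > 0" "C / a\<^sup>2 < e"
    proof -
      have s: "sqrt ((C + 1) / e) \<ge> 0" using C e by simp
      then show "a > 0" unfolding a_def by linarith
      have "(C + 1) / e = (sqrt ((C + 1) / e))\<^sup>2" using C e by simp
      also have "\<dots> \<le> a\<^sup>2" unfolding a_def using s by (intro power_mono) auto
      finally have "C + 1 \<le> a\<^sup>2 * e" using e by (simp add: divide_simps)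
      then show "C / a\<^sup>2 < e" using \<open>a > 0\<close> by (simp add: divide_simps mult_ac)
    qed
    have "measure (\<mu> n) {- a<..a} > 1 - e" for n
    proof -
      interpret real_distribution "\<mu> n" by (rule \<mu>)
      have "measure (\<mu> n) {x \<in> space (\<mu> n). a\<^sup>2 \<le> x\<^sup>2} \<le> (\<integral>x. x\<^sup>2 \<partial>\<mu> n) / a\<^sup>2"
        using I2 a by (intro integral_Markov_inequality_measure[where A = "{}"]) auto
      also have "\<dots> \<le> C / a\<^sup>2" by (intro divide_right_mono bdd) auto
      also have "\<dots> < e" by (rule a)
      finally have "measure (\<mu> n) {x \<in> space (\<mu> n). a\<^sup>2 \<le> x\<^sup>2} < e" .
      moreover have "measure (\<mu> n) (UNIV - {- a<..a}) \<le> measure (\<mu> n) {x \<in> space (\<mu> n). a\<^sup>2 \<le> x\<^sup>2}"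
      proof (rule finite_measure_mono)
        have "a\<^sup>2 \<le> x\<^sup>2" if "x \<notin> {- a<..a}" for x
          using that a(1) abs_le_square_iff[of a x] by auto
        then show "UNIV - {- a<..a} \<subseteq> {x \<in> space (\<mu> n). a\<^sup>2 \<le> x\<^sup>2}" by auto
      qed measurable
      moreover have "measure (\<mu> n) (UNIV - {- a<..a}) = 1 - measure (\<mu> n) {- a<..a}"
        using prob_compl[of "{- a<..a}"] by simp
      ultimately show ?thesis by linarith
    qed
    moreover have "- a < a" using a(1) by simp
    ultimately show "\<exists>a b. a < b \<and> (\<forall>n. 1 - e < measure (\<mu> n) {a<..b})"
      by blast
  qed
next
  fix s :: "nat \<Rightarrow> nat" and \<rho>
  assume s: "strict_mono s" and \<rho>: "real_distribution \<rho>" and w: "weak_conv_m (\<mu> \<circ> s) \<rho>"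
  have "stieltjes \<rho> (y + real k) = stieltjes \<nu> (y + real k)" for k
  proof (rule LIMSEQ_unique)
    define c where "c = y + real k"
    have c: "c > 0" using y by (simp add: c_def)
    have nz: "of_real x - \<i> * of_real c \<noteq> 0" for x using c by (simp add: complex_eq_iff)
    show "(\<lambda>n. stieltjes ((\<mu> \<circ> s) n) c) \<longlonglongrightarrow> stieltjes \<rho> c"
      unfolding stieltjes_def
    proof (rule weak_conv_imp_integral_bdd_continuous_conv[OF _ \<rho> w, where B = "1 / c"])
      show "isCont (\<lambda>x. 1 / (complex_of_real x - \<i> * complex_of_real c)) x" for x
        using nz by (intro continuous_intros) auto
      show "norm (1 / (complex_of_real x - \<i> * complex_of_real c)) \<le> 1 / c" for x
        using abs_Im_le_cmod[of "complex_of_real x - \<i> * complex_of_real c"] c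
        by (simp add: norm_divide frac_le)
    qed (simp add: \<mu>)
    show "(\<lambda>n. stieltjes ((\<mu> \<circ> s) n) c) \<longlonglongrightarrow> stieltjes \<nu> c"
      using LIMSEQ_subseq_LIMSEQ[OF conv[of k] s] by (simp add: o_def c_def)
  qed
  then have "\<rho> = \<nu>" by (rule stieltjes_eq_imp_eq[OF \<rho> \<nu> y])
  then show "weak_conv_m (\<mu> \<circ> s) \<nu>" using w by simp
qed

subsection \<open>Resolvents of real symmetric matrices at purely imaginary points\<close>

definition shifted :: "(nat \<Rightarrow> nat \<Rightarrow> real) \<Rightarrow> real \<Rightarrow> nat \<Rightarrow> nat \<Rightarrow> complex" where
  "shifted b y i j = of_real (b i j) - (if i = j then \<i> * of_real y else 0)"

text \<open>Cramer's formula makes the measurable dependence of the resolvent on the entries evident; it is junk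
  if the determinant vanishes, which does not happen for symmetric \<open>b\<close> and \<open>y > 0\<close>.\<close>

definition resolvent :: "nat \<Rightarrow> (nat \<Rightarrow> nat \<Rightarrow> real) \<Rightarrow> real \<Rightarrow> nat \<Rightarrow> nat \<Rightarrow> complex" where
  "resolvent n b y i j =
     adj_mat (mat n n (\<lambda>(i, j). shifted b y i j)) $$ (i, j) / det (mat n n (\<lambda>(i, j). shifted b y i j))"

definition resolvent_trace :: "nat \<Rightarrow> (nat \<Rightarrow> nat \<Rightarrow> real) \<Rightarrow> real \<Rightarrow> complex" where
  "resolvent_trace n b y = (\<Sum>i<n. resolvent n b y i i)"

definition sym_on :: "nat \<Rightarrow> (nat \<Rightarrow> nat \<Rightarrow> real) \<Rightarrow> bool" where
  "sym_on n b \<longleftrightarrow> (\<forall>i<n. \<forall>j<n. b i j = b j i)"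

lemma sym_onD: "sym_on n b \<Longrightarrow> i < n \<Longrightarrow> j < n \<Longrightarrow> b i j = b j i"
  by (simp add: sym_on_def)

lemma resolvent_cong:
  assumes "\<And>i j. i < n \<Longrightarrow> j < n \<Longrightarrow> b i j = b' i j"
  shows "resolvent n b y = resolvent n b' y"
proof -
  have "mat n n (\<lambda>(i, j). shifted b y i j) = mat n n (\<lambda>(i, j). shifted b' y i j)"
    by (rule cong_mat) (auto simp: shifted_def assms)
  then show ?thesis by (intro ext) (simp add: resolvent_def)
qed

lemma resolvent_trace_cong:
  assumes "\<And>i j. i < n \<Longrightarrow> j < n \<Longrightarrow> b i j = b' i j"
  shows "resolvent_trace n b y = resolvent_trace n b' y"
  using resolvent_cong[OF assms] by (simp add: resolvent_trace_def)

lemma shifted_sum: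
  assumes "i < n"
  shows "(\<Sum>k<n. shifted b y i k * w k) = (\<Sum>k<n. of_real (b i k) * w k) - \<i> * of_real y * w i"
proof -
  have "(\<Sum>k<n. (if i = k then \<i> * of_real y else 0) * w k) = \<i> * of_real y * w i"
    using assms by (simp add: if_distrib[of "\<lambda>x. x * _"] sum.delta' cong: if_cong)
  then show ?thesis by (simp add: shifted_def left_diff_distrib sum_subtractf)
qed

text \<open>The quadratic form of a real symmetric \<open>b\<close> is real on complex vectors, so
  pairing (b - iy) w = v with w leaves only the shift in the imaginary part. The later bounds on the
  resolvent descend from this identity.\<close>

lemma shifted_energy:
  assumes sym: "sym_on n b"
    and sol: "\<And>i. i < n \<Longrightarrow> (\<Sum>k<n. shifted b y i k * w k) = v i"
  shows "Im (\<Sum>i<n. cnj (w i) * v i) = - y * (\<Sum>i<n. (cmod (w i))\<^sup>2)"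
proof -
  define S where "S = (\<Sum>i<n. \<Sum>k<n. cnj (w i) * of_real (b i k) * w k)"
  have "cnj S = (\<Sum>i<n. \<Sum>k<n. cnj (w k) * of_real (b i k) * w i)"
    by (simp add: S_def mult_ac)
  also have "\<dots> = (\<Sum>k<n. \<Sum>i<n. cnj (w k) * of_real (b i k) * w i)"
    by (rule sum.swap)
  also have "\<dots> = S"
    unfolding S_def by (intro sum.cong refl) (simp add: sym_onD[OF sym])
  finally have "Im S = 0" by (simp add: complex_eq_iff)
  have "cnj (w i) * v i = (\<Sum>k<n. cnj (w i) * of_real (b i k) * w k) - \<i> * of_real (y * (cmod (w i))\<^sup>2)"
    if "i < n" for i
  proof -
    have "cnj (w i) * v i = (\<Sum>k<n. cnj (w i) * of_real (b i k) * w k) - \<i> * (of_real y * (w i * cnj (w i)))"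
      unfolding sol[OF that, symmetric] shifted_sum[OF that] right_diff_distrib sum_distrib_left by (simp add: mult_ac)
    then show ?thesis by (simp only: of_real_mult complex_norm_square)
  qed
  then have "(\<Sum>i<n. cnj (w i) * v i) = S - \<i> * of_real (y * (\<Sum>i<n. (cmod (w i))\<^sup>2))"
    by (simp add: S_def sum_subtractf sum_distrib_left)
  then show ?thesis using \<open>Im S = 0\<close> by simp
qed

text \<open>By Cauchy-Schwarz in the energy identity, y |w|^2 is at most |w| |v|. In operator terms,
  the resolvent has norm at most 1 / y.\<close>

lemma shifted_norm_le:
  assumes sym: "sym_on n b" and y: "y > 0"
    and sol: "\<And>i. i < n \<Longrightarrow> (\<Sum>k<n. shifted b y i k * w k) = v i"
  shows "y\<^sup>2 * (\<Sum>i<n. (cmod (w i))\<^sup>2) \<le> (\<Sum>i<n. (cmod (v i))\<^sup>2)"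
proof -
  define W where "W = (\<Sum>i<n. (cmod (w i))\<^sup>2)"
  define U where "U = (\<Sum>i<n. (cmod (v i))\<^sup>2)"
  have W: "W \<ge> 0" and U: "U \<ge> 0" by (auto simp: W_def U_def sum_nonneg)
  have "y * W = \<bar>Im (\<Sum>i<n. cnj (w i) * v i)\<bar>"
    using shifted_energy[OF sym sol] y W by (simp add: W_def abs_mult)
  also have "\<dots> \<le> cmod (\<Sum>i<n. cnj (w i) * v i)" by (rule abs_Im_le_cmod)
  also have "\<dots> \<le> (\<Sum>i<n. cmod (w i) * cmod (v i))"
    by (intro sum_norm_le) (simp add: norm_mult)
  finally have "(y * W)\<^sup>2 \<le> (\<Sum>i<n. cmod (w i) * cmod (v i))\<^sup>2"
    using y W by (intro power_mono) auto
  also have "\<dots> \<le> W * U" unfolding W_def U_def by (rule Cauchy_Schwarz_ineq_sum)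
  finally have "y\<^sup>2 * W * W \<le> U * W" by (simp add: power2_eq_square mult_ac)
  then have "y\<^sup>2 * W \<le> U" using W U by (cases "W = 0") auto
  then show ?thesis by (simp add: W_def U_def)
qed

lemma shifted_det_nonzero:
  assumes sym: "sym_on n b" and y: "y > 0"
  shows "det (mat n n (\<lambda>(i, j). shifted b y i j)) \<noteq> 0"
proof
  assume "det (mat n n (\<lambda>(i, j). shifted b y i j)) = 0"
  then obtain v where v: "v \<in> carrier_vec n" "v \<noteq> 0\<^sub>v n" "mat n n (\<lambda>(i, j). shifted b y i j) *\<^sub>v v = 0\<^sub>v n"
    using det_0_iff_vec_prod_zero_field[of "mat n n (\<lambda>(i, j). shifted b y i j)" n] by auto
  have "(\<Sum>k<n. shifted b y i k * v $ k) = 0" if "i < n" for i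
  proof -
    have "(mat n n (\<lambda>(i, j). shifted b y i j) *\<^sub>v v) $ i = 0" using v that by simp
    then show ?thesis using that v(1) by (simp add: scalar_prod_def lessThan_atLeast0)
  qed
  from shifted_norm_le[OF sym y this] y
  have "(\<Sum>i<n. (cmod (v $ i))\<^sup>2) \<le> 0" by (simp add: mult_le_0_iff)
  then have "\<forall>i<n. v $ i = 0" 
    using sum_nonneg_eq_0_iff[of "{..<n}" "\<lambda>i. (cmod (v $ i))\<^sup>2"] sum_nonneg[of "{..<n}" "\<lambda>i. (cmod (v $ i))\<^sup>2"]
    by (auto dest!: order_antisym)
  then show False using v by (auto intro: eq_vecI)
qed

section \<open>The resolvent as a symmetric two-sided inverse\<close>

lemma resolvent_right:
  assumes "sym_on n b" and "y > 0" and ij: "i < n" "j < n"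
  shows "(\<Sum>k<n. shifted b y i k * resolvent n b y k j) = (if i = j then 1 else 0)"
proof -
  define A where "A = mat n n (\<lambda>(i, j). shifted b y i j)"
  have A: "A \<in> carrier_mat n n" by (simp add: A_def)
  have d: "det A \<noteq> 0" unfolding A_def by (rule shifted_det_nonzero[OF assms(1,2)])
  have "(A * adj_mat A) $$ (i, j) = (det A \<cdot>\<^sub>m 1\<^sub>m n) $$ (i, j)"
    using adj_mat(2)[OF A] by simp
  then have "(\<Sum>k<n. A $$ (i, k) * adj_mat A $$ (k, j)) = (if i = j then det A else 0)"
    using A adj_mat(1)[OF A] ij by (simp add: scalar_prod_def lessThan_atLeast0)
  then have "(\<Sum>k<n. A $$ (i, k) * adj_mat A $$ (k, j)) / det A = (if i = j then 1 else 0)"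
    using d by simp
  moreover have "(\<Sum>k<n. shifted b y i k * resolvent n b y k j) = (\<Sum>k<n. A $$ (i, k) * adj_mat A $$ (k, j)) / det A"
    unfolding sum_divide_distrib by (intro sum.cong refl) (use ij in \<open>simp add: resolvent_def A_def\<close>)
  ultimately show ?thesis by simp
qed

lemma shifted_commute: "sym_on n b \<Longrightarrow> i < n \<Longrightarrow> j < n \<Longrightarrow> shifted b y i j = shifted b y j i"
  by (auto simp: shifted_def sym_onD)

text \<open>The adjugate formula supplies a right inverse. As the shifted matrix is symmetric, the
  transpose of a right inverse is a left inverse; this transposed form is what proves that the
  resolvent itself is symmetric.\<close>

lemma resolvent_solve_transpose:
  assumes sym: "sym_on n b" and y: "y > 0" and i: "i < n"
    and sol: "\<And>k. k < n \<Longrightarrow> (\<Sum>l<n. shifted b y k l * w l) = v k"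
  shows "w i = (\<Sum>k<n. resolvent n b y k i * v k)"
proof -
  have "(\<Sum>k<n. resolvent n b y k i * v k) = (\<Sum>k<n. \<Sum>l<n. resolvent n b y k i * (shifted b y k l * w l))"
    by (intro sum.cong refl) (simp add: sol[symmetric] sum_distrib_left)
  also have "\<dots> = (\<Sum>l<n. (\<Sum>k<n. shifted b y l k * resolvent n b y k i) * w l)"
    unfolding sum_distrib_right
    by (subst sum.swap) (intro sum.cong refl, simp add: mult_ac shifted_commute[OF sym])
  also have "\<dots> = (\<Sum>l<n. (if l = i then 1 else 0) * w l)"
    using i by (intro sum.cong refl) (simp add: resolvent_right[OF sym y])
  also have "\<dots> = w i"
    using i by (simp add: if_distrib[of "\<lambda>x. x * _"] cong: if_cong)
  finally show ?thesis by simp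
qed

lemma resolvent_sym:
  assumes sym: "sym_on n b" and y: "y > 0" and ij: "i < n" "j < n"
  shows "resolvent n b y i j = resolvent n b y j i"
proof -
  have "resolvent n b y i j = (\<Sum>k<n. resolvent n b y k i * (if k = j then 1 else 0))"
    using ij by (intro resolvent_solve_transpose[OF sym y]) (simp_all add: resolvent_right[OF sym y])
  also have "\<dots> = resolvent n b y j i"
    using ij by (simp add: if_distrib[of "\<lambda>x. _ * x"] cong: if_cong)
  finally show ?thesis .
qed

lemma resolvent_solve:
  assumes sym: "sym_on n b" and y: "y > 0" and i: "i < n"
    and sol: "\<And>k. k < n \<Longrightarrow> (\<Sum>l<n. shifted b y k l * w l) = v k"
  shows "w i = (\<Sum>k<n. resolvent n b y i k * v k)"
  by (subst resolvent_solve_transpose[OF sym y i sol])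
     (auto intro!: sum.cong simp: resolvent_sym[OF sym y i])

lemma resolvent_apply:
  assumes sym: "sym_on n b" and y: "y > 0" and i: "i < n"
  shows "(\<Sum>k<n. shifted b y i k * (\<Sum>l<n. resolvent n b y k l * v l)) = v i"
proof -
  have "(\<Sum>k<n. shifted b y i k * (\<Sum>l<n. resolvent n b y k l * v l))
      = (\<Sum>l<n. (\<Sum>k<n. shifted b y i k * resolvent n b y k l) * v l)"
    unfolding sum_distrib_left sum_distrib_right by (subst sum.swap) (simp add: mult.assoc)
  also have "\<dots> = (\<Sum>l<n. (if i = l then 1 else 0) * v l)"
    using i by (intro sum.cong refl) (simp add: resolvent_right[OF sym y])
  also have "\<dots> = v i" using i by (simp add: if_distrib[of "\<lambda>x. x * _"] cong: if_cong)
  finally show ?thesis .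
qed

text \<open>The energy identity for the j-th column, whose right-hand side is a unit vector. It
  trades a sum of n squares for a single diagonal entry.\<close>

lemma resolvent_Ward:
  assumes sym: "sym_on n b" and y: "y > 0" and j: "j < n"
  shows "Im (resolvent n b y j j) = y * (\<Sum>i<n. (cmod (resolvent n b y i j))\<^sup>2)"
proof -
  have "Im (\<Sum>i<n. cnj (resolvent n b y i j) * (if i = j then 1 else 0))
      = - y * (\<Sum>i<n. (cmod (resolvent n b y i j))\<^sup>2)"
    using j by (intro shifted_energy[OF sym]) (simp add: resolvent_right[OF sym y])
  then show ?thesis using j by (simp add: if_distrib[of "\<lambda>x. _ * x"] cong: if_cong)
qed

lemma resolvent_col_le:
  assumes sym: "sym_on n b" and y: "y > 0" and j: "j < n"
  shows "(\<Sum>i<n. (cmod (resolvent n b y i j))\<^sup>2) \<le> 1 / y\<^sup>2"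
proof -
  have "y\<^sup>2 * (\<Sum>i<n. (cmod (resolvent n b y i j))\<^sup>2) \<le> (\<Sum>i<n. (cmod (if i = j then 1 else 0))\<^sup>2)"
    using j by (intro shifted_norm_le[OF sym y]) (simp add: resolvent_right[OF sym y])
  also have "\<dots> = 1"
    using j by (simp add: if_distrib[of cmod] if_distrib[of "\<lambda>x. x\<^sup>2"] cong: if_cong)
  finally show ?thesis using y by (simp add: divide_simps mult.commute)
qed

lemma resolvent_norm_le:
  assumes sym: "sym_on n b" and y: "y > 0" and ij: "i < n" "j < n"
  shows "cmod (resolvent n b y i j) \<le> 1 / y"
proof -
  have "(cmod (resolvent n b y i j))\<^sup>2 \<le> (\<Sum>i<n. (cmod (resolvent n b y i j))\<^sup>2)"
    using ij by (intro member_le_sum) auto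
  also have "\<dots> \<le> (1 / y)\<^sup>2" using resolvent_col_le[OF sym y ij(2)] by (simp add: power_divide)
  finally show ?thesis by (rule power2_le_imp_le) (use y in auto)
qed

lemma resolvent_trace_norm_le:
  assumes sym: "sym_on n b" and y: "y > 0"
  shows "cmod (resolvent_trace n b y) \<le> real n / y"
proof -
  have "cmod (resolvent_trace n b y) \<le> (\<Sum>i<n. 1 / y)"
    unfolding resolvent_trace_def by (intro sum_norm_le) (simp add: resolvent_norm_le[OF sym y])
  then show ?thesis by simp
qed

text \<open>By the Ward identity a vanishing diagonal entry would annihilate its whole column,
  contradicting invertibility. This permits division by it in the Schur complement formulas.\<close>

lemma resolvent_diag_nonzero:
  assumes sym: "sym_on n b" and y: "y > 0" and i: "i < n"
  shows "resolvent n b y i i \<noteq> 0"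
proof
  assume 0: "resolvent n b y i i = 0"
  with resolvent_Ward[OF sym y i] y have "(\<Sum>k<n. (cmod (resolvent n b y k i))\<^sup>2) = 0" by simp
  then have "\<forall>k<n. resolvent n b y k i = 0" by (simp add: sum_nonneg_eq_0_iff)
  with resolvent_right[OF sym y i i] show False by simp
qed

section \<open>The second resolvent identity and perturbations of the trace\<close>

lemma resolvent_diff:
  assumes sym: "sym_on n b" "sym_on n b'" and y: "y > 0" and ij: "i < n" "j < n"
  shows "resolvent n b y i j = resolvent n b' y i j +
    (\<Sum>k<n. resolvent n b' y i k * (\<Sum>l<n. of_real (b' k l - b k l) * resolvent n b y l j))"
proof -
  have "resolvent n b y i j = (\<Sum>k<n. resolvent n b' y i k *
      ((if k = j then 1 else 0) + (\<Sum>l<n. of_real (b' k l - b k l) * resolvent n b y l j)))"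
  proof (rule resolvent_solve[OF sym(2) y ij(1)])
    fix k assume k: "k < n"
    have "(\<Sum>l<n. shifted b' y k l * resolvent n b y l j)
        = (\<Sum>l<n. shifted b y k l * resolvent n b y l j + of_real (b' k l - b k l) * resolvent n b y l j)"
      by (intro sum.cong refl) (simp add: shifted_def algebra_simps)
    then show "(\<Sum>l<n. shifted b' y k l * resolvent n b y l j)
        = (if k = j then 1 else 0) + (\<Sum>l<n. of_real (b' k l - b k l) * resolvent n b y l j)"
      by (simp add: sum.distrib resolvent_right[OF sym(1) y k ij(2)])
  qed
  also have "\<dots> = (\<Sum>k<n. resolvent n b' y i k * (if k = j then 1 else 0)) +
    (\<Sum>k<n. resolvent n b' y i k * (\<Sum>l<n. of_real (b' k l - b k l) * resolvent n b y l j))"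
    by (simp add: distrib_left sum.distrib)
  also have "(\<Sum>k<n. resolvent n b' y i k * (if k = j then 1 else 0)) = resolvent n b' y i j"
    using ij by (simp add: if_distrib[of "\<lambda>x. _ * x"] cong: if_cong)
  finally show ?thesis .
qed

text \<open>This product appears when the trace in the second resolvent identity is rearranged
  cyclically: each entry of \<open>b' - b\<close> is weighted by one of its entries.\<close>

definition resolvent_prod :: "nat \<Rightarrow> (nat \<Rightarrow> nat \<Rightarrow> real) \<Rightarrow> (nat \<Rightarrow> nat \<Rightarrow> real) \<Rightarrow> real \<Rightarrow> nat \<Rightarrow> nat \<Rightarrow> complex" where
  "resolvent_prod n b b' y l k = (\<Sum>i<n. resolvent n b y l i * resolvent n b' y i k)"

lemma resolvent_trace_diff:
  assumes sym: "sym_on n b" "sym_on n b'" and y: "y > 0"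
  shows "resolvent_trace n b y - resolvent_trace n b' y =
    (\<Sum>k<n. \<Sum>l<n. of_real (b' k l - b k l) * resolvent_prod n b b' y l k)"
proof -
  have "resolvent_trace n b y - resolvent_trace n b' y =
     (\<Sum>i<n. \<Sum>k<n. \<Sum>l<n. of_real (b' k l - b k l) * (resolvent n b y l i * resolvent n b' y i k))"
    unfolding resolvent_trace_def sum_subtractf[symmetric]
    by (intro sum.cong refl) (subst resolvent_diff[OF sym y], auto simp: sum_distrib_left mult_ac)
  also have "\<dots> = (\<Sum>k<n. \<Sum>i<n. \<Sum>l<n. of_real (b' k l - b k l) * (resolvent n b y l i * resolvent n b' y i k))"
    by (rule sum.swap)
  also have "\<dots> = (\<Sum>k<n. \<Sum>l<n. \<Sum>i<n. of_real (b' k l - b k l) * (resolvent n b y l i * resolvent n b' y i k))"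
    by (rule sum.cong[OF refl], rule sum.swap)
  finally show ?thesis by (simp add: resolvent_prod_def sum_distrib_left)
qed

text \<open>The k-th column of the product solves the system of \<open>b\<close> with the k-th
  column of the other resolvent on the right, so the norm bound applies twice.\<close>

lemma resolvent_prod_col_le:
  assumes sym: "sym_on n b" "sym_on n b'" and y: "y > 0" and k: "k < n"
  shows "(\<Sum>l<n. (cmod (resolvent_prod n b b' y l k))\<^sup>2) \<le> 1 / y ^ 4"
proof -
  have "y\<^sup>2 * (\<Sum>l<n. (cmod (resolvent_prod n b b' y l k))\<^sup>2) \<le> (\<Sum>l<n. (cmod (resolvent n b' y l k))\<^sup>2)"
    by (rule shifted_norm_le[OF sym(1) y]) (simp add: resolvent_prod_def resolvent_apply[OF sym(1) y])
  also have "\<dots> \<le> 1 / y\<^sup>2" by (rule resolvent_col_le[OF sym(2) y k])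
  finally show ?thesis using y by (simp add: divide_simps mult_ac power2_eq_square power4_eq_xxxx)
qed

lemma resolvent_prod_norm_le:
  assumes sym: "sym_on n b" "sym_on n b'" and y: "y > 0" and k: "k < n" "l < n"
  shows "cmod (resolvent_prod n b b' y l k) \<le> 1 / y\<^sup>2"
proof -
  have "(cmod (resolvent_prod n b b' y l k))\<^sup>2 \<le> (\<Sum>l<n. (cmod (resolvent_prod n b b' y l k))\<^sup>2)"
    using k by (intro member_le_sum) auto
  also have "\<dots> \<le> (1 / y\<^sup>2)\<^sup>2" using resolvent_prod_col_le[OF sym y k(1)] by (simp add: power_divide)
  finally show ?thesis by (rule power2_le_imp_le) (use y in auto)
qed

text \<open>At most two positions differ (one if p = q), and each is weighted by a number of size at
  most 1 / y^2. The bound is free of n, so dividing by n leaves the small differences that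
  concentration requires.\<close>

lemma resolvent_trace_diff_entry:
  assumes sym: "sym_on n b" "sym_on n b'" and y: "y > 0"
    and same: "\<And>i j. i < n \<Longrightarrow> j < n \<Longrightarrow> (i, j) \<noteq> (p, q) \<Longrightarrow> (i, j) \<noteq> (q, p) \<Longrightarrow> b i j = b' i j"
    and h: "\<And>i j. i < n \<Longrightarrow> j < n \<Longrightarrow> \<bar>b' i j - b i j\<bar> \<le> h" and h0: "h \<ge> 0"
  shows "cmod (resolvent_trace n b y - resolvent_trace n b' y) \<le> 2 * h / y\<^sup>2"
proof -
  have "resolvent_trace n b y - resolvent_trace n b' y =
    (\<Sum>(k, l)\<in>{..<n} \<times> {..<n}. of_real (b' k l - b k l) * resolvent_prod n b b' y l k)"
    by (simp add: resolvent_trace_diff[OF sym y] sum.cartesian_product)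
  also have "\<dots> = (\<Sum>(k, l)\<in>({..<n} \<times> {..<n}) \<inter> {(p, q), (q, p)}. of_real (b' k l - b k l) * resolvent_prod n b b' y l k)"
  proof (rule sum.mono_neutral_right)
    show "\<forall>e\<in>{..<n} \<times> {..<n} - ({..<n} \<times> {..<n}) \<inter> {(p, q), (q, p)}.
        (case e of (k, l) \<Rightarrow> complex_of_real (b' k l - b k l) * resolvent_prod n b b' y l k) = 0"
    proof
      fix e assume e: "e \<in> {..<n} \<times> {..<n} - ({..<n} \<times> {..<n}) \<inter> {(p, q), (q, p)}"
      then have "b (fst e) (snd e) = b' (fst e) (snd e)" by (intro same) (auto simp: prod_eq_iff)
      then show "(case e of (k, l) \<Rightarrow> complex_of_real (b' k l - b k l) * resolvent_prod n b b' y l k) = 0"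
        by (simp add: case_prod_beta)
    qed
  qed auto
  finally have eq: "resolvent_trace n b y - resolvent_trace n b' y =
    (\<Sum>(k, l)\<in>({..<n} \<times> {..<n}) \<inter> {(p, q), (q, p)}. of_real (b' k l - b k l) * resolvent_prod n b b' y l k)" .
  have "cmod (resolvent_trace n b y - resolvent_trace n b' y)
     \<le> (\<Sum>e\<in>({..<n} \<times> {..<n}) \<inter> {(p, q), (q, p)}. h * (1 / y\<^sup>2))"
    unfolding eq
  proof (rule sum_norm_le)
    fix e assume e: "e \<in> ({..<n} \<times> {..<n}) \<inter> {(p, q), (q, p)}"
    have "cmod (of_real (b' (fst e) (snd e) - b (fst e) (snd e)) * resolvent_prod n b b' y (snd e) (fst e)) \<le> h * (1 / y\<^sup>2)"
      unfolding norm_mult norm_of_real using e h0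
      by (intro mult_mono h resolvent_prod_norm_le[OF sym y]) auto
    then show "cmod (case e of (k, l) \<Rightarrow> of_real (b' k l - b k l) * resolvent_prod n b b' y l k) \<le> h * (1 / y\<^sup>2)"
      by (simp only: case_prod_beta)
  qed
  also have "\<dots> = real (card (({..<n} \<times> {..<n}) \<inter> {(p, q), (q, p)})) * (h / y\<^sup>2)" by simp
  also have "\<dots> \<le> 2 * (h / y\<^sup>2)"
  proof (rule mult_right_mono)
    have "card (({..<n} \<times> {..<n}) \<inter> {(p, q), (q, p)}) \<le> card (set [(p, q), (q, p)])"
      by (rule card_mono) auto
    also have "\<dots> \<le> 2" by (rule order_trans[OF card_length]) simp
    finally show "real (card (({..<n} \<times> {..<n}) \<inter> {(p, q), (q, p)})) \<le> 2" by simp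
  qed (use h0 in simp)
  finally show ?thesis by simp
qed

text \<open>Cauchy-Schwarz over all n^2 positions; the column bound makes the square sum of the
  resolvent product at most n / y^4.\<close>

lemma resolvent_trace_diff_Frobenius:
  assumes sym: "sym_on n b" "sym_on n b'" and y: "y > 0"
  shows "(cmod (resolvent_trace n b y - resolvent_trace n b' y))\<^sup>2
    \<le> (\<Sum>k<n. \<Sum>l<n. (b' k l - b k l)\<^sup>2) * (real n / y ^ 4)"
proof -
  let ?S = "{..<n} \<times> {..<n}"
  have "cmod (resolvent_trace n b y - resolvent_trace n b' y)
     \<le> (\<Sum>e\<in>?S. \<bar>b' (fst e) (snd e) - b (fst e) (snd e)\<bar> * cmod (resolvent_prod n b b' y (snd e) (fst e)))"
    unfolding resolvent_trace_diff[OF sym y] sum.cartesian_product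
    by (intro sum_norm_le) (auto simp: norm_mult simp flip: of_real_diff)
  then have "(cmod (resolvent_trace n b y - resolvent_trace n b' y))\<^sup>2
     \<le> (\<Sum>e\<in>?S. \<bar>b' (fst e) (snd e) - b (fst e) (snd e)\<bar> * cmod (resolvent_prod n b b' y (snd e) (fst e)))\<^sup>2"
    by (intro power_mono) auto
  also have "\<dots> \<le> (\<Sum>e\<in>?S. \<bar>b' (fst e) (snd e) - b (fst e) (snd e)\<bar>\<^sup>2) * (\<Sum>e\<in>?S. (cmod (resolvent_prod n b b' y (snd e) (fst e)))\<^sup>2)"
    by (rule Cauchy_Schwarz_ineq_sum)
  also have "(\<Sum>e\<in>?S. \<bar>b' (fst e) (snd e) - b (fst e) (snd e)\<bar>\<^sup>2) = (\<Sum>k<n. \<Sum>l<n. (b' k l - b k l)\<^sup>2)"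
    by (simp add: sum.cartesian_product case_prod_beta)
  also have "(\<Sum>e\<in>?S. (cmod (resolvent_prod n b b' y (snd e) (fst e)))\<^sup>2) = (\<Sum>k<n. \<Sum>l<n. (cmod (resolvent_prod n b b' y l k))\<^sup>2)"
    by (simp add: sum.cartesian_product case_prod_beta)
  also have "\<dots> \<le> (\<Sum>k<n. 1 / y ^ 4)"
    by (intro sum_mono resolvent_prod_col_le[OF sym y]) auto
  finally show ?thesis by (simp add: mult_left_mono sum_nonneg)
qed

text \<open>A Sherman-Morrison argument. If p and p' are the two resolvents applied to u, then p = E
  p' and the trace difference \<open>\<Delta>\<close> is c times the sum of p' p. Hence |\<Delta>|
  |E| is at most |c| |p|^2, while the energy identity gives |Im E| = |c| y |p|^2. Both c and u
  cancel, so a rank-one perturbation of any norm is harmless.\<close>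

lemma resolvent_trace_diff_rank_one:
  assumes sym: "sym_on n b" and y: "y > 0"
  shows "cmod (resolvent_trace n b y - resolvent_trace n (\<lambda>i j. b i j + c * u i * u j) y) \<le> 1 / y"
proof -
  define b' where "b' i j = b i j + c * u i * u j" for i j
  have sym': "sym_on n b'" using sym by (auto simp: sym_on_def b'_def)
  define p where "p i = (\<Sum>k<n. resolvent n b y i k * of_real (u k))" for i
  define p' where "p' i = (\<Sum>k<n. resolvent n b' y i k * of_real (u k))" for i
  define E where "E = 1 + of_real c * (\<Sum>k<n. of_real (u k) * p k)"
  define N where "N = (\<Sum>i<n. (cmod (p i))\<^sup>2)"
  have row: "(\<Sum>l<n. of_real (u l) * resolvent n b y l j) = p j" if "j < n" for j
    unfolding p_def using that by (intro sum.cong refl) (simp add: resolvent_sym[OF sym y, of j] mult.commute)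
  have diff: "resolvent n b y i j = resolvent n b' y i j + of_real c * p' i * p j" if "i < n" "j < n" for i j
  proof -
    have "(\<Sum>k<n. resolvent n b' y i k * (\<Sum>l<n. of_real (b' k l - b k l) * resolvent n b y l j))
        = (\<Sum>k<n. of_real c * (resolvent n b' y i k * of_real (u k)) * (\<Sum>l<n. of_real (u l) * resolvent n b y l j))"
      by (intro sum.cong refl) (simp add: b'_def sum_distrib_left mult_ac)
    also have "\<dots> = of_real c * p' i * p j"
      by (simp add: p'_def row[OF that(2)] sum_distrib_left sum_distrib_right)
    finally show ?thesis using resolvent_diff[OF sym sym' y that] by simp
  qed
  have pp: "p i = E * p' i" if "i < n" for i
  proof -
    have "p i = (\<Sum>j<n. (resolvent n b' y i j + of_real c * p' i * p j) * of_real (u j))"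
      unfolding p_def[of i] using that diff by (intro sum.cong refl) simp
    also have "\<dots> = p' i + of_real c * p' i * (\<Sum>j<n. of_real (u j) * p j)"
    proof -
      have "(\<Sum>j<n. of_real c * p' i * p j * of_real (u j)) = of_real c * p' i * (\<Sum>j<n. of_real (u j) * p j)"
        by (simp add: sum_distrib_left mult_ac)
      then show ?thesis by (simp add: distrib_right sum.distrib p'_def)
    qed
    finally show ?thesis by (simp add: E_def algebra_simps)
  qed
  define \<Delta> where "\<Delta> = resolvent_trace n b y - resolvent_trace n b' y"
  have \<Delta>: "\<Delta> = (\<Sum>i<n. of_real c * p' i * p i)"
    unfolding \<Delta>_def resolvent_trace_def sum_subtractf[symmetric] using diff by (intro sum.cong) auto
  then have "\<Delta> * E = (\<Sum>i<n. of_real c * (p i * p i))"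
    using pp by (simp add: sum_distrib_right) (intro sum.cong refl, simp)
  then have "cmod (\<Delta> * E) \<le> (\<Sum>i<n. \<bar>c\<bar> * (cmod (p i))\<^sup>2)"
    by (metis (no_types, lifting) sum_norm_le norm_mult norm_of_real power2_eq_square order_refl)
  then have "cmod \<Delta> * cmod E \<le> (\<Sum>i<n. \<bar>c\<bar> * (cmod (p i))\<^sup>2)"
    by (simp add: norm_mult)
  also have "\<dots> = \<bar>c\<bar> * N" by (simp add: N_def sum_distrib_left)
  finally have 1: "cmod \<Delta> * cmod E \<le> \<bar>c\<bar> * N" .
  have "Im (\<Sum>i<n. cnj (p i) * of_real (u i)) = - y * N"
    unfolding N_def by (rule shifted_energy[OF sym]) (simp add: p_def resolvent_apply[OF sym y])
  moreover have "(\<Sum>i<n. cnj (p i) * of_real (u i)) = cnj (\<Sum>i<n. of_real (u i) * p i)"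
    by (simp add: mult.commute)
  then have "Im E = - c * Im (\<Sum>i<n. cnj (p i) * of_real (u i))"
    by (simp add: E_def del: cnj_sum Im_sum)
  ultimately have "\<bar>c\<bar> * N * y = \<bar>Im E\<bar>"
    using y by (simp add: abs_mult N_def sum_nonneg)
  also have "\<dots> \<le> cmod E" by (rule abs_Im_le_cmod)
  finally have 2: "\<bar>c\<bar> * N * y \<le> cmod E" .
  have "cmod \<Delta> \<le> 1 / y"
  proof (cases "\<bar>c\<bar> * N = 0")
    case True
    then have "c = 0 \<or> (\<forall>i<n. p i = 0)" by (auto simp: N_def sum_nonneg_eq_0_iff)
    then have "\<Delta> = 0" by (auto simp: \<Delta>)
    then show ?thesis using y by simp
  next
    case False
    then have pos: "\<bar>c\<bar> * N > 0" by (simp add: N_def sum_nonneg less_le)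
    have "cmod \<Delta> * (\<bar>c\<bar> * N * y) \<le> cmod \<Delta> * cmod E" using 2 by (intro mult_left_mono) auto
    with 1 have "(cmod \<Delta> * y) * (\<bar>c\<bar> * N) \<le> 1 * (\<bar>c\<bar> * N)" by (simp add: mult_ac)
    then have "cmod \<Delta> * y \<le> 1" using pos mult_right_le_imp_le by blast
    then show ?thesis using y by (simp add: divide_simps)
  qed
  then show ?thesis by (simp add: \<Delta>_def b'_def[abs_def])
qed

text \<open>Zeroing a row and a column instead of deleting them keeps the dimension; off the index \<open>i\<close> the
  resolvent is that of the minor.\<close>

definition drop_index :: "nat \<Rightarrow> (nat \<Rightarrow> nat \<Rightarrow> real) \<Rightarrow> nat \<Rightarrow> nat \<Rightarrow> real" where
  "drop_index i b k l = (if k = i \<or> l = i then 0 else b k l)"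

lemma sym_on_drop_index: "sym_on n b \<Longrightarrow> sym_on n (drop_index i b)"
  by (auto simp: sym_on_def drop_index_def)

text \<open>Both parts come from the second resolvent identity between \<open>b\<close> and the
  matrix with index i dropped, because the perturbation lives in row and column i and H does not
  connect i with other indices. The kernel H in the first formula no longer involves row i of
  \<open>b\<close>; the second formula exhibits the effect of dropping i as a rank-one term.\<close>

lemma resolvent_Schur:
  assumes sym: "sym_on n b" and y: "y > 0" and i: "i < n"
  defines "G \<equiv> resolvent n b y" and "H \<equiv> resolvent n (drop_index i b) y"
  shows "G i i * (of_real (b i i) - \<i> * of_real y
           - (\<Sum>j\<in>{..<n}-{i}. \<Sum>k\<in>{..<n}-{i}. of_real (b i j) * of_real (b i k) * H j k)) = 1"
    and "\<And>k j. k < n \<Longrightarrow> j < n \<Longrightarrow> k \<noteq> i \<Longrightarrow> j \<noteq> i \<Longrightarrow> G k j = H k j + G k i * G i j / G i i"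
proof -
  let ?J = "{..<n} - {i}"
  have sym': "sym_on n (drop_index i b)" by (rule sym_on_drop_index[OF sym])
  have Gii: "G i i \<noteq> 0" unfolding G_def by (rule resolvent_diag_nonzero[OF sym y i])
  \<comment> \<open>Row i of the reduced matrix contains only the shift, so the defining equation
    reads - iy H_ij = 0.\<close>
  have Hi: "H i j = 0" if "j < n" "j \<noteq> i" for j
  proof -
    have "(\<Sum>k<n. of_real (drop_index i b i k) * H k j) - \<i> * of_real y * H i j = 0"
      using resolvent_right[OF sym' y i that(1)] that unfolding shifted_sum[OF i] by (simp add: H_def)
    then show ?thesis using y by (simp add: drop_index_def)
  qed
  have Hki: "H k i = 0" if "k < n" "k \<noteq> i" for k
    using Hi[OF that] resolvent_sym[OF sym' y that(1) i] by (simp add: H_def)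
  define Hb where "Hb k = (\<Sum>p\<in>?J. H k p * of_real (b p i))" for k
  have eq: "G k j = H k j - Hb k * G i j" if k: "k < n" "k \<noteq> i" and j: "j < n" for k j
  proof -
    have "(\<Sum>p<n. H k p * (\<Sum>q<n. of_real (drop_index i b p q - b p q) * G q j))
        = (\<Sum>p\<in>?J. H k p * (\<Sum>q<n. of_real (drop_index i b p q - b p q) * G q j))"
      using Hki[OF k] i by (intro sum.mono_neutral_right) auto
    also have "\<dots> = (\<Sum>p\<in>?J. H k p * (- of_real (b p i) * G i j))"
    proof (intro sum.cong refl arg_cong2[where f = "(*)"])
      fix p assume p: "p \<in> ?J"
      have "(\<Sum>q<n. of_real (drop_index i b p q - b p q) * G q j)
          = (\<Sum>q<n. if q = i then - of_real (b p i) * G i j else 0)"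
        using p by (intro sum.cong refl) (auto simp: drop_index_def)
      then show "(\<Sum>q<n. of_real (drop_index i b p q - b p q) * G q j) = - of_real (b p i) * G i j"
        using i by simp
    qed
    also have "\<dots> = - Hb k * G i j"
      unfolding Hb_def sum_negf[symmetric] sum_distrib_right by (intro sum.cong refl) simp
    finally show ?thesis
      using resolvent_diff[OF sym sym' y k(1) j] by (simp add: G_def H_def)
  qed
  have Gki: "G k i = - Hb k * G i i" if "k < n" "k \<noteq> i" for k
    using eq[OF that i] Hki[OF that] by simp
  show "G k j = H k j + G k i * G i j / G i i" if "k < n" "j < n" "k \<noteq> i" "j \<noteq> i" for k j
    using eq[of k j] Gki[of k] that Gii by simp
  have "1 = (\<Sum>k<n. of_real (b i k) * G k i) - \<i> * of_real y * G i i"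
    using resolvent_right[OF sym y i i] unfolding shifted_sum[OF i] by (simp add: G_def)
  also have "(\<Sum>k<n. of_real (b i k) * G k i) = of_real (b i i) * G i i + (\<Sum>k\<in>?J. of_real (b i k) * G k i)"
    using i by (subst sum.remove[of _ i]) auto
  also have "(\<Sum>k\<in>?J. of_real (b i k) * G k i) = - (\<Sum>k\<in>?J. of_real (b i k) * Hb k) * G i i"
    unfolding sum_negf[symmetric] sum_distrib_right using Gki by (intro sum.cong refl) simp
  also have "(\<Sum>k\<in>?J. of_real (b i k) * Hb k) = (\<Sum>j\<in>?J. \<Sum>k\<in>?J. of_real (b i j) * of_real (b i k) * H j k)"
    unfolding Hb_def sum_distrib_left
    using i by (intro sum.cong refl) (auto simp: sym_onD[OF sym, of i] mult_ac)
  finally show "G i i * (of_real (b i i) - \<i> * of_real y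
           - (\<Sum>j\<in>?J. \<Sum>k\<in>?J. of_real (b i j) * of_real (b i k) * H j k)) = 1"
    by (simp add: algebra_simps)
qed

text \<open>By symmetry the differences are - G_ji^2 / G_ii, and the Ward identity sums the |G_ji|^2
  over all j to Im G_ii / y. The total stays bounded uniformly in n although n - 1 diagonal entries
  change.\<close>

lemma resolvent_minor_diag_diff:
  assumes sym: "sym_on n b" and y: "y > 0" and i: "i < n"
    and s: "\<And>j. j < n \<Longrightarrow> \<bar>s j\<bar> \<le> S" and S: "S \<ge> 0"
  shows "cmod (\<Sum>j\<in>{..<n}-{i}. of_real (s j) * (resolvent n (drop_index i b) y j j - resolvent n b y j j)) \<le> S / y"
proof -
  define G where "G = resolvent n b y"
  have Gii: "G i i \<noteq> 0" unfolding G_def by (rule resolvent_diag_nonzero[OF sym y i])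
  have "cmod (\<Sum>j\<in>{..<n}-{i}. of_real (s j) * (resolvent n (drop_index i b) y j j - G j j))
      \<le> (\<Sum>j\<in>{..<n}-{i}. S * (cmod (G j i))\<^sup>2 / cmod (G i i))"
  proof (rule sum_norm_le)
    fix j assume "j \<in> {..<n}-{i}"
    then have j: "j < n" "j \<noteq> i" by auto
    have "G j j = resolvent n (drop_index i b) y j j + G j i * G i j / G i i"
      unfolding G_def using resolvent_Schur(2)[OF sym y i j(1) j(1) j(2) j(2)] .
    then have "resolvent n (drop_index i b) y j j - G j j = - (G j i * G i j / G i i)" by (simp add: algebra_simps)
    then have "cmod (of_real (s j) * (resolvent n (drop_index i b) y j j - G j j)) = \<bar>s j\<bar> * (cmod (G j i * G i j) / cmod (G i i))"
      by (simp only: norm_mult norm_divide norm_minus_cancel norm_of_real)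
    also have "cmod (G j i * G i j) = (cmod (G j i))\<^sup>2"
      using resolvent_sym[OF sym y i j(1)] by (simp add: G_def norm_mult power2_eq_square)
    also have "\<bar>s j\<bar> * ((cmod (G j i))\<^sup>2 / cmod (G i i)) \<le> S * ((cmod (G j i))\<^sup>2 / cmod (G i i))"
      using s[OF j(1)] by (intro mult_right_mono) auto
    finally show "cmod (of_real (s j) * (resolvent n (drop_index i b) y j j - G j j)) \<le> S * (cmod (G j i))\<^sup>2 / cmod (G i i)"
      by simp
  qed
  also have "\<dots> \<le> (\<Sum>j<n. S * (cmod (G j i))\<^sup>2 / cmod (G i i))"
    using S by (intro sum_mono2) auto
  also have "\<dots> = S * (\<Sum>j<n. (cmod (G j i))\<^sup>2) / cmod (G i i)"
    by (simp add: sum_distrib_left sum_divide_distrib)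
  also have "(\<Sum>j<n. (cmod (G j i))\<^sup>2) = Im (G i i) / y"
    using resolvent_Ward[OF sym y i] y by (simp add: G_def)
  also have "S * (Im (G i i) / y) / cmod (G i i) \<le> S / y"
  proof -
    have "Im (G i i) / cmod (G i i) \<le> 1" using Gii abs_Im_le_cmod[of "G i i"] by (simp add: divide_simps)
    then have "(S / y) * (Im (G i i) / cmod (G i i)) \<le> (S / y) * 1" using S y by (intro mult_left_mono) auto
    then show ?thesis by (simp add: mult_ac)
  qed
  finally show ?thesis by (simp add: G_def)
qed

subsection \<open>Eigenvalues of real symmetric matrices\<close>

lemma poly_map_poly_of_real:
  "poly (map_poly of_real p) (of_real x) = (of_real (poly p x) :: complex)"
  by (induction p) (simp_all add: map_poly_pCons)

text \<open>The energy identity at y = 0, with right-hand side a w, says that Im a times the squared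
  norm of w vanishes.\<close>

lemma symmetric_eigenvalue_real:
  assumes sym: "sym_on n b"
    and ev: "eigenvalue (mat n n (\<lambda>(i, j). complex_of_real (b i j))) a"
  shows "Im a = 0"
proof -
  let ?A = "mat n n (\<lambda>(i, j). complex_of_real (b i j))"
  obtain v where v: "v \<in> carrier_vec n" "v \<noteq> 0\<^sub>v n" "?A *\<^sub>v v = a \<cdot>\<^sub>v v"
    using ev unfolding eigenvalue_def eigenvector_def by auto
  have "(\<Sum>k<n. shifted b 0 i k * v $ k) = a * v $ i" if "i < n" for i
  proof -
    have "(?A *\<^sub>v v) $ i = (a \<cdot>\<^sub>v v) $ i" using v by simp
    then show ?thesis using that v(1)
      by (simp add: scalar_prod_def lessThan_atLeast0 shifted_def cong: if_cong)
  qed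
  from shifted_energy[OF sym this]
  have "Im (\<Sum>i<n. cnj (v $ i) * (a * v $ i)) = 0" by simp
  moreover have "(\<Sum>i<n. cnj (v $ i) * (a * v $ i)) = a * of_real (\<Sum>i<n. (cmod (v $ i))\<^sup>2)"
    unfolding of_real_sum complex_norm_square sum_distrib_left by (intro sum.cong refl) simp
  ultimately have "Im a * (\<Sum>i<n. (cmod (v $ i))\<^sup>2) = 0" by simp
  moreover have "(\<Sum>i<n. (cmod (v $ i))\<^sup>2) \<noteq> 0"
  proof
    assume "(\<Sum>i<n. (cmod (v $ i))\<^sup>2) = 0"
    then have "\<forall>i<n. v $ i = 0" by (simp add: sum_nonneg_eq_0_iff)
    then have "v = 0\<^sub>v n" using v(1) by (intro eq_vecI) auto
    then show False using v(2) by simp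
  qed
  ultimately show ?thesis by simp
qed

text \<open>Over the complex numbers the polynomial splits. Its roots are real, so the same linear
  factors give the real polynomial, as a comparison of values at real points shows.\<close>

lemma symmetric_char_poly_factorized:
  assumes sym: "sym_on n b"
  obtains es where "length es = n"
    "char_poly (mat n n (\<lambda>(i, j). b i j)) = (\<Prod>e\<leftarrow>es. [:- e, 1:])"
    "char_poly (mat n n (\<lambda>(i, j). complex_of_real (b i j))) = (\<Prod>e\<leftarrow>map of_real es. [:- e, 1:])"
proof -
  let ?B = "mat n n (\<lambda>(i, j). b i j)"
  let ?A = "mat n n (\<lambda>(i, j). complex_of_real (b i j))"
  have A: "?A \<in> carrier_mat n n" and B: "?B \<in> carrier_mat n n" by auto
  have AB: "?A = map_mat of_real ?B" by (rule eq_matI) auto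
  obtain as where as: "char_poly ?A = (\<Prod>a\<leftarrow>as. [:- a, 1:])" "length as = n"
    using char_poly_factorized[OF A] by blast
  have "of_real (Re a) = a" if "a \<in> set as" for a
  proof -
    have "poly (char_poly ?A) a = 0"
      unfolding as(1) using that by (simp add: poly_prod_list prod_list_zero_iff o_def image_iff)
    then have "eigenvalue ?A a" using eigenvalue_root_char_poly[OF A] by blast
    from symmetric_eigenvalue_real[OF sym this] show ?thesis by (simp add: complex_eq_iff)
  qed
  then have re: "map complex_of_real (map Re as) = as" by (simp add: map_idI)
  have "poly (char_poly ?B) x = poly (\<Prod>e\<leftarrow>map Re as. [:- e, 1:]) x" for x
  proof -
    have "complex_of_real (poly (char_poly ?B) x) = poly (char_poly ?A) (of_real x)"
      unfolding AB of_real_hom.char_poly_hom[OF B] poly_map_poly_of_real ..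
    also have "\<dots> = poly (\<Prod>e\<leftarrow>map complex_of_real (map Re as). [:- e, 1:]) (of_real x)"
      unfolding re as(1) ..
    also have "\<dots> = of_real (poly (\<Prod>e\<leftarrow>map Re as. [:- e, 1:]) x)"
      by (induction as) (simp_all add: algebra_simps)
    finally show ?thesis by (simp only: of_real_eq_iff)
  qed
  then have "char_poly ?B = (\<Prod>e\<leftarrow>map Re as. [:- e, 1:])"
    using poly_eq_poly_eq_iff by blast
  moreover have "char_poly ?A = (\<Prod>e\<leftarrow>map of_real (map Re as). [:- e, 1:])"
    unfolding re by (rule as(1))
  moreover have "length (map Re as) = n" using as(2) by simp
  ultimately show ?thesis by (rule that[rotated])
qed

lemma eigenvalues_mset_eq:
  assumes "char_poly B = (\<Prod>e\<leftarrow>es. [:- e, 1:])"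
  shows "eigenvalues_mset B = mset es"
proof -
  have "(\<Prod>e\<leftarrow>es. [:- e, 1:]) \<noteq> 0 \<and> proots (\<Prod>e\<leftarrow>es. [:- e, 1:]) = mset es"
    by (induction es) (auto simp: proots_mult simp del: mult_pCons_left)
  then show ?thesis by (simp add: eigenvalues_mset_def assms)
qed

section \<open>Traces under similarity and inverses of triangular matrices\<close>

definition diag_sum :: "nat \<Rightarrow> complex mat \<Rightarrow> complex" where
  "diag_sum n A = (\<Sum>i<n. A $$ (i, i))"

lemma diag_sum_mult_commute:
  assumes A: "A \<in> carrier_mat n n" and B: "B \<in> carrier_mat n n"
  shows "diag_sum n (A * B) = diag_sum n (B * A)"
proof -
  have "diag_sum n (A * B) = (\<Sum>i<n. \<Sum>k<n. A $$ (i, k) * B $$ (k, i))"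
    using A B by (auto simp: diag_sum_def scalar_prod_def lessThan_atLeast0 intro!: sum.cong)
  also have "\<dots> = (\<Sum>k<n. \<Sum>i<n. A $$ (i, k) * B $$ (k, i))" by (rule sum.swap)
  also have "\<dots> = diag_sum n (B * A)"
    using A B by (auto simp: diag_sum_def scalar_prod_def lessThan_atLeast0 mult.commute intro!: sum.cong)
  finally show ?thesis .
qed

lemma diag_sum_similar:
  assumes "P \<in> carrier_mat n n" "Q \<in> carrier_mat n n" "A \<in> carrier_mat n n" "P * Q = 1\<^sub>m n"
  shows "diag_sum n (Q * A * P) = diag_sum n A"
proof -
  have "diag_sum n (Q * A * P) = diag_sum n (P * (Q * A))"
    using assms by (intro diag_sum_mult_commute) auto
  also have "P * (Q * A) = A" using assms by (simp flip: assoc_mult_mat)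
  finally show ?thesis .
qed

lemma upper_triangular_inverse_diag:
  assumes T: "T \<in> carrier_mat n n" and X: "X \<in> carrier_mat n n" and ut: "upper_triangular T"
    and nz: "\<And>i. i < n \<Longrightarrow> T $$ (i, i) \<noteq> (0 :: complex)" and inv: "T * X = 1\<^sub>m n" and i: "i < n"
  shows "X $$ (i, i) = 1 / T $$ (i, i)"
proof -
  have entry: "(\<Sum>k<n. T $$ (r, k) * X $$ (k, c)) = (if r = c then 1 else 0)" if "r < n" "c < n" for r c
  proof -
    have "(T * X) $$ (r, c) = (1\<^sub>m n :: complex mat) $$ (r, c)" using inv by simp
    then show ?thesis using that T X by (simp add: scalar_prod_def lessThan_atLeast0)
  qed
  have split: "(\<Sum>k<n. T $$ (r, k) * X $$ (k, c)) = T $$ (r, r) * X $$ (r, c)"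
    if "r < n" "c < n" and "\<And>k. r < k \<Longrightarrow> k < n \<Longrightarrow> X $$ (k, c) = 0" for r c
  proof -
    have "T $$ (r, k) * X $$ (k, c) = 0" if "k < n" "k \<noteq> r" for k
      using that \<open>r < n\<close> ut T \<open>\<And>k. r < k \<Longrightarrow> k < n \<Longrightarrow> X $$ (k, c) = 0\<close>
      by (cases "k < r") (auto dest: upper_triangularD)
    then have "(\<Sum>k<n. T $$ (r, k) * X $$ (k, c)) = (\<Sum>k\<in>{r}. T $$ (r, k) * X $$ (k, c))"
      using \<open>r < n\<close> by (intro sum.mono_neutral_right) (blast | simp)+
    then show ?thesis by simp
  qed
  \<comment> \<open>Back substitution: the induction on \<open>n - r\<close> runs from the last row
    upwards, because row r of a triangular T involves only rows of X from r on.\<close>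
  have low: "X $$ (r, c) = 0" if "c < r" "r < n" for r c
    using that
  proof (induction "n - r" arbitrary: r rule: less_induct)
    case less
    have "X $$ (k, c) = 0" if "r < k" "k < n" for k
      using less.hyps[of k] less.prems that by simp
    then have "T $$ (r, r) * X $$ (r, c) = 0"
      using entry[of r c] split[of r c] less.prems by simp
    then show ?case using nz less.prems by simp
  qed
  have "T $$ (i, i) * X $$ (i, i) = 1"
    using entry[OF i i] split[OF i i] low i by simp
  then show ?thesis using nz[OF i] by (simp add: field_simps)
qed

text \<open>One Schur triangularisation serves both formulas. Conjugation preserves traces and turns
  the shifted matrix into T - iy, and the diagonal of the inverse or of the square of a triangular
  matrix depends only on its diagonal. Orthogonal diagonalisation is thus avoided.\<close>

lemma symmetric_spectral_sums:
  assumes sym: "sym_on n b"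
  obtains es where "length es = n"
    "eigenvalues_mset (mat n n (\<lambda>(i, j). b i j)) = mset es"
    "\<And>y. y > 0 \<Longrightarrow> resolvent_trace n b y = (\<Sum>i<n. 1 / (of_real (es ! i) - \<i> * of_real y))"
    "(\<Sum>i<n. (es ! i)\<^sup>2) = (\<Sum>i<n. \<Sum>j<n. (b i j)\<^sup>2)"
proof -
  let ?A = "mat n n (\<lambda>(i, j). complex_of_real (b i j))"
  have A: "?A \<in> carrier_mat n n" by auto
  obtain es where es: "length es = n"
    "char_poly (mat n n (\<lambda>(i, j). b i j)) = (\<Prod>e\<leftarrow>es. [:- e, 1:])"
    "char_poly ?A = (\<Prod>e\<leftarrow>map of_real es. [:- e, 1:])"
    using symmetric_char_poly_factorized[OF sym] by blast
  obtain T P Q where schur: "schur_decomposition ?A (map of_real es) = (T, P, Q)"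
    by (metis prod_cases3)
  from schur_decomposition[OF A es(3) schur]
  have wit: "similar_mat_wit ?A T P Q" and ut: "upper_triangular T" and dT: "diag_mat T = map of_real es" by auto
  note D = similar_mat_witD2[OF A wit]
  have PQ: "P * Q = 1\<^sub>m n" and QP: "Q * P = 1\<^sub>m n" and AT: "?A = P * T * Q"
    and T: "T \<in> carrier_mat n n" and P: "P \<in> carrier_mat n n" and Q: "Q \<in> carrier_mat n n"
    using D by auto
  have Tii: "T $$ (i, i) = of_real (es ! i)" if "i < n" for i
  proof -
    have "diag_mat T ! i = T $$ (i, i)" using that T by (simp add: diag_mat_def)
    then show ?thesis using dT that es(1) by simp
  qed
  have QAP: "Q * ?A * P = T"
  proof -
    have "Q * ?A * P = (Q * P) * T * (Q * P)"
      unfolding AT using P Q T by (simp add: assoc_mult_mat[of _ n n _ n _ n])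
    then show ?thesis using QP T by simp
  qed
  have tr: "resolvent_trace n b y = (\<Sum>i<n. 1 / (of_real (es ! i) - \<i> * of_real y))" if y: "y > 0" for y
  proof -
    define M where "M = mat n n (\<lambda>(i, j). shifted b y i j)"
    define G where "G = mat n n (\<lambda>(i, j). resolvent n b y i j)"
    define X where "X = Q * G * P"
    define S where "S = Q * M * P"
    have M: "M \<in> carrier_mat n n" and G: "G \<in> carrier_mat n n" by (auto simp: M_def G_def)
    have X: "X \<in> carrier_mat n n" and S: "S \<in> carrier_mat n n" using P Q G M by (auto simp: X_def S_def)
    have MG: "M * G = 1\<^sub>m n"
      by (rule eq_matI) (auto simp: M_def G_def scalar_prod_def lessThan_atLeast0[symmetric] resolvent_right[OF sym y])
    have SX: "S * X = 1\<^sub>m n"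
    proof -
      have "S * X = Q * (M * ((P * Q) * (G * P)))"
        unfolding S_def X_def using P Q M G by (simp add: assoc_mult_mat[of _ n n _ n _ n])
      also have "(P * Q) * (G * P) = G * P" using PQ P G by simp
      also have "M * (G * P) = (M * G) * P" using P M G by (simp add: assoc_mult_mat[of _ n n _ n _ n])
      also have "Q * ((M * G) * P) = 1\<^sub>m n" using MG P QP by simp
      finally show ?thesis .
    qed
    have M_eq: "M = ?A + (- (\<i> * of_real y)) \<cdot>\<^sub>m 1\<^sub>m n"
      by (rule eq_matI) (auto simp: M_def shifted_def)
    have S_eq: "S = T + (- (\<i> * of_real y)) \<cdot>\<^sub>m 1\<^sub>m n"
    proof -
      have "S = (Q * ?A + Q * ((- (\<i> * of_real y)) \<cdot>\<^sub>m 1\<^sub>m n)) * P"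
        unfolding S_def M_eq using Q by (subst mult_add_distrib_mat[of _ n n _ n]) auto
      also have "\<dots> = Q * ?A * P + Q * ((- (\<i> * of_real y)) \<cdot>\<^sub>m 1\<^sub>m n) * P"
        using Q P by (subst add_mult_distrib_mat[of _ n n]) auto
      also have "Q * ((- (\<i> * of_real y)) \<cdot>\<^sub>m 1\<^sub>m n) * P = (- (\<i> * of_real y)) \<cdot>\<^sub>m 1\<^sub>m n"
        using Q P QP by (simp add: mult_smult_distrib[of _ n n _ n] mult_smult_assoc_mat[of _ n n _ n])
      finally show ?thesis using QAP by simp
    qed
    have Sii: "S $$ (i, i) = of_real (es ! i) - \<i> * of_real y" if "i < n" for i
      using that T Tii by (simp add: S_eq)
    have "upper_triangular S"
      using ut T unfolding S_eq upper_triangular_def by auto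
    moreover have "S $$ (i, i) \<noteq> 0" if "i < n" for i
      using y Sii[OF that] by (simp add: complex_eq_iff)
    ultimately have "X $$ (i, i) = 1 / (of_real (es ! i) - \<i> * of_real y)" if "i < n" for i
      using upper_triangular_inverse_diag[OF S X _ _ SX that] Sii[OF that] by simp
    then have "diag_sum n X = (\<Sum>i<n. 1 / (of_real (es ! i) - \<i> * of_real y))"
      by (simp add: diag_sum_def)
    moreover have "diag_sum n X = diag_sum n G"
      unfolding X_def by (rule diag_sum_similar[OF P Q G PQ])
    moreover have "diag_sum n G = resolvent_trace n b y"
      by (simp add: diag_sum_def G_def resolvent_trace_def)
    ultimately show ?thesis by simp
  qed
  have sq: "(\<Sum>i<n. (es ! i)\<^sup>2) = (\<Sum>i<n. \<Sum>j<n. (b i j)\<^sup>2)"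
  proof -
    have "T * T = Q * (?A * ?A) * P"
    proof -
      have "T * T = Q * ?A * (P * Q) * ?A * P"
        unfolding QAP[symmetric] using P Q A
        by (simp add: assoc_mult_mat[of _ n n _ n _ n] mult_carrier_mat[of _ n n _ n])
      then show ?thesis using PQ P Q A
        by (simp add: assoc_mult_mat[of _ n n _ n _ n] mult_carrier_mat[of _ n n _ n])
    qed
    then have "diag_sum n (T * T) = diag_sum n (?A * ?A)"
      using diag_sum_similar[OF P Q mult_carrier_mat[OF A A] PQ] by simp
    moreover have "diag_sum n (?A * ?A) = of_real (\<Sum>i<n. \<Sum>j<n. (b i j)\<^sup>2)"
      by (auto simp: diag_sum_def scalar_prod_def lessThan_atLeast0[symmetric] power2_eq_square sym_onD[OF sym]
          intro!: sum.cong)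
    moreover have "diag_sum n (T * T) = of_real (\<Sum>i<n. (es ! i)\<^sup>2)"
    proof -
      have "(T * T) $$ (i, i) = of_real ((es ! i)\<^sup>2)" if i: "i < n" for i
      proof -
        have "(T * T) $$ (i, i) = (\<Sum>k<n. T $$ (i, k) * T $$ (k, i))"
          using i T by (simp add: scalar_prod_def lessThan_atLeast0)
        also have "\<dots> = (\<Sum>k\<in>{i}. T $$ (i, k) * T $$ (k, i))"
        proof (rule sum.mono_neutral_right)
          show "\<forall>k\<in>{..<n} - {i}. T $$ (i, k) * T $$ (k, i) = 0"
          proof
            fix k assume "k \<in> {..<n} - {i}"
            then have "k < n" "k < i \<or> i < k" by auto
            then show "T $$ (i, k) * T $$ (k, i) = 0"
              using i ut T by (auto dest: upper_triangularD)
          qed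
        qed (use i in auto)
        finally show ?thesis using Tii[OF i] by (simp add: power2_eq_square)
      qed
      then show ?thesis by (simp add: diag_sum_def)
    qed
    ultimately show ?thesis by (metis of_real_eq_iff)
  qed
  show ?thesis by (rule that[OF es(1) eigenvalues_mset_eq[OF es(2)] tr sq])
qed

subsection \<open>Measurability of resolvent entries\<close>

text \<open>The Leibniz formula makes the determinant a polynomial in the entries.\<close>

lemma det_measurable:
  assumes "\<And>\<omega>. A \<omega> \<in> carrier_mat n n"
    and "\<And>i j. i < n \<Longrightarrow> j < n \<Longrightarrow> (\<lambda>\<omega>. A \<omega> $$ (i, j)) \<in> borel_measurable M"
  shows "(\<lambda>\<omega>. det (A \<omega>) :: complex) \<in> borel_measurable M"
proof -
  have "(\<lambda>\<omega>. det (A \<omega>)) = (\<lambda>\<omega>. \<Sum>p\<in>{p. p permutes {0..<n}}. signof p * (\<Prod>i=0..<n. A \<omega> $$ (i, p i)))"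
    using assms(1) by (intro ext) (rule det_def')
  moreover have "(\<lambda>\<omega>. \<Sum>p\<in>{p. p permutes {0..<n}}. signof p * (\<Prod>i=0..<n. A \<omega> $$ (i, p i))) \<in> borel_measurable M"
    by (intro borel_measurable_sum borel_measurable_times borel_measurable_prod borel_measurable_const assms(2))
      (use permutes_in_image in fastforce)+
  ultimately show ?thesis by simp
qed

lemma resolvent_measurable:
  assumes meas: "\<And>i j. i < n \<Longrightarrow> j < n \<Longrightarrow> (\<lambda>\<omega>. b \<omega> i j) \<in> borel_measurable M"
    and ij: "i < n" "j < n"
  shows "(\<lambda>\<omega>. resolvent n (b \<omega>) y i j) \<in> borel_measurable M"
proof -
  define A where "A \<omega> = mat n n (\<lambda>(i, j). shifted (b \<omega>) y i j)" for \<omega>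
  have A: "A \<omega> \<in> carrier_mat n n" for \<omega> by (simp add: A_def)
  have ent: "(\<lambda>\<omega>. A \<omega> $$ (k, l)) \<in> borel_measurable M" if "k < n" "l < n" for k l
  proof -
    have "(\<lambda>\<omega>. A \<omega> $$ (k, l)) = (\<lambda>\<omega>. of_real (b \<omega> k l) - (if k = l then \<i> * of_real y else 0))"
      using that by (simp add: A_def shifted_def)
    then show ?thesis using meas[OF that] by simp
  qed
  have "(\<lambda>\<omega>. det (mat_delete (A \<omega>) j i)) \<in> borel_measurable M"
  proof (rule det_measurable[where n = "n - 1"])
    show "mat_delete (A \<omega>) j i \<in> carrier_mat (n - 1) (n - 1)" for \<omega>
      using A[of \<omega>] by (rule mat_delete_carrier)
    fix k l assume "k < n - 1" "l < n - 1"
    then have "(\<lambda>\<omega>. mat_delete (A \<omega>) j i $$ (k, l))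
        = (\<lambda>\<omega>. A \<omega> $$ (if k < j then k else Suc k, if l < i then l else Suc l))"
      using A by (intro ext) (simp add: mat_delete_def A_def)
    then show "(\<lambda>\<omega>. mat_delete (A \<omega>) j i $$ (k, l)) \<in> borel_measurable M"
      using \<open>k < n - 1\<close> \<open>l < n - 1\<close> by (simp add: ent)
  qed
  moreover have "(\<lambda>\<omega>. det (A \<omega>)) \<in> borel_measurable M"
    by (rule det_measurable[OF A ent])
  moreover have "(\<lambda>\<omega>. resolvent n (b \<omega>) y i j) =
      (\<lambda>\<omega>. (- 1) ^ (j + i) * det (mat_delete (A \<omega>) j i) / det (A \<omega>))"
    using ij by (simp add: resolvent_def A_def[symmetric] adj_mat_def cofactor_def) (simp add: A_def)
  ultimately show ?thesis by simp
qed

lemma resolvent_trace_measurable: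
  assumes "\<And>i j. i < n \<Longrightarrow> j < n \<Longrightarrow> (\<lambda>\<omega>. b \<omega> i j) \<in> borel_measurable M"
  shows "(\<lambda>\<omega>. resolvent_trace n (b \<omega>) y) \<in> borel_measurable M"
  unfolding resolvent_trace_def by (intro borel_measurable_sum resolvent_measurable assms) auto

subsection \<open>Bounded differences and product measures\<close>

text \<open>Integrating over coordinate \<open>e\<close> first pulls out \<open>\<Psi>\<close>,
  which does not depend on it, and leaves the vanishing mean. This plays the role of conditioning on
  the other entries.\<close>

lemma integral_PiM_factor_zero:
  fixes \<mu> :: "'i \<Rightarrow> real measure" and \<Psi> :: "('i \<Rightarrow> real) \<Rightarrow> complex"
  assumes prob: "\<And>i. prob_space (\<mu> i)" and I: "finite I" "e \<in> I"
    and int: "integrable (PiM I \<mu>) (\<lambda>x. of_real (\<phi> (x e)) * \<Psi> x)"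
    and indep: "\<And>x t. \<Psi> (x(e := t)) = \<Psi> x"
    and mean: "(\<integral>t. \<phi> t \<partial>\<mu> e) = 0"
  shows "(\<integral>x. of_real (\<phi> (x e)) * \<Psi> x \<partial>PiM I \<mu>) = 0"
proof -
  interpret product_sigma_finite \<mu>
    by (intro product_sigma_finite.intro prob_space_imp_sigma_finite prob)
  have I': "insert e (I - {e}) = I" using I by auto
  have "(\<integral>x. of_real (\<phi> (x e)) * \<Psi> x \<partial>PiM I \<mu>) =
      (\<integral>x. (\<integral>t. of_real (\<phi> ((x(e := t)) e)) * \<Psi> (x(e := t)) \<partial>\<mu> e) \<partial>PiM (I - {e}) \<mu>)"
    using product_integral_insert[of "I - {e}" e "\<lambda>x. of_real (\<phi> (x e)) * \<Psi> x"] I int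
    unfolding I' by simp
  also have "\<dots> = 0"
    by (simp add: indep mean)
  finally show ?thesis .
qed

text \<open>Hoeffding's lemma on [-c, c]; the length 2c of this interval turns the constant 1/8 into
  1/2.\<close>

lemma (in prob_space) Hoeffding_exp_moment:
  fixes f :: "'a \<Rightarrow> real"
  assumes f[measurable]: "f \<in> borel_measurable M" and b: "\<And>x. x \<in> space M \<Longrightarrow> \<bar>f x\<bar> \<le> c"
    and mean: "expectation f = 0" and l: "l > 0"
  shows "expectation (\<lambda>x. exp (l * f x)) \<le> exp (l\<^sup>2 * c\<^sup>2 / 2)"
proof -
  interpret interval_bounded_random_variable M f "- c" c
    by unfold_locales (use b in \<open>auto simp: abs_le_iff minus_le_iff\<close>)
  have int: "integrable M (\<lambda>x. exp (l * f x))"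
    by (rule integrable_const_bound[of _ "exp (l * c)"]) (use b l in \<open>auto simp: abs_le_iff\<close>)
  have "ennreal (expectation (\<lambda>x. exp (l * f x))) = (\<integral>\<^sup>+x. ennreal (exp (l * f x)) \<partial>M)"
    by (rule nn_integral_eq_integral[symmetric, OF int]) simp
  also have "\<dots> \<le> ennreal (exp (l\<^sup>2 * (c - (- c))\<^sup>2 / 8))"
    by (rule Hoeffdings_lemma_nn_integral_0[OF l mean])
  also have "l\<^sup>2 * (c - (- c))\<^sup>2 / 8 = l\<^sup>2 * c\<^sup>2 / 2" by (simp add: power2_eq_square algebra_simps)
  finally show ?thesis by (simp add: ennreal_le_iff)
qed

text \<open>McDiarmid's method as an induction on the coordinates. Averaging over coordinate i
  yields F, which inherits the other differences; f - F is centred in coordinate i and bounded by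
  \<open>c i\<close>. Hoeffding's lemma contributes one factor and the induction hypothesis for F
  the remaining ones.\<close>

lemma bounded_differences_exp_moment:
  fixes \<mu> :: "'i \<Rightarrow> real measure" and f :: "('i \<Rightarrow> real) \<Rightarrow> real"
  assumes prob: "\<And>i. prob_space (\<mu> i)" and sets: "\<And>i. sets (\<mu> i) = sets borel"
    and I: "finite I" and l: "l > 0"
    and f: "f \<in> borel_measurable (PiM I \<mu>)"
    and bdd: "\<And>x. x \<in> space (PiM I \<mu>) \<Longrightarrow> \<bar>f x\<bar> \<le> B"
    and diff: "\<And>x i t. x \<in> space (PiM I \<mu>) \<Longrightarrow> i \<in> I \<Longrightarrow> \<bar>f (x(i := t)) - f x\<bar> \<le> c i"
  shows "(\<integral>x. exp (l * (f x - (\<integral>x. f x \<partial>PiM I \<mu>))) \<partial>PiM I \<mu>) \<le> exp (l\<^sup>2 * (\<Sum>i\<in>I. (c i)\<^sup>2) / 2)"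
  using I f bdd diff
proof (induction I arbitrary: f rule: finite_induct)
  case empty
  interpret product_sigma_finite \<mu>
    by (intro product_sigma_finite.intro prob_space_imp_sigma_finite prob)
  have "(\<integral>x. g x \<partial>PiM {} \<mu>) = g (\<lambda>_. undefined)" for g :: "('i \<Rightarrow> real) \<Rightarrow> real"
    by (simp add: PiM_empty lebesgue_integral_count_space_finite)
  then show ?case by simp
next
  case (insert i I)
  interpret product_sigma_finite \<mu>
    by (intro product_sigma_finite.intro prob_space_imp_sigma_finite prob)
  interpret \<mu>: prob_space "\<mu> j" for j by (rule prob)
  interpret P: prob_space "PiM I \<mu>" by (intro prob_space_PiM prob)
  interpret P': prob_space "PiM (insert i I) \<mu>" by (intro prob_space_PiM prob)
  have sp[simp]: "space (\<mu> j) = UNIV" for j using sets_eq_imp_space_eq[OF sets, of j] by simp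
  note [measurable_cong] = sets
  note f[measurable] = insert.prems(1)
  have spI: "x(i := t) \<in> space (PiM (insert i I) \<mu>)" if "x \<in> space (PiM I \<mu>)" for x t
    using that by (auto simp: space_PiM PiE_def extensional_def)
  have pm: "(\<lambda>(x, t). f (x(i := t))) \<in> borel_measurable (PiM I \<mu> \<Otimes>\<^sub>M \<mu> i)"
    using measurable_compose[OF measurable_add_dim f] by (simp add: case_prod_beta')
  have fm: "(\<lambda>t. f (x(i := t))) \<in> borel_measurable (\<mu> i)" if "x \<in> space (PiM I \<mu>)" for x
    using measurable_Pair2[OF pm that] by simp
  have fint: "integrable (\<mu> i) (\<lambda>t. f (x(i := t)))" if "x \<in> space (PiM I \<mu>)" for x
  proof (rule \<mu>.integrable_const_bound[where B = B])
    show "AE t in \<mu> i. norm (f (x(i := t))) \<le> B"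
      unfolding real_norm_def by (rule AE_I2, rule insert.prems(2)[OF spI[OF that]])
  qed (rule fm[OF that])
  define F where "F x = (\<integral>t. f (x(i := t)) \<partial>\<mu> i)" for x
  have Fm[measurable]: "F \<in> borel_measurable (PiM I \<mu>)"
    unfolding F_def using pm by (rule sigma_finite_measure.borel_measurable_lebesgue_integral[OF prob_space_imp_sigma_finite[OF prob]])
  have EF: "(\<integral>x. F x \<partial>PiM I \<mu>) = (\<integral>x. f x \<partial>PiM (insert i I) \<mu>)"
    unfolding F_def
  proof (rule product_integral_insert[symmetric])
    show "integrable (PiM (insert i I) \<mu>) f"
      by (rule P'.integrable_const_bound[where B = B]) (use insert.prems(2) in auto)
  qed (use insert.hyps in auto)
  have FB: "\<bar>F x\<bar> \<le> B" if x: "x \<in> space (PiM I \<mu>)" for x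
  proof -
    have "\<bar>F x\<bar> \<le> (\<integral>t. \<bar>f (x(i := t))\<bar> \<partial>\<mu> i)" unfolding F_def by (rule integral_abs_bound)
    also have "\<dots> \<le> (\<integral>t. B \<partial>\<mu> i)"
      by (rule integral_mono) (use fint[OF x] in \<open>auto intro!: insert.prems(2)[OF spI[OF x]]\<close>)
    finally show ?thesis by (simp add: \<mu>.prob_space[simplified])
  qed
  have Fdiff: "\<bar>F (x(j := t)) - F x\<bar> \<le> c j" if x: "x \<in> space (PiM I \<mu>)" and j: "j \<in> I" for x j t
  proof -
    have ij: "i \<noteq> j" using j insert.hyps by auto
    have x': "x(j := t) \<in> space (PiM I \<mu>)"
      using x j by (auto simp: space_PiM PiE_def extensional_def)
    have "F (x(j := t)) - F x = (\<integral>u. f (x(j := t, i := u)) - f (x(i := u)) \<partial>\<mu> i)"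
      unfolding F_def using fint[OF x] fint[OF x'] by (simp add: Bochner_Integration.integral_diff)
    also have "\<bar>\<dots>\<bar> \<le> (\<integral>u. \<bar>f (x(j := t, i := u)) - f (x(i := u))\<bar> \<partial>\<mu> i)"
      by (rule integral_abs_bound)
    also have "\<dots> \<le> (\<integral>u. c j \<partial>\<mu> i)"
    proof (rule integral_mono)
      fix u
      have "\<bar>f ((x(i := u))(j := t)) - f (x(i := u))\<bar> \<le> c j"
        by (rule insert.prems(3)[OF spI[OF x]]) (use j in simp)
      then show "\<bar>f (x(j := t, i := u)) - f (x(i := u))\<bar> \<le> c j"
        using ij by (simp only: fun_upd_twist[of i j] not_False_eq_True)
    qed (use fint[OF x] fint[OF x'] in auto)
    finally show ?thesis by (simp add: \<mu>.prob_space[simplified])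
  qed
  define m where "m = (\<integral>x. f x \<partial>PiM (insert i I) \<mu>)"
  have inner: "(\<integral>t. exp (l * (f (x(i := t)) - m)) \<partial>\<mu> i) \<le> exp (l\<^sup>2 * (c i)\<^sup>2 / 2) * exp (l * (F x - m))"
    if x: "x \<in> space (PiM I \<mu>)" for x
  proof -
    have "(\<integral>t. exp (l * (f (x(i := t)) - F x)) \<partial>\<mu> i) \<le> exp (l\<^sup>2 * (c i)\<^sup>2 / 2)"
    proof (rule \<mu>.Hoeffding_exp_moment[OF _ _ _ l])
      show "(\<lambda>t. f (x(i := t)) - F x) \<in> borel_measurable (\<mu> i)" using fm[OF x] by simp
      show "(\<integral>t. f (x(i := t)) - F x \<partial>\<mu> i) = 0"
        using fint[OF x] by (simp add: F_def \<mu>.prob_space[simplified])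
      fix t
      have "f (x(i := t)) - F x = (\<integral>u. f (x(i := t)) - f (x(i := u)) \<partial>\<mu> i)"
        using fint[OF x] by (simp add: F_def \<mu>.prob_space[simplified])
      also have "\<bar>\<dots>\<bar> \<le> (\<integral>u. \<bar>f (x(i := t)) - f (x(i := u))\<bar> \<partial>\<mu> i)"
        by (rule integral_abs_bound)
      also have "\<dots> \<le> (\<integral>u. c i \<partial>\<mu> i)"
      proof (rule integral_mono)
        fix u
        have "\<bar>f ((x(i := u))(i := t)) - f (x(i := u))\<bar> \<le> c i"
          by (rule insert.prems(3)[OF spI[OF x]]) simp
        then show "\<bar>f (x(i := t)) - f (x(i := u))\<bar> \<le> c i"
          by (simp only: fun_upd_upd)
      qed (use fint[OF x] in auto)
      finally show "\<bar>f (x(i := t)) - F x\<bar> \<le> c i" by (simp add: \<mu>.prob_space[simplified])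
    qed
    then have "(\<integral>t. exp (l * (f (x(i := t)) - F x)) \<partial>\<mu> i) * exp (l * (F x - m)) \<le> exp (l\<^sup>2 * (c i)\<^sup>2 / 2) * exp (l * (F x - m))"
      by (rule mult_right_mono) simp
    moreover have "exp (l * (f (x(i := t)) - m)) = exp (l * (f (x(i := t)) - F x)) * exp (l * (F x - m))" for t
      by (simp add: exp_add[symmetric] algebra_simps)
    ultimately show ?thesis by simp
  qed
  have mB: "\<bar>m\<bar> \<le> B"
  proof -
    have "\<bar>\<integral>x. F x \<partial>PiM I \<mu>\<bar> \<le> (\<integral>x. \<bar>F x\<bar> \<partial>PiM I \<mu>)" by (rule integral_abs_bound)
    also have "\<dots> \<le> (\<integral>x. B \<partial>PiM I \<mu>)"
      by (rule integral_mono) (use FB in \<open>auto intro!: P.integrable_const_bound[of _ B]\<close>)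
    finally show ?thesis by (simp add: EF m_def P.prob_space)
  qed
  have bound: "\<bar>exp (l * (r - m))\<bar> \<le> exp (l * (2 * B))" if "\<bar>r\<bar> \<le> B" for r
    using that mB l by (auto simp: abs_le_iff intro!: mult_left_mono)
  have "(\<integral>x. exp (l * (f x - m)) \<partial>PiM (insert i I) \<mu>)
      = (\<integral>x. (\<integral>t. exp (l * (f (x(i := t)) - m)) \<partial>\<mu> i) \<partial>PiM I \<mu>)"
  proof (rule product_integral_insert)
    show "integrable (PiM (insert i I) \<mu>) (\<lambda>x. exp (l * (f x - m)))"
      by (rule P'.integrable_const_bound[of _ "exp (l * (2 * B))"]) (use bound insert.prems(2) in auto)
  qed (use insert.hyps in auto)
  also have "\<dots> \<le> (\<integral>x. exp (l\<^sup>2 * (c i)\<^sup>2 / 2) * exp (l * (F x - m)) \<partial>PiM I \<mu>)"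
  proof (rule integral_mono[OF _ _ inner])
    have "integrable (PiM I \<mu>) (\<lambda>x. exp (l * (F x - m)))"
      by (rule P.integrable_const_bound[of _ "exp (l * (2 * B))"]) (use bound FB in auto)
    then show int2: "integrable (PiM I \<mu>) (\<lambda>x. exp (l\<^sup>2 * (c i)\<^sup>2 / 2) * exp (l * (F x - m)))"
      by simp
    show "integrable (PiM I \<mu>) (\<lambda>x. \<integral>t. exp (l * (f (x(i := t)) - m)) \<partial>\<mu> i)"
    proof (rule Bochner_Integration.integrable_bound[OF int2])
      show "(\<lambda>x. \<integral>t. exp (l * (f (x(i := t)) - m)) \<partial>\<mu> i) \<in> borel_measurable (PiM I \<mu>)"
        by (rule sigma_finite_measure.borel_measurable_lebesgue_integral[OF prob_space_imp_sigma_finite[OF prob]]) (use pm in \<open>simp add: case_prod_beta'\<close>)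
      have "norm (\<integral>t. exp (l * (f (x(i := t)) - m)) \<partial>\<mu> i) \<le> norm (exp (l\<^sup>2 * (c i)\<^sup>2 / 2) * exp (l * (F x - m)))"
        if "x \<in> space (PiM I \<mu>)" for x
        using inner[OF that] by (simp add: abs_mult integral_nonneg_AE)
      then show "AE x in PiM I \<mu>. norm (\<integral>t. exp (l * (f (x(i := t)) - m)) \<partial>\<mu> i) \<le> norm (exp (l\<^sup>2 * (c i)\<^sup>2 / 2) * exp (l * (F x - m)))"
        by (rule AE_I2)
    qed
  qed
  also have "\<dots> = exp (l\<^sup>2 * (c i)\<^sup>2 / 2) * (\<integral>x. exp (l * (F x - (\<integral>x. F x \<partial>PiM I \<mu>))) \<partial>PiM I \<mu>)"
    by (simp add: EF m_def)
  also have "\<dots> \<le> exp (l\<^sup>2 * (c i)\<^sup>2 / 2) * exp (l\<^sup>2 * (\<Sum>j\<in>I. (c j)\<^sup>2) / 2)"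
    by (intro mult_left_mono insert.IH Fm FB Fdiff) auto
  also have "\<dots> = exp (l\<^sup>2 * (\<Sum>j\<in>insert i I. (c j)\<^sup>2) / 2)"
    using insert.hyps by (simp add: exp_add[symmetric] algebra_simps add_divide_distrib)
  finally show ?case by (simp add: m_def)
qed

lemma bounded_differences_tail:
  fixes \<mu> :: "'i \<Rightarrow> real measure" and f :: "('i \<Rightarrow> real) \<Rightarrow> real"
  assumes prob: "\<And>i. prob_space (\<mu> i)" and sets: "\<And>i. sets (\<mu> i) = sets borel"
    and I: "finite I"
    and f[measurable]: "f \<in> borel_measurable (PiM I \<mu>)"
    and bdd: "\<And>x. x \<in> space (PiM I \<mu>) \<Longrightarrow> \<bar>f x\<bar> \<le> B"
    and diff: "\<And>x i t. x \<in> space (PiM I \<mu>) \<Longrightarrow> i \<in> I \<Longrightarrow> \<bar>f (x(i := t)) - f x\<bar> \<le> c i"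
    and D: "(\<Sum>i\<in>I. (c i)\<^sup>2) \<le> D" "D > 0" and \<epsilon>: "\<epsilon> > 0"
  shows "measure (PiM I \<mu>) {x \<in> space (PiM I \<mu>). \<epsilon> \<le> f x - (\<integral>x. f x \<partial>PiM I \<mu>)} \<le> exp (- (\<epsilon>\<^sup>2 / (2 * D)))"
proof -
  interpret P: prob_space "PiM I \<mu>" by (intro prob_space_PiM prob)
  define m where "m = (\<integral>x. f x \<partial>PiM I \<mu>)"
  \<comment> \<open>The minimiser of l^2 D / 2 - l \<epsilon>, the exponent in the Chernoff
    bound.\<close>
  define l where "l = \<epsilon> / D"
  have l: "l > 0" using D \<epsilon> by (simp add: l_def)
  have int: "integrable (PiM I \<mu>) (\<lambda>x. exp (l * (f x - m)))"
  proof (rule P.integrable_const_bound[of _ "exp (l * (B - m))"])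
    show "AE x in PiM I \<mu>. norm (exp (l * (f x - m))) \<le> exp (l * (B - m))"
      by (rule AE_I2) (use bdd l in \<open>force simp: abs_le_iff\<close>)
  qed simp
  have "measure (PiM I \<mu>) {x \<in> space (PiM I \<mu>). \<epsilon> \<le> f x - m}
      = measure (PiM I \<mu>) {x \<in> space (PiM I \<mu>). exp (l * \<epsilon>) \<le> exp (l * (f x - m))}"
    using l by simp
  also have "\<dots> \<le> (\<integral>x. exp (l * (f x - m)) \<partial>PiM I \<mu>) / exp (l * \<epsilon>)"
    by (rule integral_Markov_inequality_measure[OF int, where A = "{}"]) auto
  also have "\<dots> \<le> exp (l\<^sup>2 * (\<Sum>i\<in>I. (c i)\<^sup>2) / 2) / exp (l * \<epsilon>)"
    unfolding m_def by (intro divide_right_mono bounded_differences_exp_moment[where B = B] prob sets I l f bdd diff) auto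
  also have "\<dots> \<le> exp (l\<^sup>2 * D / 2) / exp (l * \<epsilon>)"
    using D(1) by (intro divide_right_mono) (auto intro!: mult_left_mono)
  also have "\<dots> = exp (l\<^sup>2 * D / 2 - l * \<epsilon>)" by (simp add: exp_diff)
  also have "l\<^sup>2 * D / 2 - l * \<epsilon> = - (\<epsilon>\<^sup>2 / (2 * D))"
    using D(2) by (simp add: l_def field_simps power2_eq_square)
  finally show ?thesis by (simp add: m_def)
qed

text \<open>Since |z| is at most |Re z| + |Im z|, a deviation by 2 \<epsilon> forces one of the four
  signed parts to deviate by \<epsilon>; hence the factors 2 and 4.\<close>

lemma bounded_differences_tail_complex:
  fixes \<mu> :: "'i \<Rightarrow> real measure" and f :: "('i \<Rightarrow> real) \<Rightarrow> complex"
  assumes prob: "\<And>i. prob_space (\<mu> i)" and sets: "\<And>i. sets (\<mu> i) = sets borel"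
    and I: "finite I"
    and f[measurable]: "f \<in> borel_measurable (PiM I \<mu>)"
    and bdd: "\<And>x. x \<in> space (PiM I \<mu>) \<Longrightarrow> cmod (f x) \<le> B"
    and diff: "\<And>x i t. x \<in> space (PiM I \<mu>) \<Longrightarrow> i \<in> I \<Longrightarrow> cmod (f (x(i := t)) - f x) \<le> c i"
    and D: "(\<Sum>i\<in>I. (c i)\<^sup>2) \<le> D" "D > 0" and \<epsilon>: "\<epsilon> > 0"
  shows "measure (PiM I \<mu>) {x \<in> space (PiM I \<mu>). 2 * \<epsilon> \<le> cmod (f x - (\<integral>x. f x \<partial>PiM I \<mu>))}
    \<le> 4 * exp (- (\<epsilon>\<^sup>2 / (2 * D)))"
proof -
  interpret P: prob_space "PiM I \<mu>" by (intro prob_space_PiM prob)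
  have int: "integrable (PiM I \<mu>) f"
    by (rule P.integrable_const_bound[of _ B]) (use bdd in auto)
  let ?m = "\<integral>x. f x \<partial>PiM I \<mu>"
  define A where "A g = {x \<in> space (PiM I \<mu>). \<epsilon> \<le> g x - (\<integral>x. g x \<partial>PiM I \<mu>)}" for g :: "('i \<Rightarrow> real) \<Rightarrow> real"
  have Am[measurable]: "A g \<in> sets (PiM I \<mu>)" if "g \<in> borel_measurable (PiM I \<mu>)" for g
    unfolding A_def using that by measurable
  have tail: "measure (PiM I \<mu>) (A (\<lambda>x. \<theta> (f x))) \<le> exp (- (\<epsilon>\<^sup>2 / (2 * D)))"
    if \<theta>: "\<And>w z. \<theta> w - \<theta> z = \<theta> (w - z)" "\<And>z. \<bar>\<theta> z\<bar> \<le> cmod z" "\<theta> \<in> borel_measurable borel" for \<theta>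
    unfolding A_def
  proof (rule bounded_differences_tail[OF prob sets I _ _ _ D \<epsilon>])
    show "(\<lambda>x. \<theta> (f x)) \<in> borel_measurable (PiM I \<mu>)" using measurable_compose[OF f \<theta>(3)] by simp
    show "\<bar>\<theta> (f x)\<bar> \<le> B" if "x \<in> space (PiM I \<mu>)" for x
      using \<theta>(2)[of "f x"] bdd[OF that] by linarith
    show "\<bar>\<theta> (f (x(i := t))) - \<theta> (f x)\<bar> \<le> c i" if "x \<in> space (PiM I \<mu>)" "i \<in> I" for x i t
      using \<theta>(2)[of "f (x(i := t)) - f x"] diff[OF that, of t] unfolding \<theta>(1) by linarith
  qed
  have "{x \<in> space (PiM I \<mu>). 2 * \<epsilon> \<le> cmod (f x - ?m)}
      \<subseteq> (A (\<lambda>x. Re (f x)) \<union> A (\<lambda>x. - Re (f x))) \<union> (A (\<lambda>x. Im (f x)) \<union> A (\<lambda>x. - Im (f x)))"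
  proof
    fix x assume "x \<in> {x \<in> space (PiM I \<mu>). 2 * \<epsilon> \<le> cmod (f x - ?m)}"
    then have x: "x \<in> space (PiM I \<mu>)" "2 * \<epsilon> \<le> cmod (f x - ?m)" by auto
    have "cmod (f x - ?m) \<le> \<bar>Re (f x) - Re ?m\<bar> + \<bar>Im (f x) - Im ?m\<bar>"
      using cmod_le[of "f x - ?m"] by simp
    with x(2) have "\<epsilon> \<le> \<bar>Re (f x) - Re ?m\<bar> \<or> \<epsilon> \<le> \<bar>Im (f x) - Im ?m\<bar>" by linarith
    then show "x \<in> (A (\<lambda>x. Re (f x)) \<union> A (\<lambda>x. - Re (f x))) \<union> (A (\<lambda>x. Im (f x)) \<union> A (\<lambda>x. - Im (f x)))"
      using x(1) int by (auto simp: A_def abs_real_def split: if_splits)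
  qed
  then have "measure (PiM I \<mu>) {x \<in> space (PiM I \<mu>). 2 * \<epsilon> \<le> cmod (f x - ?m)}
      \<le> measure (PiM I \<mu>) ((A (\<lambda>x. Re (f x)) \<union> A (\<lambda>x. - Re (f x))) \<union> (A (\<lambda>x. Im (f x)) \<union> A (\<lambda>x. - Im (f x))))"
    by (intro P.finite_measure_mono) auto
  also have "\<dots> \<le> (measure (PiM I \<mu>) (A (\<lambda>x. Re (f x))) + measure (PiM I \<mu>) (A (\<lambda>x. - Re (f x))))
      + (measure (PiM I \<mu>) (A (\<lambda>x. Im (f x))) + measure (PiM I \<mu>) (A (\<lambda>x. - Im (f x))))"
    by (intro order_trans[OF measure_Un_le] add_mono measure_Un_le) auto
  also have "\<dots> \<le> 4 * exp (- (\<epsilon>\<^sup>2 / (2 * D)))"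
    using tail[of Re] tail[of Im] tail[of "\<lambda>z. - Re z"] tail[of "\<lambda>z. - Im z"]
    by (simp add: abs_Re_le_cmod abs_Im_le_cmod)
  finally show ?thesis .
qed

subsection \<open>The self-consistent equation for the diagonal of the resolvent\<close>

text \<open>Matrices are indexed from 0, the random entries from 1.\<close>

definition edge :: "nat \<Rightarrow> nat \<Rightarrow> nat \<times> nat" where
  "edge i j = (Suc (min i j), Suc (max i j))"

definition edges :: "nat \<Rightarrow> (nat \<times> nat) set" where
  "edges n = {(i, j). 1 \<le> i \<and> i \<le> j \<and> j \<le> n}"

lemma edge_commute: "edge i j = edge j i"
  by (simp add: edge_def min.commute max.commute)

lemma edge_eq_iff: "edge i j = edge k l \<longleftrightarrow> {i, j} = {k, l}"
  by (auto simp: edge_def min_def max_def doubleton_eq_iff)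

lemma edge_in_edges: "i < n \<Longrightarrow> j < n \<Longrightarrow> edge i j \<in> edges n"
  by (auto simp: edge_def edges_def)

lemma finite_edges: "finite (edges n)"
  by (rule finite_subset[of _ "{1..n} \<times> {1..n}"]) (auto simp: edges_def)

lemma card_edges_le: "card (edges n) \<le> n\<^sup>2"
proof -
  have "card (edges n) \<le> card ({1..n} \<times> {1..n})"
    by (intro card_mono) (auto simp: edges_def)
  then show ?thesis by (simp add: power2_eq_square)
qed

lemma measurable_cnj:
  assumes "f \<in> borel_measurable M"
  shows "(\<lambda>x. cnj (f x)) \<in> borel_measurable M"
  using assms by (rule measurable_compose[OF _ borel_measurable_continuous_onI[OF continuous_on_cnj[OF continuous_on_id]]])

text \<open>The matrix is a function on a product space: its entry at \<open>e\<close> is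
  \<open>h e\<close> of coordinate \<open>e\<close>. The bound on \<open>h\<close> is demanded for
  every argument because the bounded differences method substitutes arbitrary reals for a
  coordinate. In the application \<beta> is of order 1 / sqrt n.\<close>

locale random_symmetric =
  fixes n :: nat and \<mu> :: "nat \<times> nat \<Rightarrow> real measure" and h :: "nat \<times> nat \<Rightarrow> real \<Rightarrow> real"
    and \<beta> y :: real
  assumes prob: "\<And>e. prob_space (\<mu> e)" and sets_\<mu>: "\<And>e. sets (\<mu> e) = sets borel"
    and h_meas: "\<And>e. h e \<in> borel_measurable borel"
    and h_bound: "\<And>e t. \<bar>h e t\<bar> \<le> \<beta>"
    and h_mean: "\<And>e. e \<in> edges n \<Longrightarrow> (\<integral>t. h e t \<partial>\<mu> e) = 0"
    and y: "y > 0" and n: "n > 0"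
begin

abbreviation P where "P \<equiv> PiM (edges n) \<mu>"

definition ent :: "(nat \<times> nat \<Rightarrow> real) \<Rightarrow> nat \<Rightarrow> nat \<Rightarrow> real" where
  "ent x i j = h (edge i j) (x (edge i j))"

definition v :: "nat \<Rightarrow> nat \<Rightarrow> real" where
  "v i j = (\<integral>t. (h (edge i j) t)\<^sup>2 \<partial>\<mu> (edge i j))"

lemma sym_ent: "sym_on m (ent x)"
  by (simp add: sym_on_def ent_def edge_commute)

sublocale P: prob_space P by (intro prob_space_PiM prob)

sublocale prob_space "\<mu> e" for e by (rule prob)

lemma \<beta>_nonneg: "\<beta> \<ge> 0" using h_bound[of undefined undefined] by linarith

lemma h_meas_\<mu>: "h e \<in> borel_measurable (\<mu> e)"
  using h_meas by (simp cong: measurable_cong_sets add: sets_\<mu>)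

lemma ent_bound: "\<bar>ent x i j\<bar> \<le> \<beta>" by (simp add: ent_def h_bound)

lemma ent_meas [measurable]: "i < n \<Longrightarrow> j < n \<Longrightarrow> (\<lambda>x. ent x i j) \<in> borel_measurable P"
  unfolding ent_def
  by (rule measurable_compose[OF measurable_component_singleton[where i = "edge i j" and M = \<mu>] h_meas_\<mu>])
    (rule edge_in_edges)

lemma sq_le: "(h e t)\<^sup>2 \<le> \<beta>\<^sup>2"
  using power_mono[OF h_bound[of e t], of 2] by simp

lemma v_nonneg: "v i j \<ge> 0" by (simp add: v_def)

lemma h2_int: "integrable (\<mu> e) (\<lambda>t. (h e t)\<^sup>2)"
  by (rule integrable_const_bound[where B = "\<beta>\<^sup>2"]) (use sq_le h_meas_\<mu> in auto)

lemma v_le: "v i j \<le> \<beta>\<^sup>2"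
proof -
  have "v i j \<le> (\<integral>t. \<beta>\<^sup>2 \<partial>\<mu> (edge i j))"
    unfolding v_def by (rule integral_mono) (use h2_int sq_le in auto)
  then show ?thesis using prob_space[of "edge i j"] by simp
qed

section \<open>The resolvent, its minors, and their dependence on single entries\<close>

abbreviation G where "G x \<equiv> resolvent n (ent x) y"
abbreviation H where "H i x \<equiv> resolvent n (drop_index i (ent x)) y"

text \<open>Independence of the minor from row i, in the pointwise form that Fubini
  requires.\<close>

lemma H_update: "H i (x(edge i p := t)) = H i x"
proof (rule resolvent_cong)
  fix k l
  have "edge k l \<noteq> edge i p" if "k \<noteq> i" "l \<noteq> i"
    using that by (auto simp: edge_eq_iff doubleton_eq_iff)
  then show "drop_index i (ent (x(edge i p := t))) k l = drop_index i (ent x) k l"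
    by (auto simp: drop_index_def ent_def)
qed

lemma ent_update: "j \<noteq> p \<Longrightarrow> ent (x(edge i p := t)) i j = ent x i j"
  by (auto simp: ent_def edge_eq_iff doubleton_eq_iff)

lemma G_meas [measurable]: "j < n \<Longrightarrow> k < n \<Longrightarrow> (\<lambda>x. G x j k) \<in> borel_measurable P"
  by (rule resolvent_measurable) auto

lemma H_meas [measurable]: "j < n \<Longrightarrow> k < n \<Longrightarrow> (\<lambda>x. H i x j k) \<in> borel_measurable P"
  by (rule resolvent_measurable) (auto simp: drop_index_def)

lemma G_norm_le: "j < n \<Longrightarrow> k < n \<Longrightarrow> cmod (G x j k) \<le> 1 / y"
  by (rule resolvent_norm_le[OF sym_ent y])

lemma H_norm_le: "j < n \<Longrightarrow> k < n \<Longrightarrow> cmod (H i x j k) \<le> 1 / y"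
  by (rule resolvent_norm_le[OF sym_on_drop_index[OF sym_ent] y])

text \<open>Products of two entries of row i minus their expectations; for distinct positions the
  expectation is zero, since the entries are independent and centred.\<close>

definition Z :: "nat \<Rightarrow> (nat \<times> nat \<Rightarrow> real) \<Rightarrow> nat \<Rightarrow> nat \<Rightarrow> real" where
  "Z i x j k = ent x i j * ent x i k - (if j = k then v i j else 0)"

lemma Z_meas [measurable]: "i < n \<Longrightarrow> j < n \<Longrightarrow> k < n \<Longrightarrow> (\<lambda>x. Z i x j k) \<in> borel_measurable P"
  unfolding Z_def by measurable

lemma Z_commute: "Z i x j k = Z i x k j" by (simp add: Z_def mult.commute)

lemma Z_bound: "\<bar>Z i x j k\<bar> \<le> 2 * \<beta>\<^sup>2"
proof -
  have "\<bar>ent x i j * ent x i k\<bar> \<le> \<beta> * \<beta>"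
    unfolding abs_mult by (intro mult_mono ent_bound \<beta>_nonneg) auto
  moreover have "\<bar>if j = k then v i j else 0\<bar> \<le> \<beta> * \<beta>"
    using v_nonneg v_le by (simp add: power2_eq_square)
  ultimately show ?thesis
    unfolding Z_def power2_eq_square by linarith
qed

lemma Z_update: "j \<noteq> p \<Longrightarrow> k \<noteq> p \<Longrightarrow> Z i (x(edge i p := t)) j k = Z i x j k"
  by (simp add: Z_def ent_update)

lemma P_integrable:
  fixes f :: "(nat \<times> nat \<Rightarrow> real) \<Rightarrow> complex"
  assumes "f \<in> borel_measurable P" "\<And>x. cmod (f x) \<le> B"
  shows "integrable P f"
  by (rule P.integrable_const_bound[where B = B]) (use assms in auto)

text \<open>The index p occurs exactly once, so the integrand is linear in the centred entry at
  \<open>edge i p\<close>. The weight W stands for the factors coming from the minor.\<close>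

lemma Z_orthogonal_single:
  assumes ip: "i < n" "p < n" "q < n" "j < n" "k < n" and ne: "p \<noteq> q" "p \<noteq> j" "p \<noteq> k"
    and W: "W \<in> borel_measurable P" "\<And>x. cmod (W x) \<le> B" "\<And>x t. W (x(edge i p := t)) = W x"
  shows "(\<integral>x. of_real (Z i x p q * Z i x j k) * W x \<partial>P) = 0"
proof -
  have eq: "of_real (Z i x p q * Z i x j k) * W x
      = of_real (h (edge i p) (x (edge i p))) * (of_real (ent x i q * Z i x j k) * W x)" for x
    using ne by (simp add: Z_def[of i x p q] ent_def[of x i p])
  show ?thesis
    unfolding eq
  proof (rule integral_PiM_factor_zero[OF prob finite_edges])
    show "edge i p \<in> edges n" using ip by (intro edge_in_edges)
    then show "(\<integral>t. h (edge i p) t \<partial>\<mu> (edge i p)) = 0" by (rule h_mean)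
    show "integrable P (\<lambda>x. of_real (h (edge i p) (x (edge i p))) * (of_real (ent x i q * Z i x j k) * W x))"
      unfolding eq[symmetric]
    proof (rule P_integrable)
      show "(\<lambda>x. of_real (Z i x p q * Z i x j k) * W x) \<in> borel_measurable P"
        using W(1) ip by measurable
      show "cmod (of_real (Z i x p q * Z i x j k) * W x) \<le> (2 * \<beta>\<^sup>2) * (2 * \<beta>\<^sup>2) * B" for x
        unfolding norm_mult norm_of_real abs_mult using order_trans[OF norm_ge_zero W(2)]
        by (intro mult_mono Z_bound W(2)) auto
    qed
    fix x t
    show "complex_of_real (ent (x(edge i p := t)) i q * Z i (x(edge i p := t)) j k) * W (x(edge i p := t))
        = of_real (ent x i q * Z i x j k) * W x"
      using ne by (simp add: ent_update Z_update W(3))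
  qed
qed

text \<open>Here p occurs twice, and the factor of mean zero is the centred square of the entry at
  \<open>edge i p\<close>.\<close>

lemma Z_orthogonal_diag:
  assumes ip: "i < n" "p < n" "j < n" and ne: "p \<noteq> j"
    and W: "W \<in> borel_measurable P" "\<And>x. cmod (W x) \<le> B" "\<And>x t. W (x(edge i p := t)) = W x"
  shows "(\<integral>x. of_real (Z i x p p * Z i x j j) * W x \<partial>P) = 0"
proof -
  have eq: "of_real (Z i x p p * Z i x j j) * W x
      = of_real ((\<lambda>t. (h (edge i p) t)\<^sup>2 - v i p) (x (edge i p))) * (of_real (Z i x j j) * W x)" for x
    by (simp add: Z_def[of i x p p] ent_def[of x i p] power2_eq_square)
  show ?thesis
    unfolding eq
  proof (rule integral_PiM_factor_zero[OF prob finite_edges])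
    show "edge i p \<in> edges n" using ip by (intro edge_in_edges)
    show "(\<integral>t. (h (edge i p) t)\<^sup>2 - v i p \<partial>\<mu> (edge i p)) = 0"
      using h2_int prob_space[of "edge i p"] by (simp add: v_def)
    show "integrable P (\<lambda>x. of_real ((\<lambda>t. (h (edge i p) t)\<^sup>2 - v i p) (x (edge i p))) * (of_real (Z i x j j) * W x))"
      unfolding eq[symmetric]
    proof (rule P_integrable)
      show "(\<lambda>x. of_real (Z i x p p * Z i x j j) * W x) \<in> borel_measurable P"
        using W(1) ip by measurable
      show "cmod (of_real (Z i x p p * Z i x j j) * W x) \<le> (2 * \<beta>\<^sup>2) * (2 * \<beta>\<^sup>2) * B" for x
        unfolding norm_mult norm_of_real abs_mult using order_trans[OF norm_ge_zero W(2)]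
        by (intro mult_mono Z_bound W(2)) auto
    qed
    fix x t
    show "complex_of_real (Z i (x(edge i p := t)) j j) * W (x(edge i p := t)) = of_real (Z i x j j) * W x"
      using ne by (simp add: Z_update W(3))
  qed
qed

lemma Z_orthogonal:
  assumes i: "i < n" and jk: "j < n" "k < n" "j' < n" "k' < n" and ne: "{j, k} \<noteq> {j', k'}"
    and W: "W \<in> borel_measurable P" "\<And>x. cmod (W x) \<le> B" "\<And>p x t. W (x(edge i p := t)) = W x"
  shows "(\<integral>x. of_real (Z i x j k * Z i x j' k') * W x \<partial>P) = 0"
proof -
  note S = Z_orthogonal_single[OF i _ _ _ _ _ _ _ W(1,2) W(3)]
  \<comment> \<open>Two different unordered pairs leave either an index that occurs exactly once
    among the four, or two distinct diagonal pairs.\<close>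
  consider "j \<noteq> k" "j \<noteq> j'" "j \<noteq> k'" | "j \<noteq> k" "k \<noteq> j'" "k \<noteq> k'"
    | "j' \<noteq> k'" "j' \<noteq> j" "j' \<noteq> k" | "j' \<noteq> k'" "k' \<noteq> j" "k' \<noteq> k"
    | "j = k" "j' = k'" "j \<noteq> j'"
    using ne by (metis doubleton_eq_iff)
  then show ?thesis
  proof cases
    case 1 then show ?thesis using S[of j k j' k'] jk by simp
  next
    case 2 then show ?thesis using S[of k j j' k'] jk by (simp add: Z_commute[of i _ k j])
  next
    case 3 then show ?thesis using S[of j' k' j k] jk by (simp add: mult.commute mult.left_commute)
  next
    case 4 then show ?thesis using S[of k' j' j k] jk
      by (simp add: Z_commute[of i _ k' j'] mult.commute mult.left_commute)
  next
    case 5 then show ?thesis using Z_orthogonal_diag[OF i _ _ _ W(1,2) W(3), of j j'] jk by simp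
  qed
qed

definition quad_error :: "nat \<Rightarrow> (nat \<times> nat \<Rightarrow> real) \<Rightarrow> complex" where
  "quad_error i x = (\<Sum>j\<in>{..<n}-{i}. \<Sum>k\<in>{..<n}-{i}. of_real (Z i x j k) * H i x j k)"

lemma quad_error_meas [measurable]: "i < n \<Longrightarrow> quad_error i \<in> borel_measurable P"
  unfolding quad_error_def[abs_def] by (intro borel_measurable_sum borel_measurable_times borel_measurable_of_real Z_meas H_meas) auto

text \<open>In the expanded square only pairs that agree up to order survive, so at most two
  partners remain for each pair and the sum of all |H_jk|^2, at most n / y^2, takes over. The
  constant is 8 = 2 * 2 * 2, from two partners and |Z| at most 2 \<beta>^2. With \<beta>^2 of order
  1/n the bound is of order 1/n.\<close>

lemma quad_error_second_moment:
  assumes i: "i < n"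
  shows "integrable P (\<lambda>x. (cmod (quad_error i x))\<^sup>2)"
    and "(\<integral>x. (cmod (quad_error i x))\<^sup>2 \<partial>P) \<le> 8 * \<beta> ^ 4 * real n / y\<^sup>2"
proof -
  let ?J = "{..<n} - {i}"
  let ?K = "?J \<times> ?J"
  define T where "T x a c = of_real (Z i x (fst a) (snd a) * Z i x (fst c) (snd c)) *
      (H i x (fst a) (snd a) * cnj (H i x (fst c) (snd c)))" for x a c
  define B where "B = (2 * \<beta>\<^sup>2) * (2 * \<beta>\<^sup>2) * (1 / y * (1 / y))"
  have W: "(\<lambda>x. H i x (fst a) (snd a) * cnj (H i x (fst c) (snd c))) \<in> borel_measurable P"
    "\<And>x. cmod (H i x (fst a) (snd a) * cnj (H i x (fst c) (snd c))) \<le> 1 / y * (1 / y)"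
    if "a \<in> ?K" "c \<in> ?K" for a c
  proof -
    show "(\<lambda>x. H i x (fst a) (snd a) * cnj (H i x (fst c) (snd c))) \<in> borel_measurable P"
      using that by (intro borel_measurable_times measurable_cnj H_meas) auto
    show "cmod (H i x (fst a) (snd a) * cnj (H i x (fst c) (snd c))) \<le> 1 / y * (1 / y)" for x
      unfolding norm_mult complex_mod_cnj using that y by (intro mult_mono H_norm_le) auto
  qed
  have Tint: "integrable P (\<lambda>x. T x a c)" if "a \<in> ?K" "c \<in> ?K" for a c
  proof (rule P_integrable)
    show "(\<lambda>x. T x a c) \<in> borel_measurable P"
    proof -
      have "(\<lambda>x. Z i x (fst a) (snd a)) \<in> borel_measurable P" "(\<lambda>x. Z i x (fst c) (snd c)) \<in> borel_measurable P"
        using that i by (auto intro!: Z_meas)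
      then show ?thesis unfolding T_def using W(1)[OF that] by measurable
    qed
    show "cmod (T x a c) \<le> B" for x
      unfolding T_def B_def norm_mult[of "of_real _"] norm_of_real abs_mult
      by (intro mult_mono Z_bound W(2) that) (auto simp: y less_imp_le)
  qed
  have T0: "(\<integral>x. T x a c \<partial>P) = 0" if "a \<in> ?K" "c \<in> ?K" "{fst a, snd a} \<noteq> {fst c, snd c}" for a c
    unfolding T_def using that i
    by (intro Z_orthogonal[OF _ _ _ _ _ _ W(1)[OF that(1,2)] W(2)[OF that(1,2)]]) (auto simp: H_update)
  have expand: "of_real ((cmod (quad_error i x))\<^sup>2) = (\<Sum>a\<in>?K. \<Sum>c\<in>?K. T x a c)" for x
  proof -
    have q: "quad_error i x = (\<Sum>a\<in>?K. of_real (Z i x (fst a) (snd a)) * H i x (fst a) (snd a))"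
      unfolding quad_error_def by (simp add: sum.cartesian_product case_prod_beta)
    have "of_real ((cmod (quad_error i x))\<^sup>2) = quad_error i x * cnj (quad_error i x)"
      by (rule complex_norm_square)
    also have "\<dots> = (\<Sum>a\<in>?K. \<Sum>c\<in>?K. (of_real (Z i x (fst a) (snd a)) * H i x (fst a) (snd a)) *
        cnj (of_real (Z i x (fst c) (snd c)) * H i x (fst c) (snd c)))"
      unfolding q cnj_sum by (rule sum_product)
    finally show ?thesis by (simp add: T_def mult_ac)
  qed
  have cint: "integrable P (\<lambda>x. complex_of_real ((cmod (quad_error i x))\<^sup>2))"
    unfolding expand using Tint by (intro Bochner_Integration.integrable_sum) auto
  then show int: "integrable P (\<lambda>x. (cmod (quad_error i x))\<^sup>2)"
    by (simp only: complex_of_real_integrable_eq)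
  define N where "N x = (\<Sum>a\<in>?K. (cmod (H i x (fst a) (snd a)))\<^sup>2)" for x
  have N: "N x \<le> real n * (1 / y\<^sup>2)" for x
  proof -
    have "N x = (\<Sum>k\<in>?J. \<Sum>j\<in>?J. (cmod (H i x j k))\<^sup>2)"
      unfolding N_def by (subst sum.swap) (simp add: sum.cartesian_product case_prod_beta)
    also have "\<dots> \<le> (\<Sum>k<n. \<Sum>j<n. (cmod (H i x j k))\<^sup>2)"
      by (intro order_trans[OF sum_mono[OF sum_mono2] sum_mono2]) (auto intro: sum_nonneg)
    also have "\<dots> \<le> (\<Sum>k<n. 1 / y\<^sup>2)"
      by (intro sum_mono resolvent_col_le[OF sym_on_drop_index[OF sym_ent] y]) auto
    finally show ?thesis by simp
  qed
  have Hint: "integrable P (\<lambda>x. (cmod (H i x (fst a) (snd a)))\<^sup>2)" if a: "a \<in> ?K" for a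
  proof (rule P.integrable_const_bound[where B = "(1 / y)\<^sup>2"])
    show "AE x in P. norm ((cmod (H i x (fst a) (snd a)))\<^sup>2) \<le> (1 / y)\<^sup>2"
      using a by (intro AE_I2) (auto intro!: power_mono H_norm_le)
    show "(\<lambda>x. (cmod (H i x (fst a) (snd a)))\<^sup>2) \<in> borel_measurable P"
      using a by (intro borel_measurable_power borel_measurable_norm H_meas) auto
  qed
  have term_le: "(\<Sum>c\<in>?K. cmod (\<integral>x. T x a c \<partial>P)) \<le> 8 * \<beta> ^ 4 * (\<integral>x. (cmod (H i x (fst a) (snd a)))\<^sup>2 \<partial>P)"
    if a: "a \<in> ?K" for a
  proof -
    let ?c = "{a, (snd a, fst a)}"
    have "(\<Sum>c\<in>?K. cmod (\<integral>x. T x a c \<partial>P)) = (\<Sum>c\<in>?c. cmod (\<integral>x. T x a c \<partial>P))"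
    proof (rule sum.mono_neutral_right)
      show "\<forall>c\<in>?K - ?c. cmod (\<integral>x. T x a c \<partial>P) = 0"
      proof
        fix c assume c: "c \<in> ?K - ?c"
        then have "{fst a, snd a} \<noteq> {fst c, snd c}"
          by (cases a, cases c) (auto simp: doubleton_eq_iff)
        then show "cmod (\<integral>x. T x a c \<partial>P) = 0" using T0[of a c] a c by simp
      qed
    qed (use a in auto)
    also have "\<dots> \<le> (\<Sum>c\<in>?c. 4 * \<beta> ^ 4 * (\<integral>x. (cmod (H i x (fst a) (snd a)))\<^sup>2 \<partial>P))"
    proof (rule sum_mono)
      fix c assume c: "c \<in> ?c"
      have cK: "c \<in> ?K" using a c by auto
      have eqH: "cmod (H i x (fst c) (snd c)) = cmod (H i x (fst a) (snd a))" for x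
        using c a resolvent_sym[OF sym_on_drop_index[OF sym_ent] y, of "fst a" n "snd a" i x] by auto
      have "cmod (\<integral>x. T x a c \<partial>P) \<le> (\<integral>x. cmod (T x a c) \<partial>P)" by (rule integral_norm_bound)
      also have "\<dots> \<le> (\<integral>x. 4 * \<beta> ^ 4 * (cmod (H i x (fst a) (snd a)))\<^sup>2 \<partial>P)"
      proof (rule integral_mono)
        show "integrable P (\<lambda>x. cmod (T x a c))" using Tint[OF a cK] by simp
        show "integrable P (\<lambda>x. 4 * \<beta> ^ 4 * (cmod (H i x (fst a) (snd a)))\<^sup>2)" using Hint[OF a] by simp
        fix x
        have "cmod (T x a c) \<le> (2 * \<beta>\<^sup>2) * (2 * \<beta>\<^sup>2) * (cmod (H i x (fst a) (snd a)) * cmod (H i x (fst a) (snd a)))"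
          unfolding T_def norm_mult norm_of_real abs_mult complex_mod_cnj eqH
          by (intro mult_mono Z_bound order_refl) auto
        then show "cmod (T x a c) \<le> 4 * \<beta> ^ 4 * (cmod (H i x (fst a) (snd a)))\<^sup>2"
          by (simp add: power2_eq_square power4_eq_xxxx mult_ac)
      qed
      finally show "cmod (\<integral>x. T x a c \<partial>P) \<le> 4 * \<beta> ^ 4 * (\<integral>x. (cmod (H i x (fst a) (snd a)))\<^sup>2 \<partial>P)" by simp
    qed
    also have "\<dots> = real (card ?c) * (4 * \<beta> ^ 4 * (\<integral>x. (cmod (H i x (fst a) (snd a)))\<^sup>2 \<partial>P))" by simp
    also have "\<dots> \<le> 2 * (4 * \<beta> ^ 4 * (\<integral>x. (cmod (H i x (fst a) (snd a)))\<^sup>2 \<partial>P))"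
    proof (rule mult_right_mono)
      show "real (card ?c) \<le> 2" by (cases "(snd a, fst a) = a") auto
    qed simp
    finally show ?thesis by simp
  qed
  have "complex_of_real (\<integral>x. (cmod (quad_error i x))\<^sup>2 \<partial>P) = (\<integral>x. (\<Sum>a\<in>?K. \<Sum>c\<in>?K. T x a c) \<partial>P)"
    unfolding expand[symmetric] by (rule integral_complex_of_real[symmetric])
  also have "\<dots> = (\<Sum>a\<in>?K. \<Sum>c\<in>?K. \<integral>x. T x a c \<partial>P)"
    by (subst Bochner_Integration.integral_sum, use Tint in \<open>force intro!: Bochner_Integration.integrable_sum\<close>)
       (intro sum.cong refl Bochner_Integration.integral_sum Tint)
  finally have "cmod (complex_of_real (\<integral>x. (cmod (quad_error i x))\<^sup>2 \<partial>P)) = cmod (\<Sum>a\<in>?K. \<Sum>c\<in>?K. \<integral>x. T x a c \<partial>P)"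
    by (rule arg_cong)
  also have "\<dots> \<le> (\<Sum>a\<in>?K. \<Sum>c\<in>?K. cmod (\<integral>x. T x a c \<partial>P))"
    by (intro order_trans[OF norm_sum] sum_mono norm_sum order_refl)
  also have "\<dots> \<le> (\<Sum>a\<in>?K. 8 * \<beta> ^ 4 * (\<integral>x. (cmod (H i x (fst a) (snd a)))\<^sup>2 \<partial>P))"
    by (intro sum_mono term_le)
  also have "\<dots> = 8 * \<beta> ^ 4 * (\<integral>x. N x \<partial>P)"
    unfolding N_def sum_distrib_left[symmetric] by (subst Bochner_Integration.integral_sum) (use Hint in auto)
  also have "\<dots> \<le> 8 * \<beta> ^ 4 * (\<integral>x. real n * (1 / y\<^sup>2) \<partial>P)"
    by (intro mult_left_mono integral_mono N) (use Hint in \<open>auto simp: N_def intro!: Bochner_Integration.integrable_sum\<close>)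
  also have "\<dots> = 8 * \<beta> ^ 4 * real n / y\<^sup>2" by (simp add: P.prob_space)
  finally show "(\<integral>x. (cmod (quad_error i x))\<^sup>2 \<partial>P) \<le> 8 * \<beta> ^ 4 * real n / y\<^sup>2"
    by (simp add: norm_of_real)
qed

section \<open>Deviation of the diagonal from the semicircle value\<close>

lemma G_diag_equation:
  assumes i: "i < n"
  shows "G x i i * (of_real (ent x i i) - \<i> * of_real y
    - (quad_error i x + (\<Sum>j\<in>{..<n}-{i}. of_real (v i j) * H i x j j))) = 1"
proof -
  let ?J = "{..<n} - {i}"
  have "(\<Sum>k\<in>?J. of_real (ent x i j) * of_real (ent x i k) * H i x j k)
      = (\<Sum>k\<in>?J. of_real (Z i x j k) * H i x j k) + of_real (v i j) * H i x j j" if j: "j \<in> ?J" for j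
  proof -
    have "(\<Sum>k\<in>?J. of_real (ent x i j) * of_real (ent x i k) * H i x j k)
        = (\<Sum>k\<in>?J. of_real (Z i x j k) * H i x j k + (if k = j then of_real (v i j) * H i x j j else 0))"
      by (intro sum.cong refl) (auto simp: Z_def algebra_simps)
    then show ?thesis using j by (simp add: sum.distrib)
  qed
  then have "(\<Sum>j\<in>?J. \<Sum>k\<in>?J. of_real (ent x i j) * of_real (ent x i k) * H i x j k)
      = quad_error i x + (\<Sum>j\<in>?J. of_real (v i j) * H i x j j)"
    by (simp add: quad_error_def sum.distrib)
  then show ?thesis using resolvent_Schur(1)[OF sym_ent y i, of x] by simp
qed

text \<open>Jensen's inequality for the square, in the form that a variance is nonnegative.\<close>

lemma quad_error_first_moment:
  assumes i: "i < n"
  shows "integrable P (\<lambda>x. cmod (quad_error i x))"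
    and "(\<integral>x. cmod (quad_error i x) \<partial>P) \<le> sqrt (8 * \<beta> ^ 4 * real n / y\<^sup>2)"
proof -
  show int: "integrable P (\<lambda>x. cmod (quad_error i x))"
    by (rule P.square_integrable_imp_integrable) (use i quad_error_second_moment(1)[OF i] in auto)
  have "(\<integral>x. cmod (quad_error i x) \<partial>P)\<^sup>2 \<le> (\<integral>x. (cmod (quad_error i x))\<^sup>2 \<partial>P)"
    using P.variance_eq[OF int quad_error_second_moment(1)[OF i]]
      P.variance_positive[of "\<lambda>x. cmod (quad_error i x)"] by simp
  also have "\<dots> \<le> 8 * \<beta> ^ 4 * real n / y\<^sup>2" by (rule quad_error_second_moment(2)[OF i])
  finally show "(\<integral>x. cmod (quad_error i x) \<partial>P) \<le> sqrt (8 * \<beta> ^ 4 * real n / y\<^sup>2)"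
    by (rule real_le_rsqrt)
qed

lemma G_diag_diff_le:
  assumes i: "i < n"
    and g: "g * (- (\<i> * of_real y) - of_real s * g) = 1" "cmod g \<le> 1 / y"
    and \<eta>: "\<bar>(\<Sum>j\<in>{..<n}-{i}. v i j) - s\<bar> \<le> \<eta>"
  shows "cmod (G x i i - g) \<le> (1 / y\<^sup>2) *
    (cmod (quad_error i x) + \<beta>\<^sup>2 / y + (\<Sum>j\<in>{..<n}-{i}. v i j * cmod (G x j j - g)) + \<eta> / y + \<beta>)"
proof -
  let ?J = "{..<n} - {i}"
  define U where "U = (\<Sum>j\<in>?J. of_real (v i j) * (H i x j j - G x j j))"
  define V where "V = (\<Sum>j\<in>?J. of_real (v i j) * (G x j j - g))"
  \<comment> \<open>This is 1/g - 1/G_ii, so that G_ii - g = G_ii g R. Its five terms are the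
    fluctuation of the quadratic form, the passage from the minor to the full matrix, the deviation
    to be estimated, the error of the row sum, and the diagonal entry.\<close>
  define R where "R = quad_error i x + U + V + of_real ((\<Sum>j\<in>?J. v i j) - s) * g - of_real (ent x i i)"
  have "(\<Sum>j\<in>?J. of_real (v i j) * H i x j j) = U + V + of_real (\<Sum>j\<in>?J. v i j) * g"
  proof -
    have "U + V = (\<Sum>j\<in>?J. of_real (v i j) * H i x j j - of_real (v i j) * g)"
      unfolding U_def V_def sum.distrib[symmetric] by (intro sum.cong refl) (simp add: algebra_simps)
    then show ?thesis by (simp add: sum_subtractf sum_distrib_right)
  qed
  then have R: "R = (- (\<i> * of_real y) - of_real s * g) - (of_real (ent x i i) - \<i> * of_real y
    - (quad_error i x + (\<Sum>j\<in>?J. of_real (v i j) * H i x j j)))"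
    by (simp add: R_def algebra_simps)
  have "G x i i - g = G x i i * g * R"
  proof -
    have "G x i i * g * R = G x i i * (g * (- (\<i> * of_real y) - of_real s * g))
      - (G x i i * (of_real (ent x i i) - \<i> * of_real y
    - (quad_error i x + (\<Sum>j\<in>?J. of_real (v i j) * H i x j j)))) * g"
      unfolding R by (simp add: algebra_simps)
    then show ?thesis unfolding g(1) G_diag_equation[OF i] by simp
  qed
  then have "cmod (G x i i - g) = (cmod (G x i i) * cmod g) * cmod R" by (simp add: norm_mult)
  also have "\<dots> \<le> (1 / y * (1 / y)) * cmod R"
    using y i by (intro mult_right_mono mult_mono G_norm_le g) auto
  also have "\<dots> \<le> (1 / y\<^sup>2) * (cmod (quad_error i x) + \<beta>\<^sup>2 / y + (\<Sum>j\<in>?J. v i j * cmod (G x j j - g)) + \<eta> / y + \<beta>)"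
  proof -
    have U: "cmod U \<le> \<beta>\<^sup>2 / y"
      unfolding U_def by (rule resolvent_minor_diag_diff[OF sym_ent y i]) (auto simp: v_nonneg v_le)
    have V: "cmod V \<le> (\<Sum>j\<in>?J. v i j * cmod (G x j j - g))"
      unfolding V_def by (intro sum_norm_le) (simp add: norm_mult v_nonneg)
    have S: "cmod (of_real ((\<Sum>j\<in>?J. v i j) - s) * g) \<le> \<eta> * (1 / y)"
      unfolding norm_mult norm_of_real using \<eta> g(2) order_trans[OF abs_ge_zero \<eta>] by (intro mult_mono) auto
    have "cmod R \<le> cmod (quad_error i x) + cmod U + cmod V + cmod (of_real ((\<Sum>j\<in>?J. v i j) - s) * g) + cmod (of_real (ent x i i))"
      unfolding R_def by (intro order_trans[OF norm_triangle_ineq4] order_trans[OF norm_triangle_ineq] add_mono order_refl)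
    also have "\<dots> \<le> cmod (quad_error i x) + \<beta>\<^sup>2 / y + (\<Sum>j\<in>?J. v i j * cmod (G x j j - g)) + \<eta> * (1 / y) + \<beta>"
      by (intro add_mono U V S order_refl) (simp add: ent_bound)
    finally have "(1 / y\<^sup>2) * cmod R \<le> (1 / y\<^sup>2) * (cmod (quad_error i x) + \<beta>\<^sup>2 / y + (\<Sum>j\<in>?J. v i j * cmod (G x j j - g)) + \<eta> * (1 / y) + \<beta>)"
      by (intro mult_left_mono) auto
    then show ?thesis by (simp add: power2_eq_square)
  qed
  finally show ?thesis .
qed

text \<open>The factor 2 is the price of absorbing the contraction term. For fixed y and \<beta> of
  order 1 / sqrt n, every summand except the one with \<eta> tends to zero.\<close>

definition err :: "real \<Rightarrow> real" where
  "err \<eta> = 2 / y\<^sup>2 * (sqrt (8 * \<beta> ^ 4 * real n / y\<^sup>2) + \<beta>\<^sup>2 / y + \<eta> / y + \<beta>)"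

text \<open>The maximum M of the expected deviations satisfies y^2 M <= X + n \<beta>^2 M, and
  \<open>large\<close> makes the last term at most half of the left-hand side. Taking the maximum
  copes with weights \<open>v i j\<close> that depend on i.\<close>

lemma G_diag_expectation_le:
  assumes g: "g * (- (\<i> * of_real y) - of_real s * g) = 1" "cmod g \<le> 1 / y"
    and \<eta>: "\<And>i. i < n \<Longrightarrow> \<bar>(\<Sum>j\<in>{..<n}-{i}. v i j) - s\<bar> \<le> \<eta>"
    and large: "2 * (real n * \<beta>\<^sup>2) \<le> y\<^sup>2" and i: "i < n"
  shows "(\<integral>x. cmod (G x i i - g) \<partial>P) \<le> err \<eta>"
proof -
  define d where "d i = (\<integral>x. cmod (G x i i - g) \<partial>P)" for i
  define X where "X = sqrt (8 * \<beta> ^ 4 * real n / y\<^sup>2) + \<beta>\<^sup>2 / y + \<eta> / y + \<beta>"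
  have int: "integrable P (\<lambda>x. cmod (G x j j - g))" if "j < n" for j
  proof (rule P.integrable_const_bound[where B = "1 / y + 1 / y"])
    show "AE x in P. norm (cmod (G x j j - g)) \<le> 1 / y + 1 / y"
      using norm_triangle_ineq4[of "G x j j" g for x] G_norm_le[OF that that] g(2)
      by (intro AE_I2) (smt (verit) norm_ge_zero real_norm_def)
  qed (use that in measurable)
  define M where "M = Max (d ` {..<n})"
  have dM: "d j \<le> M" if "j < n" for j using that by (auto simp: M_def)
  have M0: "M \<ge> 0"
    using order_trans[OF _ dM[OF n], of 0] by (simp add: d_def)
  have step: "d i \<le> (1 / y\<^sup>2) * (X + real n * \<beta>\<^sup>2 * M)" if i: "i < n" for i
  proof -
    have "d i \<le> (\<integral>x. (1 / y\<^sup>2) * (cmod (quad_error i x) + \<beta>\<^sup>2 / y + (\<Sum>j\<in>{..<n}-{i}. v i j * cmod (G x j j - g)) + \<eta> / y + \<beta>) \<partial>P)"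
      unfolding d_def
    proof (rule integral_mono[OF int[OF i]])
      show "integrable P (\<lambda>x. (1 / y\<^sup>2) * (cmod (quad_error i x) + \<beta>\<^sup>2 / y + (\<Sum>j\<in>{..<n}-{i}. v i j * cmod (G x j j - g)) + \<eta> / y + \<beta>))"
        by (intro integrable_mult_right Bochner_Integration.integrable_add Bochner_Integration.integrable_sum
            quad_error_first_moment(1)[OF i] int P.integrable_const) auto
      show "cmod (G x i i - g) \<le> (1 / y\<^sup>2) * (cmod (quad_error i x) + \<beta>\<^sup>2 / y + (\<Sum>j\<in>{..<n}-{i}. v i j * cmod (G x j j - g)) + \<eta> / y + \<beta>)" for x
        by (rule G_diag_diff_le[OF i g \<eta>[OF i]])
    qed
    also have "\<dots> = (1 / y\<^sup>2) * ((\<integral>x. cmod (quad_error i x) \<partial>P) + \<beta>\<^sup>2 / y + (\<Sum>j\<in>{..<n}-{i}. v i j * d j) + \<eta> / y + \<beta>)"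
    proof -
      have I2: "integrable P (\<lambda>x. \<Sum>j\<in>{..<n}-{i}. v i j * cmod (G x j j - g))"
        by (intro Bochner_Integration.integrable_sum integrable_mult_right int) auto
      have "(\<integral>x. (\<Sum>j\<in>{..<n}-{i}. v i j * cmod (G x j j - g)) \<partial>P) = (\<Sum>j\<in>{..<n}-{i}. v i j * d j)"
        unfolding d_def
        by (subst Bochner_Integration.integral_sum) (auto intro!: integrable_mult_right int)
      then show ?thesis
        using quad_error_first_moment(1)[OF i] I2 by (simp add: P.prob_space)
    qed
    also have "\<dots> \<le> (1 / y\<^sup>2) * (sqrt (8 * \<beta> ^ 4 * real n / y\<^sup>2) + \<beta>\<^sup>2 / y + real n * \<beta>\<^sup>2 * M + \<eta> / y + \<beta>)"
    proof (intro mult_left_mono add_mono order_refl quad_error_first_moment(2)[OF i])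
      have "(\<Sum>j\<in>{..<n}-{i}. v i j * d j) \<le> (\<Sum>j\<in>{..<n}-{i}. \<beta>\<^sup>2 * M)"
        by (intro sum_mono mult_mono v_le dM) (auto simp: d_def)
      also have "\<dots> \<le> (\<Sum>j<n. \<beta>\<^sup>2 * M)" using M0 by (intro sum_mono2) auto
      finally show "(\<Sum>j\<in>{..<n}-{i}. v i j * d j) \<le> real n * \<beta>\<^sup>2 * M" by simp
    qed simp
    finally show ?thesis by (simp add: X_def algebra_simps)
  qed
  have "M \<in> d ` {..<n}" unfolding M_def using n by (intro Max_in) auto
  then obtain k where k: "k < n" "M = d k" by auto
  have "M \<le> (1 / y\<^sup>2) * (X + real n * \<beta>\<^sup>2 * M)" using step[OF k(1)] k(2) by simp
  then have "y\<^sup>2 * M \<le> X + real n * \<beta>\<^sup>2 * M" using y by (simp add: field_simps)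
  moreover have "2 * (real n * \<beta>\<^sup>2 * M) \<le> y\<^sup>2 * M"
    using mult_right_mono[OF large M0] by (simp add: mult_ac)
  ultimately have "y\<^sup>2 * M \<le> 2 * X" by linarith
  moreover have "err \<eta> = 2 / y\<^sup>2 * X" by (simp add: err_def X_def)
  moreover have "M = y\<^sup>2 * M / y\<^sup>2" using y by simp
  ultimately have "M \<le> err \<eta>" using y divide_right_mono[of "y\<^sup>2 * M" "2 * X" "y\<^sup>2"] by simp
  then show ?thesis using dM[OF i] by (simp add: d_def)
qed

lemma trace_expectation_le:
  assumes g: "g * (- (\<i> * of_real y) - of_real s * g) = 1" "cmod g \<le> 1 / y"
    and \<eta>: "\<And>i. i < n \<Longrightarrow> \<bar>(\<Sum>j\<in>{..<n}-{i}. v i j) - s\<bar> \<le> \<eta>"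
    and large: "2 * (real n * \<beta>\<^sup>2) \<le> y\<^sup>2"
  shows "cmod ((\<integral>x. resolvent_trace n (ent x) y / of_nat n \<partial>P) - g) \<le> err \<eta>"
proof -
  have int: "integrable P (\<lambda>x. G x i i)" if "i < n" for i
    by (rule P_integrable[where B = "1 / y"]) (use that G_norm_le in auto)
  have int': "integrable P (\<lambda>x. cmod (G x i i - g))" if "i < n" for i
    using int[OF that] by (intro integrable_norm Bochner_Integration.integrable_diff) auto
  have "(\<integral>x. resolvent_trace n (ent x) y / of_nat n \<partial>P) - g = (\<Sum>i<n. (\<integral>x. G x i i - g \<partial>P)) / of_nat n"
    using int n by (simp add: resolvent_trace_def P.prob_space sum_subtractf diff_divide_distrib)
  also have "cmod \<dots> = cmod (\<Sum>i<n. (\<integral>x. G x i i - g \<partial>P)) / real n"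
    by (simp add: norm_divide)
  also have "\<dots> \<le> (\<Sum>i<n. err \<eta>) / real n"
  proof (intro divide_right_mono sum_norm_le)
    fix i assume "i \<in> {..<n}"
    then have "(\<integral>x. cmod (G x i i - g) \<partial>P) \<le> err \<eta>"
      by (intro G_diag_expectation_le[OF g \<eta> large]) auto
    then show "cmod (\<integral>x. G x i i - g \<partial>P) \<le> err \<eta>"
      by (rule order_trans[OF integral_norm_bound])
  qed simp
  also have "\<dots> = err \<eta>" using n by simp
  finally show ?thesis .
qed

text \<open>Of the 3 \<epsilon>, one covers the bias and two the fluctuation. At most n^2 squared
  differences of order (\<beta> / n)^2 add up to order \<beta>^2, which puts 1 / \<beta>^2 into the
  exponent.\<close>

lemma trace_tail:
  assumes g: "g * (- (\<i> * of_real y) - of_real s * g) = 1" "cmod g \<le> 1 / y"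
    and \<eta>: "\<And>i. i < n \<Longrightarrow> \<bar>(\<Sum>j\<in>{..<n}-{i}. v i j) - s\<bar> \<le> \<eta>"
    and large: "2 * (real n * \<beta>\<^sup>2) \<le> y\<^sup>2" and \<beta>: "\<beta> > 0"
    and \<epsilon>: "\<epsilon> > 0" "err \<eta> \<le> \<epsilon>"
  shows "measure P {x \<in> space P. 3 * \<epsilon> \<le> cmod (resolvent_trace n (ent x) y / of_nat n - g)}
    \<le> 4 * exp (- (\<epsilon>\<^sup>2 * y ^ 4 / (32 * \<beta>\<^sup>2)))"
proof -
  define f where "f x = resolvent_trace n (ent x) y / of_nat n" for x
  define D where "D = 16 * \<beta>\<^sup>2 / y ^ 4"
  have fm[measurable]: "f \<in> borel_measurable P"
    unfolding f_def[abs_def]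
    by (intro borel_measurable_divide resolvent_trace_measurable borel_measurable_const ent_meas)
  have "measure P {x \<in> space P. 3 * \<epsilon> \<le> cmod (f x - g)} \<le> measure P {x \<in> space P. 2 * \<epsilon> \<le> cmod (f x - (\<integral>x. f x \<partial>P))}"
  proof (rule P.finite_measure_mono)
    show "{x \<in> space P. 3 * \<epsilon> \<le> cmod (f x - g)} \<subseteq> {x \<in> space P. 2 * \<epsilon> \<le> cmod (f x - (\<integral>x. f x \<partial>P))}"
    proof clarify
      fix x assume "3 * \<epsilon> \<le> cmod (f x - g)"
      moreover have "cmod (f x - g) \<le> cmod (f x - (\<integral>x. f x \<partial>P)) + cmod ((\<integral>x. f x \<partial>P) - g)"
        using norm_triangle_ineq[of "f x - (\<integral>x. f x \<partial>P)" "(\<integral>x. f x \<partial>P) - g"] by simp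
      moreover have "cmod ((\<integral>x. f x \<partial>P) - g) \<le> \<epsilon>"
        unfolding f_def using trace_expectation_le[OF g \<eta> large] \<epsilon>(2) by linarith
      ultimately show "2 * \<epsilon> \<le> cmod (f x - (\<integral>x. f x \<partial>P))" by linarith
    qed
  qed measurable
  also have "\<dots> \<le> 4 * exp (- (\<epsilon>\<^sup>2 / (2 * D)))"
  proof (rule bounded_differences_tail_complex[OF prob sets_\<mu> finite_edges fm, where B = "1 / y" and c = "\<lambda>_. 4 * \<beta> / y\<^sup>2 / real n"])
    show "cmod (f x) \<le> 1 / y" for x
      using resolvent_trace_norm_le[OF sym_ent[of n x] y] n by (simp add: f_def norm_divide field_simps)
    show "cmod (f (x(e := t)) - f x) \<le> 4 * \<beta> / y\<^sup>2 / real n" if e: "e \<in> edges n" for x e t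
    proof -
      \<comment> \<open>Subtracting 1 undoes the shift between edges, counted from 1, and matrix
        indices, counted from 0.\<close>
      define p q where "p = fst e - 1" and "q = snd e - 1"
      have pq: "e = edge p q" using e by (cases e) (auto simp: edges_def edge_def p_def q_def min_def max_def)
      have "cmod (resolvent_trace n (ent (x(e := t))) y - resolvent_trace n (ent x) y) \<le> 2 * (2 * \<beta>) / y\<^sup>2"
      proof (rule resolvent_trace_diff_entry[OF sym_ent sym_ent y])
        show "ent (x(e := t)) i j = ent x i j" if "(i, j) \<noteq> (p, q)" "(i, j) \<noteq> (q, p)" for i j
          using that unfolding pq by (auto simp: ent_def edge_eq_iff doubleton_eq_iff)
        show "\<bar>ent x i j - ent (x(e := t)) i j\<bar> \<le> 2 * \<beta>" for i j
          using ent_bound[of x i j] ent_bound[of "x(e := t)" i j] by linarith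
      qed (use \<beta>_nonneg in simp)
      then have "cmod (resolvent_trace n (ent (x(e := t))) y - resolvent_trace n (ent x) y) / real n \<le> 2 * (2 * \<beta>) / y\<^sup>2 / real n"
        by (intro divide_right_mono) auto
      then show ?thesis by (simp add: f_def diff_divide_distrib[symmetric] norm_divide)
    qed
    have "(\<Sum>e\<in>edges n. (4 * \<beta> / y\<^sup>2 / real n)\<^sup>2) = real (card (edges n)) * (4 * \<beta> / y\<^sup>2 / real n)\<^sup>2" by simp
    also have "\<dots> \<le> real (n\<^sup>2) * (4 * \<beta> / y\<^sup>2 / real n)\<^sup>2"
      by (intro mult_right_mono of_nat_mono card_edges_le) auto
    also have "\<dots> = D" using n by (simp add: D_def power_divide power_mult_distrib)
    finally show "(\<Sum>e\<in>edges n. (4 * \<beta> / y\<^sup>2 / real n)\<^sup>2) \<le> D" .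
    show "D > 0" using \<beta> y by (simp add: D_def)
  qed (use \<epsilon> in auto)
  also have "\<epsilon>\<^sup>2 / (2 * D) = \<epsilon>\<^sup>2 * y ^ 4 / (32 * \<beta>\<^sup>2)" by (simp add: D_def)
  finally show ?thesis by (simp add: f_def)
qed

end

subsection \<open>From resolvent traces to empirical spectral distributions\<close>

text \<open>The image of the uniform law on positions, so that repeated list entries carry their
  multiplicity.\<close>

definition uniform_measure_list :: "real list \<Rightarrow> real measure" where
  "uniform_measure_list es = distr (measure_pmf (pmf_of_set {..<length es})) borel ((!) es)"

lemma real_distribution_uniform_measure_list: "real_distribution (uniform_measure_list es)"
proof -
  have "prob_space (uniform_measure_list es)"
    unfolding uniform_measure_list_def by (intro prob_space.prob_space_distr measure_pmf.prob_space_axioms) simp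
  then show ?thesis
    by (auto simp: real_distribution_def real_distribution_axioms_def uniform_measure_list_def)
qed

lemma integral_uniform_measure_list:
  fixes f :: "real \<Rightarrow> 'b :: {banach, second_countable_topology}"
  assumes "es \<noteq> []" and f: "f \<in> borel_measurable borel"
  shows "(\<integral>x. f x \<partial>uniform_measure_list es) = (\<Sum>i<length es. f (es ! i)) /\<^sub>R real (length es)"
    and "integrable (uniform_measure_list es) f"
proof -
  have ne: "{..<length es} \<noteq> {}" using assms(1) by auto
  have "(\<integral>x. f x \<partial>uniform_measure_list es) = (\<integral>i. f (es ! i) \<partial>measure_pmf (pmf_of_set {..<length es}))"
    unfolding uniform_measure_list_def by (rule integral_distr) (use f in auto)
  also have "\<dots> = (\<Sum>i<length es. pmf (pmf_of_set {..<length es}) i *\<^sub>R f (es ! i))"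
    by (rule integral_measure_pmf) (use ne in auto)
  also have "\<dots> = (\<Sum>i<length es. f (es ! i)) /\<^sub>R real (length es)"
    using ne by (simp add: scaleR_sum_right inverse_eq_divide)
  finally show "(\<integral>x. f x \<partial>uniform_measure_list es) = (\<Sum>i<length es. f (es ! i)) /\<^sub>R real (length es)" .
  show "integrable (uniform_measure_list es) f"
    unfolding uniform_measure_list_def
  proof (subst integrable_distr_eq)
    show "integrable (measure_pmf (pmf_of_set {..<length es})) (\<lambda>i. f (es ! i))"
      by (rule integrable_measure_pmf_finite) (simp add: set_pmf_of_set[OF ne finite_lessThan])
  qed (use f in simp_all)
qed

lemma cdf_uniform_measure_list:
  assumes "es \<noteq> []"
  shows "cdf (uniform_measure_list es) x = real (size (filter_mset (\<lambda>l. l \<le> x) (mset es))) / real (length es)"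
proof -
  interpret real_distribution "uniform_measure_list es" by (rule real_distribution_uniform_measure_list)
  have "cdf (uniform_measure_list es) x = (\<integral>z. indicator {..x} z \<partial>uniform_measure_list es)"
    by (simp add: cdf_def)
  also have "\<dots> = (\<Sum>i<length es. indicator {..x} (es ! i)) / real (length es)"
    by (subst integral_uniform_measure_list(1)) (use assms in \<open>auto simp: divide_inverse mult.commute\<close>)
  also have "(\<Sum>i<length es. indicator {..x} (es ! i)) = (\<Sum>e\<leftarrow>es. indicator {..x} e :: real)"
    by (simp add: sum_list_sum_nth lessThan_atLeast0)
  also have "\<dots> = real (size (filter_mset (\<lambda>l. l \<le> x) (mset es)))"
    by (induction es) (auto simp: indicator_def)
  finally show ?thesis .
qed

text \<open>The normalised resolvent trace is the Stieltjes transform of the uniform measure on the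
  eigenvalues, and the Frobenius bound controls its second moment. The limit has no atoms, so weak
  convergence yields convergence of the distribution functions at every x.\<close>

lemma esd_tendsto_of_resolvent_trace:
  assumes sym: "\<And>n. n \<ge> 2 \<Longrightarrow> sym_on n (b n)"
    and bound: "\<And>n. n \<ge> 2 \<Longrightarrow> (\<Sum>i<n. \<Sum>j<n. (b n i j)\<^sup>2) \<le> C * real n"
    and s: "s > 0" and y: "y > 0"
    and conv: "\<And>k::nat. (\<lambda>n. resolvent_trace n (b n) (y + real k) / of_nat n)
        \<longlonglongrightarrow> stieltjes (semicircle s) (y + real k)"
  shows "(\<lambda>n. esd (mat n n (\<lambda>(i, j). b n i j)) x) \<longlonglongrightarrow> cdf (semicircle s) x"
proof -
  have "\<exists>es. length es = n \<and> eigenvalues_mset (mat n n (\<lambda>(i, j). b n i j)) = mset es \<and>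
    (\<forall>y>0. resolvent_trace n (b n) y = (\<Sum>i<n. 1 / (of_real (es ! i) - \<i> * of_real y))) \<and>
    (\<Sum>i<n. (es ! i)\<^sup>2) = (\<Sum>i<n. \<Sum>j<n. (b n i j)\<^sup>2)" if "n \<ge> 2" for n
    using symmetric_spectral_sums[OF sym[OF that]] by metis
  then obtain es where es: "\<And>n. n \<ge> 2 \<Longrightarrow> length (es n) = n"
    "\<And>n. n \<ge> 2 \<Longrightarrow> eigenvalues_mset (mat n n (\<lambda>(i, j). b n i j)) = mset (es n)"
    "\<And>n y. n \<ge> 2 \<Longrightarrow> y > 0 \<Longrightarrow> resolvent_trace n (b n) y = (\<Sum>i<n. 1 / (of_real (es n ! i) - \<i> * of_real y))"
    "\<And>n. n \<ge> 2 \<Longrightarrow> (\<Sum>i<n. (es n ! i)\<^sup>2) = (\<Sum>i<n. \<Sum>j<n. (b n i j)\<^sup>2)"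
    by metis
  have ne: "es (n + 2) \<noteq> []" for n using es(1)[of "n + 2"] by auto
  \<comment> \<open>The shift by 2 makes every list nonempty and puts every index in the range of
    the assumptions; it is undone at the end.\<close>
  define \<rho> where "\<rho> n = uniform_measure_list (es (n + 2))" for n
  have "weak_conv_m \<rho> (semicircle s)"
  proof (rule stieltjes_tendsto_imp_weak_conv[where y = y and C = C])
    show "real_distribution (\<rho> n)" for n
      unfolding \<rho>_def by (rule real_distribution_uniform_measure_list)
    show "real_distribution (semicircle s)" by (rule real_distribution_semicircle[OF s])
    show "integrable (\<rho> n) (\<lambda>x. x\<^sup>2)" for n
      unfolding \<rho>_def by (rule integral_uniform_measure_list(2)[OF ne]) simp
    show "(\<integral>x. x\<^sup>2 \<partial>\<rho> n) \<le> C" for n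
    proof -
      have "(\<integral>x. x\<^sup>2 \<partial>\<rho> n) = (\<Sum>i<n + 2. (es (n + 2) ! i)\<^sup>2) / real (n + 2)"
        unfolding \<rho>_def by (subst integral_uniform_measure_list(1)[OF ne]) (auto simp: es divide_inverse mult.commute)
      also have "\<dots> \<le> C * real (n + 2) / real (n + 2)"
        using bound[of "n + 2"] es(4)[of "n + 2"] by (intro divide_right_mono) auto
      also have "\<dots> = C" by simp
      finally show ?thesis .
    qed
    show "(\<lambda>n. stieltjes (\<rho> n) (y + real k)) \<longlonglongrightarrow> stieltjes (semicircle s) (y + real k)" for k
    proof -
      have yk: "y + real k > 0" using y by simp
      have "stieltjes (\<rho> n) (y + real k) = resolvent_trace (n + 2) (b (n + 2)) (y + real k) / of_nat (n + 2)" for n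
        unfolding \<rho>_def stieltjes_def es(3)[OF le_add2 yk]
        by (subst integral_uniform_measure_list(1)[OF ne])
           (auto simp: es scaleR_conv_of_real divide_inverse mult.commute)
      then show ?thesis using LIMSEQ_ignore_initial_segment[OF conv[of k], of 2] by simp
    qed
  qed (rule y)
  then have "(\<lambda>n. cdf (\<rho> n) x) \<longlonglongrightarrow> cdf (semicircle s) x"
    using isCont_cdf_semicircle[OF s] by (simp add: weak_conv_m_def weak_conv_def)
  moreover have "cdf (\<rho> n) x = esd (mat (n + 2) (n + 2) (\<lambda>(i, j). b (n + 2) i j)) x" for n
    unfolding \<rho>_def esd_def using cdf_uniform_measure_list[OF ne] by (simp add: es)
  ultimately show ?thesis
    using LIMSEQ_offset[of "\<lambda>n. esd (mat n n (\<lambda>(i, j). b n i j)) x" 2] by simp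
qed

subsection \<open>Deterministic perturbations\<close>

text \<open>One rank-one step per summand, each costing 1 / y whatever its coefficient.\<close>

lemma resolvent_trace_diff_finite_rank:
  assumes "finite S" and sym: "sym_on n b" and y: "y > 0"
  shows "cmod (resolvent_trace n (\<lambda>i j. b i j + (\<Sum>k\<in>S. c k * u k i * u k j)) y - resolvent_trace n b y) \<le> real (card S) / y"
  using assms(1)
proof (induction S rule: finite_induct)
  case (insert k S)
  define b' where "b' i j = b i j + (\<Sum>k\<in>S. c k * u k i * u k j)" for i j
  have sym': "sym_on n b'"
    using sym by (auto simp: sym_on_def b'_def mult.commute mult.left_commute intro!: sum.cong)
  have "(\<lambda>i j. b i j + (\<Sum>k\<in>insert k S. c k * u k i * u k j)) = (\<lambda>i j. b' i j + c k * u k i * u k j)"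
    using insert.hyps by (simp add: b'_def fun_eq_iff)
  then have "cmod (resolvent_trace n (\<lambda>i j. b i j + (\<Sum>k\<in>insert k S. c k * u k i * u k j)) y - resolvent_trace n b y)
      \<le> cmod (resolvent_trace n (\<lambda>i j. b' i j + c k * u k i * u k j) y - resolvent_trace n b' y)
        + cmod (resolvent_trace n b' y - resolvent_trace n b y)"
    using norm_triangle_ineq[of "resolvent_trace n (\<lambda>i j. b' i j + c k * u k i * u k j) y - resolvent_trace n b' y"
        "resolvent_trace n b' y - resolvent_trace n b y"] by simp
  also have "\<dots> \<le> 1 / y + real (card S) / y"
    using resolvent_trace_diff_rank_one[OF sym' y, of "c k" "u k"] insert.IH
    by (intro add_mono) (simp_all add: norm_minus_commute b'_def[abs_def])
  also have "\<dots> = real (card (insert k S)) / y"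
    using insert.hyps by (simp add: add_divide_distrib)
  finally show ?case .
qed (use y in simp)

subsection \<open>The semicircle law\<close>

text \<open>Truncation to [-K, K] replaces almost sure bounds by sure ones and does not alter laws
  concentrated on that interval.\<close>

definition clip :: "real \<Rightarrow> real \<Rightarrow> real" where
  "clip K t = max (- K) (min K t)"

text \<open>The index \<open>True\<close> stands for the law within blocks and \<open>False\<close>
  for the law between them; \<open>same\<close> abstracts from the partition. Independence is
  required for each n separately.\<close>

locale two_distribution_matrix = prob_space M
  for M :: "'w measure" +
  fixes K :: real and \<sigma> :: "bool \<Rightarrow> real" and D :: "bool \<Rightarrow> real measure"
    and same :: "nat \<Rightarrow> nat \<Rightarrow> nat \<Rightarrow> bool" and a :: "nat \<Rightarrow> nat \<Rightarrow> nat \<Rightarrow> 'w \<Rightarrow> real"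
  assumes K: "K > 0"
    and D_distribution: "\<And>c. real_distribution (D c)"
    and D_bounded: "\<And>c. AE x in D c. \<bar>x\<bar> \<le> K"
    and D_variance: "\<And>c. prob_space.variance (D c) (\<lambda>x. x) = (\<sigma> c)\<^sup>2"
    and same_commute: "\<And>n i j. same n i j = same n j i"
    and a_sym: "\<And>n i j \<omega>. n \<ge> 2 \<Longrightarrow> i \<in> {1..n} \<Longrightarrow> j \<in> {1..n} \<Longrightarrow> \<omega> \<in> space M \<Longrightarrow> a n i j \<omega> = a n j i \<omega>"
    and a_indep: "\<And>n. n \<ge> 2 \<Longrightarrow> indep_vars (\<lambda>_. borel) (\<lambda>(i, j). a n i j) (edges n)"
    and a_meas: "\<And>n i j. n \<ge> 2 \<Longrightarrow> i \<in> {1..n} \<Longrightarrow> j \<in> {1..n} \<Longrightarrow> a n i j \<in> borel_measurable M"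
    and a_distr: "\<And>n i j. n \<ge> 2 \<Longrightarrow> i \<in> {1..n} \<Longrightarrow> j \<in> {1..n} \<Longrightarrow> distr M borel (a n i j) = D (same n i j)"
begin

definition \<kappa> :: "bool \<Rightarrow> real" where "\<kappa> c = (\<integral>x. x \<partial>D c)"

definition \<mu> :: "nat \<Rightarrow> nat \<times> nat \<Rightarrow> real measure" where
  "\<mu> n e = D (same n (fst e) (snd e))"

definition h :: "nat \<Rightarrow> nat \<times> nat \<Rightarrow> real \<Rightarrow> real" where
  "h n e t = (clip K t - \<kappa> (same n (fst e) (snd e))) / (2 * sqrt (real n))"

text \<open>This is 2 K / (2 sqrt n): the truncated entry and its mean are both at most K in
  absolute value.\<close>

definition \<beta> :: "nat \<Rightarrow> real" where "\<beta> n = K / sqrt (real n)"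

definition centered :: "nat \<Rightarrow> 'w \<Rightarrow> nat \<Rightarrow> nat \<Rightarrow> real" where
  "centered n \<omega> i j = h n (edge i j) (a n (fst (edge i j)) (snd (edge i j)) \<omega>)"

lemma clip_bound: "\<bar>clip K t\<bar> \<le> K" using K by (auto simp: clip_def)

lemma clip_meas [measurable]: "clip K \<in> borel_measurable borel"
  unfolding clip_def[abs_def] by measurable

lemma clip_AE: "AE x in D c. clip K x = x"
  using D_bounded[of c] by eventually_elim (auto simp: clip_def)

lemma integral_clip:
  fixes f :: "real \<Rightarrow> real"
  assumes "f \<in> borel_measurable borel"
  shows "(\<integral>x. f (clip K x) \<partial>D c) = (\<integral>x. f x \<partial>D c)"
proof -
  interpret Dc: real_distribution "D c" by (rule D_distribution)
  show ?thesis
    by (rule integral_cong_AE) (use assms clip_AE[of c] in \<open>auto elim!: eventually_mono intro: measurable_compose[OF clip_meas]\<close>)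
qed

lemma \<kappa>_bound: "\<bar>\<kappa> c\<bar> \<le> K"
proof -
  interpret Dc: real_distribution "D c" by (rule D_distribution)
  have "\<kappa> c = (\<integral>x. clip K x \<partial>D c)" using integral_clip[of "\<lambda>x. x" c] by (simp add: \<kappa>_def)
  also have "\<bar>\<dots>\<bar> \<le> (\<integral>x. \<bar>clip K x\<bar> \<partial>D c)" by (rule integral_abs_bound)
  also have "\<dots> \<le> (\<integral>x. K \<partial>D c)"
    by (rule integral_mono) (use clip_bound in \<open>auto intro!: Dc.integrable_const_bound[where B = K]\<close>)
  finally show ?thesis using Dc.prob_space by simp
qed

lemma clip_int: "integrable (D c) (clip K)"
proof -
  interpret Dc: real_distribution "D c" by (rule D_distribution)
  show ?thesis by (rule Dc.integrable_const_bound[where B = K]) (use clip_bound in auto)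
qed

lemma random_symmetric:
  assumes n: "n \<ge> 2" and y: "y > 0"
  shows "random_symmetric n (\<mu> n) (h n) (\<beta> n) y"
proof (rule random_symmetric.intro)
  fix e
  interpret Dc: real_distribution "D (same n (fst e) (snd e))" by (rule D_distribution)
  show "prob_space (\<mu> n e)" unfolding \<mu>_def by (rule Dc.prob_space_axioms)
  show "sets (\<mu> n e) = sets borel" by (simp add: \<mu>_def)
  show "h n e \<in> borel_measurable borel" unfolding h_def[abs_def] by measurable
  show "\<bar>h n e t\<bar> \<le> \<beta> n" for t
  proof -
    have "\<bar>clip K t - \<kappa> (same n (fst e) (snd e))\<bar> \<le> 2 * K"
      using clip_bound[of t] \<kappa>_bound[of "same n (fst e) (snd e)"] by linarith
    then have "\<bar>clip K t - \<kappa> (same n (fst e) (snd e))\<bar> / (2 * sqrt (real n)) \<le> 2 * K / (2 * sqrt (real n))"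
      by (intro divide_right_mono) auto
    then show ?thesis by (simp add: h_def \<beta>_def abs_divide)
  qed
  show "(\<integral>t. h n e t \<partial>\<mu> n e) = 0"
    using integral_clip[of "\<lambda>x. x"] clip_int Dc.prob_space by (simp add: h_def \<mu>_def \<kappa>_def)
qed (use n y in simp_all)

lemma v_eq:
  fixes y :: real
  assumes n: "n \<ge> 2" and y: "y > 0"
  shows "random_symmetric.v (\<mu> n) (h n) i j = (\<sigma> (same n (Suc i) (Suc j)))\<^sup>2 / (4 * real n)"
proof -
  interpret R: random_symmetric n "\<mu> n" "h n" "\<beta> n" y by (rule random_symmetric[OF n y])
  let ?c = "same n (fst (edge i j)) (snd (edge i j))"
  have c: "?c = same n (Suc i) (Suc j)"
    by (simp add: edge_def min_def max_def same_commute)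
  have "R.v i j = (\<integral>t. (clip K t - \<kappa> ?c)\<^sup>2 / (4 * real n) \<partial>D ?c)"
    unfolding R.v_def h_def \<mu>_def by (simp add: power_divide power_mult_distrib)
  also have "\<dots> = (\<integral>t. (clip K t - \<kappa> ?c)\<^sup>2 \<partial>D ?c) / (4 * real n)" by simp
  also have "(\<integral>t. (clip K t - \<kappa> ?c)\<^sup>2 \<partial>D ?c) = (\<integral>t. (t - \<kappa> ?c)\<^sup>2 \<partial>D ?c)"
    by (rule integral_clip[of "\<lambda>t. (t - \<kappa> ?c)\<^sup>2"]) measurable
  also have "\<dots> = (\<sigma> ?c)\<^sup>2" using D_variance[of ?c] by (simp add: \<kappa>_def)
  finally show ?thesis by (simp add: c)
qed

text \<open>For fixed n, independence says that the joint law of the entries is the product measure,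
  so the estimate on the product space pulls back to M. With \<beta>^2 = K^2 / n its exponent
  becomes linear in n.\<close>

lemma tail_bound:
  assumes n: "n \<ge> 2" and y: "y > 0" "2 * K\<^sup>2 \<le> y\<^sup>2"
    and g: "g * (- (\<i> * of_real y) - of_real (s / 4) * g) = 1" "cmod g \<le> 1 / y"
    and \<eta>: "\<And>i. i < n \<Longrightarrow> \<bar>(\<Sum>j\<in>{..<n}-{i}. (\<sigma> (same n (Suc i) (Suc j)))\<^sup>2) / real n - s\<bar> \<le> \<eta>"
    and \<epsilon>: "\<epsilon> > 0"
      "2 / y\<^sup>2 * (sqrt (8 * (\<beta> n) ^ 4 * real n / y\<^sup>2) + (\<beta> n)\<^sup>2 / y + (\<eta> / 4) / y + \<beta> n) \<le> \<epsilon>"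
  defines "A \<equiv> {\<omega> \<in> space M. 3 * \<epsilon> \<le> cmod (resolvent_trace n (centered n \<omega>) y / of_nat n - g)}"
  shows "A \<in> sets M" "measure M A \<le> 4 * exp (- (\<epsilon>\<^sup>2 * y ^ 4 / (32 * K\<^sup>2)) * real n)"
proof -
  interpret R: random_symmetric n "\<mu> n" "h n" "\<beta> n" y by (rule random_symmetric[OF n y(1)])
  define X where "X \<omega> = (\<lambda>e\<in>edges n. (case e of (i, j) \<Rightarrow> a n i j) \<omega>)" for \<omega>
  have am: "(case e of (i, j) \<Rightarrow> a n i j) \<in> borel_measurable M" if "e \<in> edges n" for e
    using that a_meas[OF n] by (cases e) (auto simp: edges_def)
  have "edge 0 0 \<in> edges n" using n by (intro edge_in_edges) auto
  then have ne: "edges n \<noteq> {}" by auto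
  have "distr M (PiM (edges n) (\<lambda>_. borel)) X = PiM (edges n) (\<lambda>e. distr M borel (case e of (i, j) \<Rightarrow> a n i j))"
    unfolding X_def using indep_vars_iff_distr_eq_PiM'[where X = "\<lambda>(i, j). a n i j" and M' = "\<lambda>_. borel", OF ne am] a_indep[OF n] by blast
  also have "\<dots> = PiM (edges n) (\<mu> n)"
  proof (rule PiM_cong[OF refl])
    fix e assume "e \<in> edges n"
    then show "distr M borel (case e of (i, j) \<Rightarrow> a n i j) = \<mu> n e"
      using a_distr[OF n] by (cases e) (auto simp: edges_def \<mu>_def)
  qed
  finally have distr: "distr M (PiM (edges n) (\<lambda>_. borel)) X = R.P" .
  have Xm: "X \<in> measurable M (PiM (edges n) (\<lambda>_. borel))"
    unfolding X_def by (intro measurable_restrict am)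
  define S where "S = {x \<in> space R.P. 3 * \<epsilon> \<le> cmod (resolvent_trace n (R.ent x) y / of_nat n - g)}"
  have [measurable]: "(\<lambda>x. resolvent_trace n (R.ent x) y) \<in> borel_measurable R.P"
    by (intro resolvent_trace_measurable R.ent_meas)
  have S: "S \<in> sets R.P" unfolding S_def by measurable
  then have S': "S \<in> sets (PiM (edges n) (\<lambda>_. borel))" using distr[symmetric] by simp
  have spaceP: "space R.P = space (PiM (edges n) (\<lambda>_. borel :: real measure))" using distr[symmetric] by simp
  have ent: "R.ent (X \<omega>) i j = centered n \<omega> i j" if "i < n" "j < n" for \<omega> i j
    using edge_in_edges[OF that] by (simp add: R.ent_def centered_def X_def case_prod_beta)
  have "A = X -` S \<inter> space M"
    unfolding A_def S_def spaceP
    using measurable_space[OF Xm] resolvent_trace_cong[of n "R.ent (X \<omega>)" "centered n \<omega>" for \<omega>, OF ent] by auto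
  then show "A \<in> sets M" using measurable_sets[OF Xm S'] by simp
  have "measure M A = measure R.P S"
    unfolding distr[symmetric] \<open>A = X -` S \<inter> space M\<close> by (rule measure_distr[OF Xm S', symmetric])
  also have "\<dots> \<le> 4 * exp (- (\<epsilon>\<^sup>2 * y ^ 4 / (32 * (\<beta> n)\<^sup>2)))"
    unfolding S_def
  proof (rule R.trace_tail[OF g, of "\<eta> / 4"])
    have "n > 0" using n by simp
    show "\<bar>(\<Sum>j\<in>{..<n}-{i}. R.v i j) - s / 4\<bar> \<le> \<eta> / 4" if "i < n" for i
    proof -
      have eq: "(\<Sum>j\<in>{..<n}-{i}. R.v i j) - s / 4 = ((\<Sum>j\<in>{..<n}-{i}. (\<sigma> (same n (Suc i) (Suc j)))\<^sup>2) / real n - s) / 4"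
        unfolding v_eq[OF n y(1)] sum_divide_distrib[symmetric] by (simp add: diff_divide_distrib)
      show ?thesis unfolding eq abs_divide using \<eta>[OF that] by simp
    qed
    show "2 * (real n * (\<beta> n)\<^sup>2) \<le> y\<^sup>2" using y(2) \<open>n > 0\<close> by (simp add: \<beta>_def power_divide)
    show "\<beta> n > 0" using K \<open>n > 0\<close> by (simp add: \<beta>_def)
    show "R.err (\<eta> / 4) \<le> \<epsilon>" using \<epsilon>(2) by (simp add: R.err_def)
  qed (rule \<epsilon>(1))
  also have "\<epsilon>\<^sup>2 * y ^ 4 / (32 * (\<beta> n)\<^sup>2) = \<epsilon>\<^sup>2 * y ^ 4 / (32 * K\<^sup>2) * real n"
    using n by (simp add: \<beta>_def power_divide)
  finally show "measure M A \<le> 4 * exp (- (\<epsilon>\<^sup>2 * y ^ 4 / (32 * K\<^sup>2)) * real n)" by simp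
qed

lemma AE_bounded: "AE \<omega> in M. \<forall>n\<ge>2. \<forall>i\<in>{1..n}. \<forall>j\<in>{1..n}. \<bar>a n i j \<omega>\<bar> \<le> K"
proof -
  have "AE \<omega> in M. n \<ge> 2 \<longrightarrow> i \<in> {1..n} \<longrightarrow> j \<in> {1..n} \<longrightarrow> \<bar>a n i j \<omega>\<bar> \<le> K" for n i j
  proof (cases "n \<ge> 2 \<and> i \<in> {1..n} \<and> j \<in> {1..n}")
    case True
    then have d: "distr M borel (a n i j) = D (same n i j)" and am: "a n i j \<in> borel_measurable M"
      by (auto intro: a_distr a_meas)
    have "AE x in distr M borel (a n i j). \<bar>x\<bar> \<le> K" unfolding d by (rule D_bounded)
    then have "AE \<omega> in M. \<bar>a n i j \<omega>\<bar> \<le> K" by (rule AE_distrD[OF am])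
    then show ?thesis by eventually_elim auto
  qed auto
  then have "AE \<omega> in M. \<forall>n i j. n \<ge> 2 \<longrightarrow> i \<in> {1..n} \<longrightarrow> j \<in> {1..n} \<longrightarrow> \<bar>a n i j \<omega>\<bar> \<le> K"
    by (simp add: AE_all_countable)
  then show ?thesis by eventually_elim auto
qed

text \<open>For fixed \<epsilon> the tails are summable, so the first Borel-Cantelli lemma applies
  whatever the coupling between different n. Taking \<epsilon> = 1 / (k + 1) for all k gives
  convergence off one null set.\<close>

lemma AE_centered_trace:
  assumes s: "s > 0" and y: "y > 0" "2 * K\<^sup>2 \<le> y\<^sup>2"
    and rows: "\<And>\<epsilon>. \<epsilon> > 0 \<Longrightarrow> \<forall>\<^sub>F n in sequentially. \<forall>i<n.
        \<bar>(\<Sum>j\<in>{..<n}-{i}. (\<sigma> (same n (Suc i) (Suc j)))\<^sup>2) / real n - s\<bar> \<le> \<epsilon>"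
  shows "AE \<omega> in M. (\<lambda>n. resolvent_trace n (centered n \<omega>) y / of_nat n) \<longlonglongrightarrow> stieltjes (semicircle s) y"
proof -
  \<comment> \<open>With g = i \<gamma> the self-consistent equation becomes \<gamma> (y + (s/4)
    \<gamma>) = 1; this is its nonnegative root, which is therefore at most 1 / y.\<close>
  define \<gamma> where "\<gamma> = 2 * (sqrt (y\<^sup>2 + s) - y) / s"
  define g where "g = stieltjes (semicircle s) y"
  have g_eq: "g = \<i> * of_real \<gamma>" unfolding g_def \<gamma>_def by (rule stieltjes_semicircle[OF s y(1)])
  have \<gamma>: "\<gamma> \<ge> 0" "\<gamma> * (y + s / 4 * \<gamma>) = 1"
  proof -
    define r where "r = sqrt (y\<^sup>2 + s)"
    have r: "r * r = y\<^sup>2 + s" using s y by (simp add: r_def)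
    have "r \<ge> y" unfolding r_def using s by (intro real_le_rsqrt) simp
    then show "\<gamma> \<ge> 0" using s by (simp add: \<gamma>_def r_def)
    have "\<gamma> * (y + s / 4 * \<gamma>) = (r - y) * (r + y) / s"
      unfolding \<gamma>_def r_def[symmetric] using s by (simp add: field_simps)
    also have "(r - y) * (r + y) = s" using r by (simp add: algebra_simps power2_eq_square)
    finally show "\<gamma> * (y + s / 4 * \<gamma>) = 1" using s by simp
  qed
  have g1: "g * (- (\<i> * of_real y) - of_real (s / 4) * g) = 1"
  proof -
    have eq: "g * (- (\<i> * of_real y) - of_real (s / 4) * g) = of_real (\<gamma> * (y + s / 4 * \<gamma>))"
      unfolding g_eq by (simp add: complex_eq_iff algebra_simps)
    show ?thesis unfolding eq \<gamma>(2) by simp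
  qed
  have g2: "cmod g \<le> 1 / y"
  proof -
    have "\<gamma> * y \<le> \<gamma> * (y + s / 4 * \<gamma>)" using \<gamma>(1) s by (intro mult_left_mono) auto
    then show ?thesis using \<gamma> y by (simp add: g_eq norm_mult field_simps)
  qed
  have small: "AE \<omega> in M. \<forall>\<^sub>F n in sequentially. cmod (resolvent_trace n (centered n \<omega>) y / of_nat n - g) < 3 * \<epsilon>"
    if \<epsilon>: "\<epsilon> > 0" for \<epsilon>
  proof -
    \<comment> \<open>Chosen so that the error bound tends to 2 / y^2 * \<eta> / (4 y) = \<epsilon>
      / 2.\<close>
    define \<eta> where "\<eta> = \<epsilon> * y ^ 3"
    have \<eta>: "\<eta> > 0" using \<epsilon> y by (simp add: \<eta>_def)
    define A where "A n = {\<omega> \<in> space M. 3 * \<epsilon> \<le> cmod (resolvent_trace n (centered n \<omega>) y / of_nat n - g)}" for n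
    have lim: "(\<lambda>n. 2 / y\<^sup>2 * (sqrt (8 * (\<beta> n) ^ 4 * real n / y\<^sup>2) + (\<beta> n)\<^sup>2 / y + (\<eta> / 4) / y + \<beta> n)) \<longlonglongrightarrow> 2 / y\<^sup>2 * (sqrt 0 + 0 / y + (\<eta> / 4) / y + 0)"
    proof (intro tendsto_intros)
      show b: "\<beta> \<longlonglongrightarrow> 0" unfolding \<beta>_def[abs_def] using K by real_asymp
      show "(\<lambda>n. (\<beta> n)\<^sup>2) \<longlonglongrightarrow> 0" using tendsto_power[OF b, of 2] by simp
      show "(\<lambda>n. 8 * (\<beta> n) ^ 4 * real n / y\<^sup>2) \<longlonglongrightarrow> 0"
        unfolding \<beta>_def[abs_def] using K y by real_asymp
    qed (use y in auto)
    have lim_eq: "2 / y\<^sup>2 * (sqrt 0 + 0 / y + (\<eta> / 4) / y + 0) = \<epsilon> / 2"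
      using y by (simp add: \<eta>_def power2_eq_square power3_eq_cube)
    have "\<forall>\<^sub>F n in sequentially. 2 / y\<^sup>2 * (sqrt (8 * (\<beta> n) ^ 4 * real n / y\<^sup>2) + (\<beta> n)\<^sup>2 / y + (\<eta> / 4) / y + \<beta> n) < \<epsilon>"
      by (rule order_tendstoD(2)[OF lim[unfolded lim_eq]]) (use \<epsilon> in simp)
    with rows[OF \<eta>] eventually_ge_at_top[of 2]
    have "\<forall>\<^sub>F n in sequentially. A n \<in> sets M \<and> measure M (A n) \<le> 4 * exp (- (\<epsilon>\<^sup>2 * y ^ 4 / (32 * K\<^sup>2)) * real n)"
    proof eventually_elim
      case (elim n)
      have "A n \<in> sets M"
        unfolding A_def by (rule tail_bound(1)[OF elim(2) y g1 g2 _ \<epsilon> less_imp_le[OF elim(3)]]) (use elim(1) in blast)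
      moreover have "measure M (A n) \<le> 4 * exp (- (\<epsilon>\<^sup>2 * y ^ 4 / (32 * K\<^sup>2)) * real n)"
        unfolding A_def by (rule tail_bound(2)[OF elim(2) y g1 g2 _ \<epsilon> less_imp_le[OF elim(3)]]) (use elim(1) in blast)
      ultimately show ?case by blast
    qed
    then obtain N where N: "\<And>n. n \<ge> N \<Longrightarrow> A n \<in> sets M"
      "\<And>n. n \<ge> N \<Longrightarrow> measure M (A n) \<le> 4 * exp (- (\<epsilon>\<^sup>2 * y ^ 4 / (32 * K\<^sup>2)) * real n)"
      unfolding eventually_sequentially by blast
    define c where "c = \<epsilon>\<^sup>2 * y ^ 4 / (32 * K\<^sup>2)"
    have c: "c > 0" using \<epsilon> y K by (simp add: c_def)
    have "AE \<omega> in M. \<forall>\<^sub>F n in sequentially. \<omega> \<in> space M - A (n + N)"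
    proof (rule borel_cantelli_AE1)
      show "A (n + N) \<in> sets M" for n by (rule N) simp
      show "emeasure M (A (n + N)) < \<infinity>" for n by (simp add: emeasure_eq_measure)
      have "summable (\<lambda>n. 4 * exp (- c) ^ n)" using c by (intro summable_mult summable_geometric) simp
      then show "summable (\<lambda>n. measure M (A (n + N)))"
      proof (rule summable_comparison_test'[where N = 0])
        fix n
        have "measure M (A (n + N)) \<le> 4 * exp (- c * real (n + N))" using N(2)[of "n + N"] by (simp add: c_def)
        also have "\<dots> \<le> 4 * exp (- c * real n)" using c by simp
        also have "exp (- c * real n) = exp (- c) ^ n" by (metis exp_of_nat2_mult)
        finally show "norm (measure M (A (n + N))) \<le> 4 * exp (- c) ^ n" by simp
      qed
    qed
    then show ?thesis
    proof eventually_elim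
      case (elim \<omega>)
      then have "\<forall>\<^sub>F n in sequentially. \<omega> \<in> space M - A n"
        by (subst eventually_sequentially_seg[of _ N, symmetric])
      then show ?case by eventually_elim (auto simp: A_def)
    qed
  qed
  have "AE \<omega> in M. \<forall>k::nat. \<forall>\<^sub>F n in sequentially.
      cmod (resolvent_trace n (centered n \<omega>) y / of_nat n - g) < 3 * (1 / real (Suc k))"
    unfolding AE_all_countable by (intro allI small) simp
  then show ?thesis
  proof eventually_elim
    case (elim \<omega>)
    show ?case
      unfolding g_def[symmetric] tendsto_iff dist_norm
    proof (intro allI impI)
      fix e :: real assume "e > 0"
      then obtain k where k: "1 / real (Suc k) < e / 3" using nat_approx_posE[of "e / 3"] by auto
      show "\<forall>\<^sub>F n in sequentially. cmod (resolvent_trace n (centered n \<omega>) y / of_nat n - g) < e"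
        using elim[rule_format, of k] by eventually_elim (use k in simp)
    qed
  qed
qed

text \<open>\<open>rows\<close> and \<open>pert\<close> isolate what each of the two block regimes
  has to supply. As \<open>pert\<close> is uniform over symmetric \<open>b\<close>, it can be
  applied to the random centred matrix outcome by outcome.\<close>

theorem semicircle_law:
  assumes s: "s > 0"
    and rows: "\<And>\<epsilon>. \<epsilon> > 0 \<Longrightarrow> \<forall>\<^sub>F n in sequentially. \<forall>i<n.
        \<bar>(\<Sum>j\<in>{..<n}-{i}. (\<sigma> (same n (Suc i) (Suc j)))\<^sup>2) / real n - s\<bar> \<le> \<epsilon>"
    and pert: "\<And>y \<epsilon>. y > 0 \<Longrightarrow> \<epsilon> > 0 \<Longrightarrow> \<forall>\<^sub>F n in sequentially. \<forall>b. sym_on n b \<longrightarrow>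
        cmod (resolvent_trace n (\<lambda>i j. b i j + \<kappa> (same n (Suc i) (Suc j)) / (2 * sqrt (real n))) y
              - resolvent_trace n b y) \<le> \<epsilon> * real n"
  shows "AE \<omega> in M. \<forall>x. (\<lambda>n. esd (scaled_matrix a n \<omega>) x) \<longlonglongrightarrow> cdf (semicircle s) x"
proof -
  \<comment> \<open>Large enough that 2 K^2 is at most (y + k)^2 for all k, the range in which the
    contraction works.\<close>
  define y where "y = 2 * K"
  have y: "y > 0" using K by (simp add: y_def)
  have "2 * K\<^sup>2 \<le> (y + real k)\<^sup>2" for k
  proof -
    have "2 * K\<^sup>2 \<le> y\<^sup>2" by (simp add: y_def power2_eq_square)
    also have "\<dots> \<le> (y + real k)\<^sup>2" using y by (intro power_mono) auto
    finally show ?thesis .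
  qed
  then have "AE \<omega> in M. \<forall>k::nat. (\<lambda>n. resolvent_trace n (centered n \<omega>) (y + real k) / of_nat n)
      \<longlonglongrightarrow> stieltjes (semicircle s) (y + real k)"
    unfolding AE_all_countable using y by (intro allI AE_centered_trace[OF s _ _ rows]) auto
  with AE_bounded AE_space show ?thesis
  proof eventually_elim
    case (elim \<omega>)
    define b where "b n i j = a n (Suc i) (Suc j) \<omega> / (2 * sqrt (real n))" for n i j
    have sym: "sym_on n (b n)" if "n \<ge> 2" for n
      using a_sym[OF that _ _ \<open>\<omega> \<in> space M\<close>] by (simp add: sym_on_def b_def)
    have symc: "sym_on n (centered n \<omega>)" for n
      by (simp add: sym_on_def centered_def edge_commute)
    have b_eq: "b n i j = centered n \<omega> i j + \<kappa> (same n (Suc i) (Suc j)) / (2 * sqrt (real n))"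
      if n: "n \<ge> 2" and ij: "i < n" "j < n" for n i j
    proof -
      have ij': "Suc i \<in> {1..n}" "Suc j \<in> {1..n}" using ij by auto
      have e: "a n (fst (edge i j)) (snd (edge i j)) \<omega> = a n (Suc i) (Suc j) \<omega>"
        using a_sym[OF n ij' \<open>\<omega> \<in> space M\<close>] by (simp add: edge_def min_def max_def)
      have c: "same n (fst (edge i j)) (snd (edge i j)) = same n (Suc i) (Suc j)"
        by (simp add: edge_def min_def max_def same_commute)
      \<comment> \<open>On the almost sure event of bounded entries truncation does nothing, so the
        matrix is its centred version plus the mean.\<close>
      have "clip K (a n (Suc i) (Suc j) \<omega>) = a n (Suc i) (Suc j) \<omega>"
        using elim(1) n ij' by (force simp: clip_def abs_le_iff)
      then show ?thesis by (simp add: b_def centered_def h_def e c diff_divide_distrib)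
    qed
    have conv: "(\<lambda>n. resolvent_trace n (b n) (y + real k) / of_nat n) \<longlonglongrightarrow> stieltjes (semicircle s) (y + real k)" for k
    proof -
      have yk: "y + real k > 0" using y by simp
      have "(\<lambda>n. resolvent_trace n (b n) (y + real k) / of_nat n
          - resolvent_trace n (centered n \<omega>) (y + real k) / of_nat n) \<longlonglongrightarrow> 0"
        unfolding tendsto_iff dist_norm
      proof (intro allI impI)
        fix e :: real assume e: "e > 0"
        have "e / 2 > 0" using e by simp
        from pert[OF yk this] eventually_ge_at_top[of 2]
        show "\<forall>\<^sub>F n in sequentially. norm (resolvent_trace n (b n) (y + real k) / of_nat n
          - resolvent_trace n (centered n \<omega>) (y + real k) / of_nat n - 0) < e"
        proof eventually_elim
          case (elim n)
          have "resolvent_trace n (b n) (y + real k) = resolvent_trace n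
              (\<lambda>i j. centered n \<omega> i j + \<kappa> (same n (Suc i) (Suc j)) / (2 * sqrt (real n))) (y + real k)"
            using b_eq elim(2) by (intro resolvent_trace_cong) auto
          then have "cmod (resolvent_trace n (b n) (y + real k) - resolvent_trace n (centered n \<omega>) (y + real k)) \<le> e / 2 * real n"
            using elim(1) symc by auto
          then have "cmod (resolvent_trace n (b n) (y + real k) - resolvent_trace n (centered n \<omega>) (y + real k)) / real n \<le> e / 2"
            using elim(2) by (simp add: divide_simps)
          moreover have "norm (resolvent_trace n (b n) (y + real k) / of_nat n
              - resolvent_trace n (centered n \<omega>) (y + real k) / of_nat n - 0)
            = cmod (resolvent_trace n (b n) (y + real k) - resolvent_trace n (centered n \<omega>) (y + real k)) / real n"
            by (simp add: diff_divide_distrib[symmetric] norm_divide)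
          ultimately show ?case using e by linarith
        qed
      qed
      from tendsto_add[OF this elim(3)[rule_format, of k]] show ?thesis by simp
    qed
    have bound: "(\<Sum>i<n. \<Sum>j<n. (b n i j)\<^sup>2) \<le> K\<^sup>2 * real n" if n: "n \<ge> 2" for n
    proof -
      have "(b n i j)\<^sup>2 \<le> K\<^sup>2 / real n" if "i < n" "j < n" for i j
      proof -
        have "\<bar>a n (Suc i) (Suc j) \<omega>\<bar> \<le> K" using elim(1) n that by auto
        then have "(a n (Suc i) (Suc j) \<omega>)\<^sup>2 \<le> K\<^sup>2" using K by (metis abs_le_square_iff abs_of_pos)
        then have "(a n (Suc i) (Suc j) \<omega>)\<^sup>2 / (4 * real n) \<le> K\<^sup>2 / (4 * real n)" by (intro divide_right_mono) auto
        also have "\<dots> \<le> K\<^sup>2 / real n" using n by (simp add: divide_simps)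
        finally show ?thesis by (simp add: b_def power_divide power_mult_distrib)
      qed
      then have "(\<Sum>i<n. \<Sum>j<n. (b n i j)\<^sup>2) \<le> (\<Sum>i<n. \<Sum>j<n. K\<^sup>2 / real n)" by (intro sum_mono) auto
      also have "\<dots> = K\<^sup>2 * real n" using n by simp
      finally show ?thesis .
    qed
    have mat: "scaled_matrix a n \<omega> = mat n n (\<lambda>(i, j). b n i j)" for n
      by (rule eq_matI) (auto simp: scaled_matrix_def b_def)
    show ?case
      unfolding mat by (intro allI esd_tendsto_of_resolvent_trace[OF sym bound s y conv])
  qed
qed

end

subsection \<open>Block structure\<close>

locale block_partition =
  fixes m :: "nat \<Rightarrow> nat" and V :: "nat \<Rightarrow> nat \<Rightarrow> nat set"
  assumes m_ge: "\<And>n. n \<ge> 2 \<Longrightarrow> m n \<ge> 2"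
    and partition: "\<And>n. n \<ge> 2 \<Longrightarrow> inj_on (V n) {1..m n} \<and> partition_on {1..n} (V n ` {1..m n})"
begin

definition same_block :: "nat \<Rightarrow> nat \<Rightarrow> nat \<Rightarrow> bool" where
  "same_block n i j \<longleftrightarrow> (\<exists>k\<in>{1..m n}. i \<in> V n k \<and> j \<in> V n k)"

abbreviation \<nu> where "\<nu> n k \<equiv> part_fraction V n k"

lemma same_block_commute: "same_block n i j = same_block n j i"
  by (auto simp: same_block_def)

lemma block_exists: "n \<ge> 2 \<Longrightarrow> i \<in> {1..n} \<Longrightarrow> \<exists>k\<in>{1..m n}. i \<in> V n k"
  using partition[of n] by (auto simp: partition_on_def)

lemma block_subset: "n \<ge> 2 \<Longrightarrow> k \<in> {1..m n} \<Longrightarrow> V n k \<subseteq> {1..n}"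
  using partition[of n] by (auto simp: partition_on_def)

lemma block_finite: "n \<ge> 2 \<Longrightarrow> k \<in> {1..m n} \<Longrightarrow> finite (V n k)"
  using block_subset finite_subset by blast

lemma block_disjoint:
  assumes n: "n \<ge> 2" and kl: "k \<in> {1..m n}" "l \<in> {1..m n}" and i: "i \<in> V n k" "i \<in> V n l"
  shows "k = l"
proof -
  have inj: "inj_on (V n) {1..m n}" and "disjoint (V n ` {1..m n})"
    using partition[OF n] by (auto simp: partition_on_def)
  then have "V n k = V n l"
    using disjointD[of "V n ` {1..m n}" "V n k" "V n l"] kl i by blast
  then show ?thesis using inj_onD[OF inj] kl by blast
qed

lemma same_block_iff:
  assumes n: "n \<ge> 2" and k: "k \<in> {1..m n}" and i: "i \<in> V n k"
  shows "same_block n i j \<longleftrightarrow> j \<in> V n k"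
  unfolding same_block_def using block_disjoint[OF n k _ i] k i by blast

lemma \<nu>_pos:
  assumes "n \<ge> 2" "k \<in> {1..m n}"
  shows "\<nu> n k > 0"
proof -
  have "V n k \<noteq> {}" using partition[OF assms(1)] assms(2) by (auto simp: partition_on_def)
  then have "card (V n k) > 0" using block_finite[OF assms] by (simp add: card_gt_0_iff)
  then show ?thesis using assms by (simp add: part_fraction_def)
qed

lemma sum_\<nu>:
  assumes n: "n \<ge> 2"
  shows "(\<Sum>k\<in>{1..m n}. \<nu> n k) = 1"
proof -
  have "(\<Union>k\<in>{1..m n}. V n k) = {1..n}"
    using partition[OF n] by (auto simp: partition_on_def)
  moreover have "card (\<Union>k\<in>{1..m n}. V n k) = (\<Sum>k\<in>{1..m n}. card (V n k))"
    using block_finite[OF n] block_disjoint[OF n] by (intro card_UN_disjoint) auto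
  ultimately have "(\<Sum>k\<in>{1..m n}. card (V n k)) = n" by simp
  then have "(\<Sum>k\<in>{1..m n}. real (card (V n k))) = real n" by (metis of_nat_sum)
  then show ?thesis using n by (simp add: part_fraction_def sum_divide_distrib[symmetric])
qed

lemma card_same_block:
  assumes n: "n \<ge> 2" and k: "k \<in> {1..m n}" and i: "i \<in> V n k"
  shows "real (card {j \<in> {..<n}. same_block n i (Suc j)}) = real n * \<nu> n k"
proof -
  have "Suc ` {j \<in> {..<n}. same_block n i (Suc j)} = V n k"
  proof
    show "V n k \<subseteq> Suc ` {j \<in> {..<n}. same_block n i (Suc j)}"
    proof
      fix l assume l: "l \<in> V n k"
      then have "l \<in> {1..n}" using block_subset[OF n k] by auto
      then show "l \<in> Suc ` {j \<in> {..<n}. same_block n i (Suc j)}"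
        using l same_block_iff[OF n k i] by (intro image_eqI[of _ _ "l - 1"]) auto
    qed
  qed (use same_block_iff[OF n k i] in auto)
  then have "card {j \<in> {..<n}. same_block n i (Suc j)} = card (V n k)"
    by (metis card_image inj_Suc inj_on_subset subset_UNIV)
  then show ?thesis using n by (simp add: part_fraction_def)
qed

text \<open>A row meets its own block, of fraction \<nu>, and the rest, so its average is w False +
  \<nu> (w True - w False); leaving out the diagonal costs |w True| / n. The limit fraction p will
  be 1 / m or 0.\<close>

lemma row_average:
  fixes w :: "bool \<Rightarrow> real"
  assumes near: "\<And>\<epsilon>. \<epsilon> > 0 \<Longrightarrow> \<forall>\<^sub>F n in sequentially. \<forall>k\<in>{1..m n}. \<bar>\<nu> n k - p\<bar> \<le> \<epsilon>"
    and s: "s = w True * p + w False * (1 - p)" and \<epsilon>: "\<epsilon> > 0"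
  shows "\<forall>\<^sub>F n in sequentially. \<forall>i<n. \<bar>(\<Sum>j\<in>{..<n}-{i}. w (same_block n (Suc i) (Suc j))) / real n - s\<bar> \<le> \<epsilon>"
proof -
  define C where "C = \<bar>w True - w False\<bar> + 1"
  have C: "C > 0" by (simp add: C_def)
  have "(\<lambda>n. \<bar>w True\<bar> / real n) \<longlonglongrightarrow> 0" by real_asymp
  then have "\<forall>\<^sub>F n in sequentially. \<bar>w True\<bar> / real n < \<epsilon> / 2"
    by (rule order_tendstoD) (use \<epsilon> in simp)
  moreover have "\<epsilon> / (2 * C) > 0" using \<epsilon> C by simp
  note near[OF this]
  ultimately show ?thesis
    using eventually_ge_at_top[of 2]
  proof eventually_elim
    case (elim n)
    show ?case
    proof (intro allI impI)
      fix i assume i: "i < n"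
      then obtain k where k: "k \<in> {1..m n}" "Suc i \<in> V n k"
        using block_exists[OF elim(3), of "Suc i"] by auto
      let ?N = "real (card {j \<in> {..<n}. same_block n (Suc i) (Suc j)})"
      have "(\<Sum>j<n. w (same_block n (Suc i) (Suc j)))
          = (\<Sum>j<n. w False + (if same_block n (Suc i) (Suc j) then w True - w False else 0))"
        by (intro sum.cong refl) auto
      also have "\<dots> = real n * w False + ?N * (w True - w False)"
        by (simp add: sum.distrib sum.inter_filter[symmetric])
      finally have tot: "(\<Sum>j<n. w (same_block n (Suc i) (Suc j))) = real n * (w False + \<nu> n k * (w True - w False))"
        unfolding card_same_block[OF elim(3) k] by (simp add: algebra_simps)
      have "(\<Sum>j<n. w (same_block n (Suc i) (Suc j))) = w (same_block n (Suc i) (Suc i)) + (\<Sum>j\<in>{..<n}-{i}. w (same_block n (Suc i) (Suc j)))"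
        using i by (intro sum.remove) auto
      moreover have "same_block n (Suc i) (Suc i)" using k by (auto simp: same_block_def)
      ultimately have "(\<Sum>j\<in>{..<n}-{i}. w (same_block n (Suc i) (Suc j))) = real n * (w False + \<nu> n k * (w True - w False)) - w True"
        using tot by simp
      then have "(\<Sum>j\<in>{..<n}-{i}. w (same_block n (Suc i) (Suc j))) / real n
          = w False + \<nu> n k * (w True - w False) - w True / real n"
        using elim(3) by (simp add: diff_divide_distrib)
      then have "(\<Sum>j\<in>{..<n}-{i}. w (same_block n (Suc i) (Suc j))) / real n - s
          = (\<nu> n k - p) * (w True - w False) - w True / real n"
        by (simp add: s algebra_simps)
      also have "\<bar>\<dots>\<bar> \<le> \<bar>\<nu> n k - p\<bar> * \<bar>w True - w False\<bar> + \<bar>w True\<bar> / real n"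
        by (metis abs_divide abs_mult abs_of_nat abs_triangle_ineq4)
      also have "\<dots> \<le> \<epsilon> / (2 * C) * C + \<epsilon> / 2"
        using elim(1,2) k C \<epsilon> by (intro add_mono mult_mono) (auto simp: C_def)
      also have "\<dots> = \<epsilon>" using C by (simp add: field_simps)
      finally show "\<bar>(\<Sum>j\<in>{..<n}-{i}. w (same_block n (Suc i) (Suc j))) / real n - s\<bar> \<le> \<epsilon>" .
    qed
  qed
qed

text \<open>The mean consists of one constant matrix and one indicator matrix per block, m0 + 1
  rank-one terms in all. Their effect on the trace is bounded, hence eventually below \<epsilon>
  n.\<close>

lemma mean_perturbation_bounded_rank:
  fixes w :: "bool \<Rightarrow> real"
  assumes const: "\<forall>\<^sub>F n in sequentially. m n = m\<^sub>0" and y: "y > 0" and \<epsilon>: "\<epsilon> > 0"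
  shows "\<forall>\<^sub>F n in sequentially. \<forall>b. sym_on n b \<longrightarrow>
    cmod (resolvent_trace n (\<lambda>i j. b i j + w (same_block n (Suc i) (Suc j)) / (2 * sqrt (real n))) y
      - resolvent_trace n b y) \<le> \<epsilon> * real n"
proof -
  have "\<forall>\<^sub>F n in sequentially. real (Suc m\<^sub>0) / (y * \<epsilon>) \<le> real n"
    using filterlim_real_sequentially by (simp add: filterlim_at_top)
  with const eventually_ge_at_top[of 2] show ?thesis
  proof eventually_elim
    case (elim n)
    \<comment> \<open>Index 0 carries the constant matrix; the blocks are numbered from 1.\<close>
    define c where "c k = (if k = 0 then w False else w True - w False) / (2 * sqrt (real n))" for k :: nat
    define u :: "nat \<Rightarrow> nat \<Rightarrow> real" where "u k i = (if k = 0 then 1 else of_bool (Suc i \<in> V n k))" for k i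
    have eq: "w (same_block n (Suc i) (Suc j)) / (2 * sqrt (real n)) = (\<Sum>k\<in>{0..m n}. c k * u k i * u k j)"
      if i: "i < n" for i j
    proof -
      obtain l where l: "l \<in> {1..m n}" "Suc i \<in> V n l"
        using block_exists[OF elim(2), of "Suc i"] i by auto
      have "(\<Sum>k\<in>{0..m n}. c k * u k i * u k j) = c 0 * u 0 i * u 0 j + (\<Sum>k\<in>{1..m n}. c k * u k i * u k j)"
        by (simp add: sum.atLeast_Suc_atMost)
      also have "(\<Sum>k\<in>{1..m n}. c k * u k i * u k j) = (\<Sum>k\<in>{l}. c k * u k i * u k j)"
      proof (rule sum.mono_neutral_right)
        show "\<forall>k\<in>{1..m n} - {l}. c k * u k i * u k j = 0"
          using block_disjoint[OF elim(2) _ l(1) _ l(2)] by (auto simp: u_def)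
      qed (use l in auto)
      finally show ?thesis
        using l same_block_iff[OF elim(2) l, of "Suc j"]
        by (auto simp: c_def u_def add_divide_distrib[symmetric] diff_divide_distrib[symmetric])
    qed
    show ?case
    proof (intro allI impI)
      fix b assume b: "sym_on n b"
      have "resolvent_trace n (\<lambda>i j. b i j + w (same_block n (Suc i) (Suc j)) / (2 * sqrt (real n))) y
          = resolvent_trace n (\<lambda>i j. b i j + (\<Sum>k\<in>{0..m n}. c k * u k i * u k j)) y"
        using eq by (intro resolvent_trace_cong) simp
      then have "cmod (resolvent_trace n (\<lambda>i j. b i j + w (same_block n (Suc i) (Suc j)) / (2 * sqrt (real n))) y
          - resolvent_trace n b y) \<le> real (card {0..m n}) / y"
        using resolvent_trace_diff_finite_rank[OF _ b y, of "{0..m n}" c u] by simp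
      also have "\<dots> \<le> \<epsilon> * real n"
        using elim(1,3) y \<epsilon> by (simp add: field_simps)
      finally show "cmod (resolvent_trace n (\<lambda>i j. b i j + w (same_block n (Suc i) (Suc j)) / (2 * sqrt (real n))) y
          - resolvent_trace n b y) \<le> \<epsilon> * real n" .
    qed
  qed
qed

text \<open>Only the constant part is removed by rank. The block part has row square sums (w True -
  w False)^2 \<nu> / 4, which are small along with the blocks, so the Frobenius estimate applies to
  it.\<close>

lemma mean_perturbation_small_blocks:
  fixes w :: "bool \<Rightarrow> real"
  assumes small: "\<And>\<epsilon>. \<epsilon> > 0 \<Longrightarrow> \<forall>\<^sub>F n in sequentially. \<forall>k\<in>{1..m n}. \<nu> n k \<le> \<epsilon>"
    and y: "y > 0" and \<epsilon>: "\<epsilon> > 0"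
  shows "\<forall>\<^sub>F n in sequentially. \<forall>b. sym_on n b \<longrightarrow>
    cmod (resolvent_trace n (\<lambda>i j. b i j + w (same_block n (Suc i) (Suc j)) / (2 * sqrt (real n))) y
      - resolvent_trace n b y) \<le> \<epsilon> * real n"
proof -
  define C where "C = (w True - w False)\<^sup>2 + 1"
  have C: "C > 0" by (simp add: C_def add_nonneg_pos)
  \<comment> \<open>Tuned so that C \<delta> n^2 / (4 y^4) = (\<epsilon> n / 2)^2; the other half of
    \<epsilon> n pays for the constant part.\<close>
  define \<delta> where "\<delta> = \<epsilon>\<^sup>2 * y ^ 4 / C"
  have \<delta>: "\<delta> > 0" using C \<epsilon> y by (simp add: \<delta>_def)
  have "\<forall>\<^sub>F n in sequentially. 2 / (y * \<epsilon>) \<le> real n"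
    using filterlim_real_sequentially by (simp add: filterlim_at_top)
  with small[OF \<delta>] eventually_ge_at_top[of 2] show ?thesis
  proof eventually_elim
    case (elim n)
    have n: "real n > 0" using elim(2) by simp
    define r where "r = 2 * sqrt (real n)"
    have r2: "r\<^sup>2 = 4 * real n" by (simp add: r_def power_mult_distrib)
    show ?case
    proof (intro allI impI)
      fix b assume b: "sym_on n b"
      define b1 where "b1 i j = b i j + w False / r * 1 * 1" for i j
      define b2 where "b2 i j = b i j + w (same_block n (Suc i) (Suc j)) / r" for i j
      have sym1: "sym_on n b1" and sym2: "sym_on n b2"
        using b by (auto simp: sym_on_def b1_def b2_def same_block_commute)
      have 1: "cmod (resolvent_trace n b1 y - resolvent_trace n b y) \<le> 1 / y"
        using resolvent_trace_diff_rank_one[OF b y, of "w False / r" "\<lambda>_. 1"]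
        by (simp add: norm_minus_commute b1_def[abs_def])
      have row: "(\<Sum>l<n. (b1 k l - b2 k l)\<^sup>2) \<le> (w True - w False)\<^sup>2 / 4 * \<delta>" if k: "k < n" for k
      proof -
        obtain q where q: "q \<in> {1..m n}" "Suc k \<in> V n q"
          using block_exists[OF elim(2), of "Suc k"] k by auto
        have "(b1 k l - b2 k l)\<^sup>2 = (if same_block n (Suc k) (Suc l) then (w True - w False)\<^sup>2 / r\<^sup>2 else 0)" for l
          by (simp add: b1_def b2_def diff_divide_distrib[symmetric] power_divide power2_commute)
        then have "(\<Sum>l<n. (b1 k l - b2 k l)\<^sup>2) = real (card {l \<in> {..<n}. same_block n (Suc k) (Suc l)}) * ((w True - w False)\<^sup>2 / r\<^sup>2)"
          by (simp add: sum.inter_filter[symmetric])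
        also have "\<dots> = \<nu> n q * ((w True - w False)\<^sup>2 / 4)"
          unfolding card_same_block[OF elim(2) q] r2 using n by simp
        also have "\<dots> \<le> \<delta> * ((w True - w False)\<^sup>2 / 4)"
          using elim(1) q by (intro mult_right_mono) auto
        finally show ?thesis by (simp add: mult.commute)
      qed
      have "(cmod (resolvent_trace n b2 y - resolvent_trace n b1 y))\<^sup>2
          \<le> (\<Sum>k<n. \<Sum>l<n. (b1 k l - b2 k l)\<^sup>2) * (real n / y ^ 4)"
        by (rule resolvent_trace_diff_Frobenius[OF sym2 sym1 y])
      also have "\<dots> \<le> (\<Sum>k<n. (w True - w False)\<^sup>2 / 4 * \<delta>) * (real n / y ^ 4)"
        by (intro mult_right_mono sum_mono row) auto
      also have "\<dots> = (w True - w False)\<^sup>2 * (\<delta> * (real n)\<^sup>2 / (4 * y ^ 4))"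
        by (simp add: power2_eq_square)
      also have "\<dots> \<le> C * (\<delta> * (real n)\<^sup>2 / (4 * y ^ 4))"
        using \<delta> y by (intro mult_right_mono) (auto simp: C_def)
      also have "\<dots> = (\<epsilon> * real n / 2)\<^sup>2"
        using C y by (simp add: \<delta>_def power_mult_distrib power_divide)
      finally have 2: "cmod (resolvent_trace n b2 y - resolvent_trace n b1 y) \<le> \<epsilon> * real n / 2"
        by (rule power2_le_imp_le) (use \<epsilon> n in simp)
      have "1 / y \<le> \<epsilon> * real n / 2" using elim(3) y \<epsilon> by (simp add: field_simps)
      moreover have "cmod (resolvent_trace n b2 y - resolvent_trace n b y)
          \<le> cmod (resolvent_trace n b2 y - resolvent_trace n b1 y) + cmod (resolvent_trace n b1 y - resolvent_trace n b y)"
        using norm_triangle_ineq[of "resolvent_trace n b2 y - resolvent_trace n b1 y" "resolvent_trace n b1 y - resolvent_trace n b y"]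
        by simp
      ultimately have "cmod (resolvent_trace n b2 y - resolvent_trace n b y) \<le> \<epsilon> * real n"
        using 1 2 by linarith
      then show "cmod (resolvent_trace n (\<lambda>i j. b i j + w (same_block n (Suc i) (Suc j)) / (2 * sqrt (real n))) y
          - resolvent_trace n b y) \<le> \<epsilon> * real n"
        by (simp add: b2_def[abs_def] r_def)
    qed
  qed
qed

section \<open>Block sizes in the two regimes\<close>

definition largest :: "nat \<Rightarrow> real" where
  "largest n = Max (\<nu> n ` {1..m n})"

lemma \<nu>_le_largest: "k \<in> {1..m n} \<Longrightarrow> \<nu> n k \<le> largest n"
  by (simp add: largest_def)

lemma small_blocks:
  assumes "largest \<longlonglongrightarrow> 0" and \<epsilon>: "\<epsilon> > 0"
  shows "\<forall>\<^sub>F n in sequentially. \<forall>k\<in>{1..m n}. \<bar>\<nu> n k - 0\<bar> \<le> \<epsilon>"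
  using order_tendstoD(2)[OF assms] eventually_ge_at_top[of 2]
proof eventually_elim
  case (elim n)
  show ?case
  proof
    fix k assume k: "k \<in> {1..m n}"
    show "\<bar>\<nu> n k - 0\<bar> \<le> \<epsilon>"
      using \<nu>_le_largest[OF k] \<nu>_pos[OF elim(2) k] elim(1) by simp
  qed
qed

text \<open>The fractions sum to 1 and are asymptotically equal, so m times the largest one tends to
  1 and m itself tends to 1 / L. A convergent sequence of integers is eventually constant, which
  produces m0 and L = 1 / m0.\<close>

lemma equal_blocks:
  assumes L: "largest \<longlonglongrightarrow> L" "L > 0"
    and ratio: "\<And>\<epsilon>. \<epsilon> > 0 \<Longrightarrow> \<forall>\<^sub>F n in sequentially. \<forall>i\<in>{1..m n}. \<forall>j\<in>{1..m n}. \<bar>\<nu> n i / \<nu> n j - 1\<bar> < \<epsilon>"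
  obtains m\<^sub>0 where "m\<^sub>0 \<ge> 2" "\<forall>\<^sub>F n in sequentially. m n = m\<^sub>0"
    "\<And>\<epsilon>. \<epsilon> > 0 \<Longrightarrow> \<forall>\<^sub>F n in sequentially. \<forall>k\<in>{1..m n}. \<bar>\<nu> n k - 1 / real m\<^sub>0\<bar> \<le> \<epsilon>"
proof -
  have close: "\<forall>\<^sub>F n in sequentially. \<forall>k\<in>{1..m n}. \<nu> n k \<ge> largest n * (1 - \<epsilon>)" if "\<epsilon> > 0" for \<epsilon>
    using ratio[OF that] eventually_ge_at_top[of 2]
  proof eventually_elim
    case (elim n)
    have "{1..m n} \<noteq> {}" using m_ge[OF elim(2)] by auto
    then have "largest n \<in> \<nu> n ` {1..m n}" unfolding largest_def by (intro Max_in) auto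
    then obtain j where j: "j \<in> {1..m n}" "largest n = \<nu> n j" by auto
    show ?case
    proof
      fix k assume k: "k \<in> {1..m n}"
      have "1 - \<epsilon> \<le> \<nu> n k / \<nu> n j" using elim(1) j(1) k by (smt (verit) abs_less_iff)
      then show "\<nu> n k \<ge> largest n * (1 - \<epsilon>)"
        using \<nu>_pos[OF elim(2) j(1)] j(2) by (simp add: field_simps)
    qed
  qed
  have lower: "\<forall>\<^sub>F n in sequentially. 1 \<le> real (m n) * largest n"
    using eventually_ge_at_top[of 2]
  proof eventually_elim
    case (elim n)
    have "1 = (\<Sum>k\<in>{1..m n}. \<nu> n k)" using sum_\<nu>[OF elim] by simp
    also have "\<dots> \<le> (\<Sum>k\<in>{1..m n}. largest n)" by (intro sum_mono \<nu>_le_largest)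
    finally show ?case by simp
  qed
  have upper: "\<forall>\<^sub>F n in sequentially. real (m n) * largest n * (1 - \<epsilon>) \<le> 1" if "\<epsilon> > 0" for \<epsilon>
    using close[OF that] eventually_ge_at_top[of 2]
  proof eventually_elim
    case (elim n)
    have "real (m n) * largest n * (1 - \<epsilon>) = (\<Sum>k\<in>{1..m n}. largest n * (1 - \<epsilon>))" by simp
    also have "\<dots> \<le> (\<Sum>k\<in>{1..m n}. \<nu> n k)" using elim(1) by (intro sum_mono) auto
    also have "\<dots> = 1" by (rule sum_\<nu>[OF elim(2)])
    finally show ?case .
  qed
  have prod: "(\<lambda>n. real (m n) * largest n) \<longlonglongrightarrow> 1"
  proof (rule order_tendstoI)
    fix c :: real assume "c < 1"
    show "\<forall>\<^sub>F n in sequentially. c < real (m n) * largest n"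
      using lower by eventually_elim (use \<open>c < 1\<close> in linarith)
  next
    fix c :: real assume c: "1 < c"
    \<comment> \<open>This makes c (1 - \<epsilon>) = (c + 1) / 2, which exceeds 1.\<close>
    define \<epsilon> where "\<epsilon> = (1 - 1 / c) / 2"
    have \<epsilon>: "\<epsilon> > 0" using c by (simp add: \<epsilon>_def)
    have "c * (1 - \<epsilon>) > 1" using c by (simp add: \<epsilon>_def field_simps)
    moreover have "1 - \<epsilon> > 0" using c by (simp add: \<epsilon>_def field_simps)
    ultimately have *: "x < c" if "x * (1 - \<epsilon>) \<le> 1" for x
      using that by (smt (verit) mult_right_less_imp_less)
    show "\<forall>\<^sub>F n in sequentially. real (m n) * largest n < c"
      using upper[OF \<epsilon>] by eventually_elim (rule *)
  qed
  have "(\<lambda>n. real (m n) * largest n / largest n) \<longlonglongrightarrow> 1 / L"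
    using prod L by (intro tendsto_divide) auto
  moreover have "\<forall>\<^sub>F n in sequentially. real (m n) * largest n / largest n = real (m n)"
    using order_tendstoD(1)[OF L] by eventually_elim simp
  ultimately have m_lim: "(\<lambda>n. real (m n)) \<longlonglongrightarrow> 1 / L"
    by (rule Lim_transform_eventually)
  have "\<forall>\<^sub>F n in sequentially. dist (real (m n)) (1 / L) < 1 / 2"
    by (rule tendstoD[OF m_lim]) simp
  then obtain N where N: "\<And>n. n \<ge> N \<Longrightarrow> dist (real (m n)) (1 / L) < 1 / 2"
    unfolding eventually_sequentially by blast
  define m\<^sub>0 where "m\<^sub>0 = m (max N 2)"
  \<comment> \<open>Two integers within 1/2 of the same number coincide. The reference index
    \<open>max N 2\<close> also lies where \<open>m\<close> is known to be at least 2.\<close>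
  have m_eq: "m n = m\<^sub>0" if "n \<ge> N" for n
  proof -
    have "\<bar>real (m n) - real m\<^sub>0\<bar> < 1"
      using N[OF that] N[of "max N 2", OF max.cobounded1] unfolding dist_real_def m\<^sub>0_def by linarith
    then show ?thesis by linarith
  qed
  then have const: "\<forall>\<^sub>F n in sequentially. m n = m\<^sub>0" unfolding eventually_sequentially by blast
  have m\<^sub>0: "m\<^sub>0 \<ge> 2" unfolding m\<^sub>0_def by (rule m_ge) simp
  have "(\<lambda>n. real (m n)) \<longlonglongrightarrow> real m\<^sub>0"
    using const by (intro tendsto_eventually) (auto elim: eventually_mono)
  then have "real m\<^sub>0 = 1 / L" using m_lim LIMSEQ_unique by blast
  then have Lm: "L = 1 / real m\<^sub>0" by simp
  have "\<forall>\<^sub>F n in sequentially. \<forall>k\<in>{1..m n}. \<bar>\<nu> n k - 1 / real m\<^sub>0\<bar> \<le> \<epsilon>" if \<epsilon>: "\<epsilon> > 0" for \<epsilon>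
  proof -
    \<comment> \<open>An eventual upper bound for \<open>largest\<close>, so that the relative error
      \<open>\<delta>\<close> costs at most \<epsilon> / 2 in absolute terms.\<close>
    define q where "q = L + 1"
    have q: "q > 0" using L by (simp add: q_def)
    define \<delta> where "\<delta> = \<epsilon> / (2 * q)"
    have \<delta>: "\<delta> > 0" using \<epsilon> q by (simp add: \<delta>_def)
    have "\<forall>\<^sub>F n in sequentially. dist (largest n) L < min (\<epsilon> / 2) 1"
      by (rule tendstoD[OF L(1)]) (use \<epsilon> in simp)
    with close[OF \<delta>] show ?thesis
    proof eventually_elim
      case (elim n)
      show ?case
      proof
        fix k assume k: "k \<in> {1..m n}"
        have l: "\<bar>largest n - L\<bar> < \<epsilon> / 2" "largest n \<le> q" unfolding q_def using elim(2) by (auto simp: dist_real_def)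
        have "largest n * \<delta> \<le> q * \<delta>" using l(2) \<delta> by (intro mult_right_mono) auto
        also have "\<dots> = \<epsilon> / 2" using q by (simp add: \<delta>_def)
        finally have "largest n - \<epsilon> / 2 \<le> \<nu> n k"
          using elim(1) k by (force simp: algebra_simps)
        then show "\<bar>\<nu> n k - 1 / real m\<^sub>0\<bar> \<le> \<epsilon>"
          using \<nu>_le_largest[OF k] l(1) unfolding Lm[symmetric] by linarith
      qed
    qed
  qed
  then show ?thesis using that m\<^sub>0 const by blast
qed

end

section \<open>Identification of the limit densities and conclusion\<close>

lemma psi_density_eq:
  assumes "m\<^sub>0 > 0"
  shows "psi_density \<sigma>1 \<sigma>2 m\<^sub>0 = semicircle_density ((\<sigma>1\<^sup>2 + (real m\<^sub>0 - 1) * \<sigma>2\<^sup>2) / real m\<^sub>0)"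
  using assms by (intro ext) (simp add: psi_density_def semicircle_density_def)

lemma phi_density_eq:
  assumes "\<sigma>2 \<ge> 0"
  shows "phi_density \<sigma>2 = semicircle_density (\<sigma>2\<^sup>2)"
  using assms by (intro ext) (simp add: phi_density_def semicircle_density_def)

theorem theorem2:
  fixes M :: "'w measure"
    and K \<sigma>1 \<sigma>2 :: real
    and F1 F2 :: "real \<Rightarrow> real"
    and m :: "nat \<Rightarrow> nat"
    and V :: "nat \<Rightarrow> nat \<Rightarrow> nat set"
    and a :: "nat \<Rightarrow> nat \<Rightarrow> nat \<Rightarrow> 'w \<Rightarrow> real"
  assumes "prob_space M"
    and "K > 0" and "\<sigma>1 \<ge> 0" and "\<sigma>2 \<ge> 0"
    and "bounded_distribution_function K \<sigma>1 F1"
    and "bounded_distribution_function K \<sigma>2 F2"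
    and "\<And>n. n \<ge> 2 \<Longrightarrow> m n \<ge> 2"
    and "\<And>n. n \<ge> 2 \<Longrightarrow> inj_on (V n) {1..m n} \<and> partition_on {1..n} (V n ` {1..m n})"
    and "\<And>n i j \<omega>. n \<ge> 2 \<Longrightarrow> i \<in> {1..n} \<Longrightarrow> j \<in> {1..n} \<Longrightarrow> \<omega> \<in> space M \<Longrightarrow>
           a n i j \<omega> = a n j i \<omega>"
    and "\<And>n. n \<ge> 2 \<Longrightarrow>
           prob_space.indep_vars M (\<lambda>_. borel) (\<lambda>(i, j). a n i j) {(i, j). 1 \<le> i \<and> i \<le> j \<and> j \<le> n}"
    and "\<And>n k i j. n \<ge> 2 \<Longrightarrow> k \<in> {1..m n} \<Longrightarrow> i \<in> V n k \<Longrightarrow> j \<in> V n k \<Longrightarrow>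
           has_distribution_function M (a n i j) F1"
    and "\<And>n k i j. n \<ge> 2 \<Longrightarrow> k \<in> {1..m n} \<Longrightarrow> i \<in> V n k \<Longrightarrow> j \<in> {1..n} - V n k \<Longrightarrow>
           has_distribution_function M (a n i j) F2"
  shows "((\<sigma>1 > 0 \<or> \<sigma>2 > 0) \<longrightarrow>
          (\<exists>L>0. (\<lambda>n. Max (part_fraction V n ` {1..m n})) \<longlonglongrightarrow> L) \<longrightarrow>
          (\<forall>\<epsilon>>0. \<forall>\<^sub>F n in sequentially. \<forall>i\<in>{1..m n}. \<forall>j\<in>{1..m n}.
              \<bar>part_fraction V n i / part_fraction V n j - 1\<bar> < \<epsilon>) \<longrightarrow>
          (\<exists>m\<^sub>0. (\<forall>\<^sub>F n in sequentially. m n = m\<^sub>0) \<and>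
            (AE \<omega> in M. \<forall>x. (\<lambda>n. esd (scaled_matrix a n \<omega>) x)
               \<longlonglongrightarrow> cdf_of_density (psi_density \<sigma>1 \<sigma>2 m\<^sub>0) x)))
       \<and> (\<sigma>2 > 0 \<longrightarrow>
          (\<lambda>n. Max (part_fraction V n ` {1..m n})) \<longlonglongrightarrow> 0 \<longrightarrow>
          (AE \<omega> in M. \<forall>x. (\<lambda>n. esd (scaled_matrix a n \<omega>) x)
             \<longlonglongrightarrow> cdf_of_density (phi_density \<sigma>2) x))"
proof -
  interpret prob_space M by fact
  interpret block_partition m V by unfold_locales (rule assms(7), assumption, rule assms(8), assumption)
  obtain \<mu>1 where \<mu>1: "real_distribution \<mu>1" "cdf \<mu>1 = F1" "AE x in \<mu>1. \<bar>x\<bar> \<le> K"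
    "prob_space.variance \<mu>1 (\<lambda>x. x) = \<sigma>1\<^sup>2"
    using assms(5) unfolding bounded_distribution_function_def by blast
  obtain \<mu>2 where \<mu>2: "real_distribution \<mu>2" "cdf \<mu>2 = F2" "AE x in \<mu>2. \<bar>x\<bar> \<le> K"
    "prob_space.variance \<mu>2 (\<lambda>x. x) = \<sigma>2\<^sup>2"
    using assms(6) unfolding bounded_distribution_function_def by blast
  define D where "D c = (if c then \<mu>1 else \<mu>2)" for c
  define \<sigma> where "\<sigma> c = (if c then \<sigma>1 else \<sigma>2)" for c
  \<comment> \<open>Distribution functions determine laws, so the assumptions on F1 and F2 become
    equalities of measures.\<close>
  have entry: "a n i j \<in> borel_measurable M \<and> distr M borel (a n i j) = D (same_block n i j)"
    if n: "n \<ge> 2" and ij: "i \<in> {1..n}" "j \<in> {1..n}" for n i j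
  proof -
    obtain k where k: "k \<in> {1..m n}" "i \<in> V n k" using block_exists[OF n ij(1)] by blast
    have "has_distribution_function M (a n i j) (cdf (D (same_block n i j)))"
    proof (cases "j \<in> V n k")
      case True
      then show ?thesis using assms(11)[OF n k True] same_block_iff[OF n k, of j] by (simp add: D_def \<mu>1)
    next
      case False
      then show ?thesis using assms(12)[OF n k, of j] ij same_block_iff[OF n k, of j] by (simp add: D_def \<mu>2)
    qed
    then have am: "a n i j \<in> borel_measurable M" and c: "cdf (distr M borel (a n i j)) = cdf (D (same_block n i j))"
      by (auto simp: has_distribution_function_def)
    have "real_distribution (D (same_block n i j))" using \<mu>1 \<mu>2 by (simp add: D_def)
    moreover have "real_distribution (distr M borel (a n i j))"
      using prob_space_distr[OF am] by (simp add: real_distribution_def real_distribution_axioms_def)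
    ultimately show ?thesis using cdf_unique c am by blast
  qed
  interpret two_distribution_matrix M K \<sigma> D same_block a
  proof (intro two_distribution_matrix.intro two_distribution_matrix_axioms.intro)
    show "prob_space M" by fact
    show "K > 0" by fact
    show "real_distribution (D c)" for c using \<mu>1(1) \<mu>2(1) by (simp add: D_def)
    show "AE x in D c. \<bar>x\<bar> \<le> K" for c using \<mu>1(3) \<mu>2(3) unfolding D_def by presburger
    show "prob_space.variance (D c) (\<lambda>x. x) = (\<sigma> c)\<^sup>2" for c
      using \<mu>1(4) \<mu>2(4) by (cases c) (simp_all add: D_def \<sigma>_def)
    show "same_block n i j = same_block n j i" for n i j by (rule same_block_commute)
    show "a n i j \<omega> = a n j i \<omega>" if "n \<ge> 2" "i \<in> {1..n}" "j \<in> {1..n}" "\<omega> \<in> space M" for n i j \<omega>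
      using assms(9) that by blast
    show "indep_vars (\<lambda>_. borel) (\<lambda>(i, j). a n i j) (edges n)" if "n \<ge> 2" for n
      unfolding edges_def using assms(10)[OF that] .
    show "a n i j \<in> borel_measurable M" if "n \<ge> 2" "i \<in> {1..n}" "j \<in> {1..n}" for n i j
      using entry[OF that] by blast
    show "distr M borel (a n i j) = D (same_block n i j)" if "n \<ge> 2" "i \<in> {1..n}" "j \<in> {1..n}" for n i j
      using entry[OF that] by blast
  qed
  have largest: "(\<lambda>n. Max (part_fraction V n ` {1..m n})) = largest"
    by (simp add: largest_def fun_eq_iff)
  show ?thesis
    unfolding largest
  proof (intro conjI impI)
    assume pos: "\<sigma>1 > 0 \<or> \<sigma>2 > 0" and ex: "\<exists>L>0. largest \<longlonglongrightarrow> L"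
      and ratio: "\<forall>\<epsilon>>0. \<forall>\<^sub>F n in sequentially. \<forall>i\<in>{1..m n}. \<forall>j\<in>{1..m n}.
              \<bar>part_fraction V n i / part_fraction V n j - 1\<bar> < \<epsilon>"
    obtain L where L: "largest \<longlonglongrightarrow> L" "L > 0" using ex by blast
    obtain m\<^sub>0 where m\<^sub>0: "m\<^sub>0 \<ge> 2" "\<forall>\<^sub>F n in sequentially. m n = m\<^sub>0"
      "\<And>\<epsilon>. \<epsilon> > 0 \<Longrightarrow> \<forall>\<^sub>F n in sequentially. \<forall>k\<in>{1..m n}. \<bar>part_fraction V n k - 1 / real m\<^sub>0\<bar> \<le> \<epsilon>"
      using equal_blocks[OF L] ratio by blast
    define s where "s = (\<sigma>1\<^sup>2 + (real m\<^sub>0 - 1) * \<sigma>2\<^sup>2) / real m\<^sub>0"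
    \<comment> \<open>Both weights are positive because m0 is at least 2, so one nonzero deviation
      suffices.\<close>
    have "\<sigma>1\<^sup>2 + (real m\<^sub>0 - 1) * \<sigma>2\<^sup>2 > 0"
      using pos m\<^sub>0(1) by (auto intro: add_pos_nonneg add_nonneg_pos)
    then have s: "s > 0" using m\<^sub>0(1) by (simp add: s_def)
    have s_eq: "s = (\<sigma> True)\<^sup>2 * (1 / real m\<^sub>0) + (\<sigma> False)\<^sup>2 * (1 - 1 / real m\<^sub>0)"
      using m\<^sub>0(1) by (simp add: s_def \<sigma>_def field_simps)
    have "AE \<omega> in M. \<forall>x. (\<lambda>n. esd (scaled_matrix a n \<omega>) x) \<longlonglongrightarrow> cdf (semicircle s) x"
      by (rule semicircle_law[OF s row_average[where w = "\<lambda>c. (\<sigma> c)\<^sup>2", OF m\<^sub>0(3) s_eq] mean_perturbation_bounded_rank[OF m\<^sub>0(2)]])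
    moreover have "cdf_of_density (psi_density \<sigma>1 \<sigma>2 m\<^sub>0) = cdf (semicircle s)"
      using m\<^sub>0(1) by (simp add: cdf_of_density_def psi_density_eq semicircle_def s_def)
    ultimately show "\<exists>m\<^sub>0. (\<forall>\<^sub>F n in sequentially. m n = m\<^sub>0) \<and>
        (AE \<omega> in M. \<forall>x. (\<lambda>n. esd (scaled_matrix a n \<omega>) x) \<longlonglongrightarrow> cdf_of_density (psi_density \<sigma>1 \<sigma>2 m\<^sub>0) x)"
      using m\<^sub>0(2) by auto
  next
    assume \<sigma>2: "\<sigma>2 > 0" and lim: "largest \<longlonglongrightarrow> 0"
    have s: "\<sigma>2\<^sup>2 > 0" using \<sigma>2 by simp
    \<comment> \<open>The limit fraction is 0: vanishing blocks leave only the variance between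
      blocks.\<close>
    have s_eq: "\<sigma>2\<^sup>2 = (\<sigma> True)\<^sup>2 * 0 + (\<sigma> False)\<^sup>2 * (1 - 0)" by (simp add: \<sigma>_def)
    have small: "\<forall>\<^sub>F n in sequentially. \<forall>k\<in>{1..m n}. part_fraction V n k \<le> \<epsilon>" if "\<epsilon> > 0" for \<epsilon>
      using small_blocks[OF lim that] by eventually_elim auto
    have "AE \<omega> in M. \<forall>x. (\<lambda>n. esd (scaled_matrix a n \<omega>) x) \<longlonglongrightarrow> cdf (semicircle (\<sigma>2\<^sup>2)) x"
      by (rule semicircle_law[OF s row_average[where w = "\<lambda>c. (\<sigma> c)\<^sup>2", OF small_blocks[OF lim] s_eq] mean_perturbation_small_blocks[OF small]])
    moreover have "cdf_of_density (phi_density \<sigma>2) = cdf (semicircle (\<sigma>2\<^sup>2))"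
      using assms(4) by (simp add: cdf_of_density_def phi_density_eq semicircle_def)
    ultimately show "AE \<omega> in M. \<forall>x. (\<lambda>n. esd (scaled_matrix a n \<omega>) x) \<longlonglongrightarrow> cdf_of_density (phi_density \<sigma>2) x"
      by simp
  qed
qed

end
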